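(* The distribution $\Delta$ associated to a smooth Haefliger cocycle on a manifold $M$ is integrable (i.e. is a Stefan–Sussmann singular foliation).
   Context: Manifolds are smooth, connected, paracompact, Hausdorff and without boundary. $\Gamma_q$ is the groupoid of germs of local diffeomorphisms of $\mathbb R^q$, with object space $\mathbb R^q$, topologised by the basis of sets $\{\mathrm{germ}_{x'}(g):x'\in U\}$ ($g$ a local diffeomorphism, $U\subset\mathrm{dom}(g)$ open) and with the (non-Hausdorff) manifold structure making source and range local diffeomorphisms. A smooth Haefliger cocycle on $M$ consists of an open cover $\{U_\alpha\}$ and smooth maps $h_{\alpha\beta}\colon U_\alpha\cap U_\beta\to\Gamma_q$ with $h_{\alpha\beta}(x)h_{\beta\delta}(x)=h_{\alpha\delta}(x)$ on triple overlaps. Then $h_{\alpha\alpha}(x)$ is the identity germ at a point $f_\alpha(x)$; the smooth maps $f_\alpha\colon U_\alpha\to\mathbb R^q$ are the Haefliger charts, and $f_\alpha=g\circ f_\beta$ near $x$ for $g$ representing $h_{\alpha\beta}(x)$. The associated differential ideal $\mathcal I$ is generated over $U_\alpha$ by the 1-forms $\omega^i_\alpha=f_\alpha^*dx^i$, $i=1,\dots,q$ ($x^i$ the standard coordinates on $\mathbb R^q$). The associated sheaf of vector fields is $\mathcal D(U)=\{X\in\mathfrak X(U):\omega(X)=0\text{ for all 1-forms }\omega\in\mathcal I(U)\}$, and the associated distribution $\Delta\subset TM$ is the one spanned by it: $\Delta_x$ is the set of values at $x$ of local sections of $\mathcal D$ near $x$. A smooth distribution is a fibrewise linear subset $\Delta\subseteq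 TM$, of possibly varying rank, spanned by a subsheaf of the sheaf of vector fields. An integral submanifold is an immersed submanifold $\iota\colon S\to M$ (not necessarily a homeomorphism onto its image) with $d\iota(T_xS)=\Delta_{\iota(x)}$ for every $x\in S$. The distribution is integrable (Stefan–Sussmann) if it has an integral submanifold through each point of $M$. *)

theory Defs
  imports "HOL-Analysis.Analysis"
begin

section \<open>Smooth functions on coordinate spaces\<close>

text \<open>
  Dimensions have to vary inside statements (integral submanifolds of a distribution of varying
  rank have different dimensions) and may be 0.  Hence \<open>\<real>\<^sup>n\<close> is the coordinate subspace
  \<open>span B\<close> of a Euclidean space, where \<open>B \<subseteq> Basis\<close> and \<open>n = card B\<close>; its standard coordinates
  are \<open>x \<mapsto> x \<bullet> b\<close> for \<open>b \<in> B\<close>.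
\<close>

abbreviation coord_top :: "'a::euclidean_space set \<Rightarrow> 'a topology" where
  "coord_top B \<equiv> top_of_set (span B)"

text \<open>
  The Frechet derivative along \<open>span B\<close>.  At points of \<open>span B\<close> it is uniquely determined on
  vectors of \<open>span B\<close>, and it is only ever applied to such vectors.
\<close>

definition deriv_along :: "'a::euclidean_space set \<Rightarrow> ('a \<Rightarrow> 'b::real_normed_vector) \<Rightarrow> 'a \<Rightarrow> 'a \<Rightarrow> 'b"
  where "deriv_along B f x v = frechet_derivative f (at x within span B) v"

text \<open>Both notions below are meant for \<open>A\<close> open in \<open>span B\<close>.\<close>

primrec Ck_on :: "'a::euclidean_space set \<Rightarrow> nat \<Rightarrow> 'a set \<Rightarrow> ('a \<Rightarrow> 'b::real_normed_vector) \<Rightarrow> bool"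
  where
    "Ck_on B 0 A f \<longleftrightarrow> continuous_on A f"
  | "Ck_on B (Suc k) A f \<longleftrightarrow>
       (\<forall>x\<in>A. f differentiable (at x within span B)) \<and>
       (\<forall>b\<in>B. Ck_on B k A (\<lambda>x. deriv_along B f x b))"

definition smooth_on :: "'a::euclidean_space set \<Rightarrow> 'a set \<Rightarrow> ('a \<Rightarrow> 'b::real_normed_vector) \<Rightarrow> bool"
  where "smooth_on B A f \<longleftrightarrow> (\<forall>k. Ck_on B k A f)"


section \<open>Manifolds\<close>

text \<open>A chart consists of its domain and its coordinate map (relevant only on the domain).\<close>

type_synonym ('m, 'e) chart = "'m set \<times> ('m \<Rightarrow> 'e)"

record ('m, 'e) manifold =
  mtop :: "'m topology"
  atlas :: "('m, 'e) chart set"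
  axes :: "'e set"

abbreviation points :: "('m, 'e, 'z) manifold_scheme \<Rightarrow> 'm set" where
  "points M \<equiv> topspace (mtop M)"

definition chart_inv :: "('m, 'e) chart \<Rightarrow> 'e \<Rightarrow> 'm" where
  "chart_inv c = inv_into (fst c) (snd c)"

definition charts_at :: "('m, 'e) manifold \<Rightarrow> 'm \<Rightarrow> ('m, 'e) chart set" where
  "charts_at M p = {c \<in> atlas M. p \<in> fst c}"

definition chart_at :: "('m, 'e) manifold \<Rightarrow> 'm \<Rightarrow> ('m, 'e) chart" where
  "chart_at M p = (SOME c. c \<in> charts_at M p)"

text \<open>
  A space with a smooth atlas; no separation or countability condition is imposed, because the
  space of germs below is not Hausdorff.  The atlas need not be maximal.
\<close>

definition smooth_structure :: "('m, 'e::euclidean_space) manifold \<Rightarrow> bool" where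
  "smooth_structure M \<longleftrightarrow>
     axes M \<subseteq> Basis \<and>
     \<Union>(fst ` atlas M) = points M \<and>
     (\<forall>c\<in>atlas M.
        openin (mtop M) (fst c) \<and>
        openin (coord_top (axes M)) (snd c ` fst c) \<and>
        homeomorphic_map (subtopology (mtop M) (fst c)) (top_of_set (snd c ` fst c)) (snd c)) \<and>
     (\<forall>c\<in>atlas M. \<forall>d\<in>atlas M.
        smooth_on (axes M) (snd c ` (fst c \<inter> fst d)) (snd d \<circ> chart_inv c))"

definition paracompact_space :: "'m topology \<Rightarrow> bool" where
  "paracompact_space T \<longleftrightarrow>
     (\<forall>\<U>. (\<forall>U\<in>\<U>. openin T U) \<and> \<Union>\<U> = topspace T \<longrightarrow>
        (\<exists>\<V>. (\<forall>V\<in>\<V>. openin T V \<and> (\<exists>U\<in>\<U>. V \<subseteq> U)) \<and> \<Union>\<V> = topspace T \<and>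
             locally_finite_in T \<V>))"

definition smooth_manifold :: "('m, 'e::euclidean_space) manifold \<Rightarrow> bool" where
  "smooth_manifold M \<longleftrightarrow>
     smooth_structure M \<and> connected_space (mtop M) \<and>
     paracompact_space (mtop M) \<and> Hausdorff_space (mtop M)"

definition smooth_map_on ::
  "('m, 'e::euclidean_space) manifold \<Rightarrow> 'm set \<Rightarrow> ('n, 'f::euclidean_space) manifold \<Rightarrow> ('m \<Rightarrow> 'n) \<Rightarrow> bool"
  where "smooth_map_on M U N f \<longleftrightarrow>
     continuous_map (subtopology (mtop M) U) (mtop N) f \<and>
     (\<forall>c\<in>atlas M. \<forall>d\<in>atlas N.
        smooth_on (axes M) (snd c ` {p \<in> U \<inter> fst c. f p \<in> fst d}) (snd d \<circ> f \<circ> chart_inv c))"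

definition smooth_fun_on ::
  "('m, 'e::euclidean_space) manifold \<Rightarrow> 'm set \<Rightarrow> ('m \<Rightarrow> 'v::real_normed_vector) \<Rightarrow> bool"
  where "smooth_fun_on M U f \<longleftrightarrow>
     (\<forall>c\<in>atlas M. smooth_on (axes M) (snd c ` (U \<inter> fst c)) (f \<circ> chart_inv c))"


section \<open>Tangent vectors, vector fields and 1-forms\<close>

text \<open>
  A tangent vector at \<open>p\<close> is the family of its coordinate vectors in the charts around \<open>p\<close>,
  related by the derivatives of the coordinate changes; it is set to 0 on everything that is not a
  chart around \<open>p\<close>, so that equality of tangent vectors is equality of families.
\<close>

type_synonym ('m, 'e) tvec = "('m, 'e) chart \<Rightarrow> 'e"

definition tangent_space :: "('m, 'e::euclidean_space) manifold \<Rightarrow> 'm \<Rightarrow> ('m, 'e) tvec set" where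
  "tangent_space M p =
     {\<xi>. (\<forall>c\<in>charts_at M p. \<xi> c \<in> span (axes M)) \<and>
         (\<forall>c\<in>charts_at M p. \<forall>d\<in>charts_at M p.
            \<xi> d = deriv_along (axes M) (snd d \<circ> chart_inv c) (snd c p) (\<xi> c)) \<and>
         (\<forall>c. c \<notin> charts_at M p \<longrightarrow> \<xi> c = 0)}"

definition tangent_of_coord ::
  "('m, 'e::euclidean_space) manifold \<Rightarrow> ('m, 'e) chart \<Rightarrow> 'm \<Rightarrow> 'e \<Rightarrow> ('m, 'e) tvec" where
  "tangent_of_coord M c p v =
     (\<lambda>d. if d \<in> charts_at M p then deriv_along (axes M) (snd d \<circ> chart_inv c) (snd c p) v else 0)"

text \<open>
  Differentials of vector-valued functions and of maps between manifolds.  On tangent vectors they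
  do not depend on the chart of the domain that is used.
\<close>

definition fun_differential ::
  "('m, 'e::euclidean_space) manifold \<Rightarrow> ('m \<Rightarrow> 'v::real_normed_vector) \<Rightarrow> 'm \<Rightarrow> ('m, 'e) tvec \<Rightarrow> 'v"
  where "fun_differential M f p \<xi> =
     (let c = chart_at M p in deriv_along (axes M) (f \<circ> chart_inv c) (snd c p) (\<xi> c))"

definition map_differential ::
  "('m, 'e::euclidean_space) manifold \<Rightarrow> ('n, 'f::euclidean_space) manifold \<Rightarrow> ('m \<Rightarrow> 'n) \<Rightarrow>
   'm \<Rightarrow> ('m, 'e) tvec \<Rightarrow> ('n, 'f) tvec"
  where "map_differential M N f p \<xi> =
     (let c = chart_at M p in
       (\<lambda>d. if d \<in> charts_at N (f p)
            then deriv_along (axes M) (snd d \<circ> f \<circ> chart_inv c) (snd c p) (\<xi> c) else 0))"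

definition linear_subspace_at ::
  "('m, 'e::euclidean_space) manifold \<Rightarrow> 'm \<Rightarrow> ('m, 'e) tvec set \<Rightarrow> bool" where
  "linear_subspace_at M p L \<longleftrightarrow>
     L \<subseteq> tangent_space M p \<and> (\<lambda>c. 0) \<in> L \<and>
     (\<forall>\<xi>\<in>L. \<forall>\<eta>\<in>L. (\<lambda>c. \<xi> c + \<eta> c) \<in> L) \<and>
     (\<forall>a. \<forall>\<xi>\<in>L. (\<lambda>c. a *\<^sub>R \<xi> c) \<in> L)"

definition span_at ::
  "('m, 'e::euclidean_space) manifold \<Rightarrow> 'm \<Rightarrow> ('m, 'e) tvec set \<Rightarrow> ('m, 'e) tvec set" where
  "span_at M p A = \<Inter>{L. linear_subspace_at M p L \<and> A \<subseteq> L}"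

text \<open>
  Sections over an open set \<open>U\<close> are represented by total functions; only their values at points of
  \<open>U\<close> matter (for 1-forms, only on tangent vectors at points of \<open>U\<close>).
\<close>

definition vector_field_on ::
  "('m, 'e::euclidean_space) manifold \<Rightarrow> 'm set \<Rightarrow> ('m \<Rightarrow> ('m, 'e) tvec) \<Rightarrow> bool" where
  "vector_field_on M U X \<longleftrightarrow>
     (\<forall>p\<in>U. X p \<in> tangent_space M p) \<and>
     (\<forall>c\<in>atlas M. smooth_on (axes M) (snd c ` (U \<inter> fst c)) (\<lambda>y. X (chart_inv c y) c))"

definition one_form_on ::
  "('m, 'e::euclidean_space) manifold \<Rightarrow> 'm set \<Rightarrow> ('m \<Rightarrow> ('m, 'e) tvec \<Rightarrow> real) \<Rightarrow> bool" where
  "one_form_on M U \<omega> \<longleftrightarrow>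
     (\<forall>p\<in>U. \<forall>\<xi>\<in>tangent_space M p. \<forall>\<eta>\<in>tangent_space M p.
        \<omega> p (\<lambda>c. \<xi> c + \<eta> c) = \<omega> p \<xi> + \<omega> p \<eta>) \<and>
     (\<forall>p\<in>U. \<forall>\<xi>\<in>tangent_space M p. \<forall>a. \<omega> p (\<lambda>c. a *\<^sub>R \<xi> c) = a * \<omega> p \<xi>) \<and>
     (\<forall>c\<in>atlas M. \<forall>b\<in>axes M.
        smooth_on (axes M) (snd c ` (U \<inter> fst c))
          (\<lambda>y. \<omega> (chart_inv c y) (tangent_of_coord M c (chart_inv c y) b)))"


section \<open>Distributions and integrability\<close>

text \<open>
  Because sections are total functions, the restriction axiom says that any function agreeing on
  \<open>V\<close> with a section over a larger open set is a section over \<open>V\<close>, and the gluing axiom may be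
  stated for a single total function.
\<close>

definition vector_field_subsheaf ::
  "('m, 'e::euclidean_space) manifold \<Rightarrow> ('m set \<Rightarrow> ('m \<Rightarrow> ('m, 'e) tvec) set) \<Rightarrow> bool" where
  "vector_field_subsheaf M F \<longleftrightarrow>
     (\<forall>U. openin (mtop M) U \<longrightarrow> F U \<subseteq> {X. vector_field_on M U X}) \<and>
     (\<forall>U V X Y. openin (mtop M) U \<and> openin (mtop M) V \<and> V \<subseteq> U \<and> X \<in> F U \<and> (\<forall>p\<in>V. Y p = X p)
        \<longrightarrow> Y \<in> F V) \<and>
     (\<forall>\<V> X. (\<forall>V\<in>\<V>. openin (mtop M) V \<and> X \<in> F V) \<longrightarrow> X \<in> F (\<Union>\<V>))"

definition section_values ::
  "('m, 'e) manifold \<Rightarrow> ('m set \<Rightarrow> ('m \<Rightarrow> ('m, 'e) tvec) set) \<Rightarrow> 'm \<Rightarrow> ('m, 'e) tvec set" where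
  "section_values M F p = {X p | X V. openin (mtop M) V \<and> p \<in> V \<and> X \<in> F V}"

definition smooth_distribution ::
  "('m, 'e::euclidean_space) manifold \<Rightarrow> ('m \<Rightarrow> ('m, 'e) tvec set) \<Rightarrow> bool" where
  "smooth_distribution M \<Delta> \<longleftrightarrow>
     (\<forall>p\<in>points M. linear_subspace_at M p (\<Delta> p)) \<and>
     (\<exists>F. vector_field_subsheaf M F \<and> (\<forall>p\<in>points M. \<Delta> p = span_at M p (section_values M F p)))"

definition immersed_submanifold ::
  "('s, 'f::euclidean_space) manifold \<Rightarrow> ('s \<Rightarrow> 'm) \<Rightarrow> ('m, 'e::euclidean_space) manifold \<Rightarrow> bool" where
  "immersed_submanifold S \<iota> M \<longleftrightarrow>
     smooth_manifold S \<and> smooth_map_on S (points S) M \<iota> \<and> inj_on \<iota> (points S) \<and>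
     (\<forall>x\<in>points S. inj_on (map_differential S M \<iota> x) (tangent_space S x))"

definition integral_submanifold ::
  "('m, 'e::euclidean_space) manifold \<Rightarrow> ('m \<Rightarrow> ('m, 'e) tvec set) \<Rightarrow>
   ('s, 'f::euclidean_space) manifold \<Rightarrow> ('s \<Rightarrow> 'm) \<Rightarrow> bool" where
  "integral_submanifold M \<Delta> S \<iota> \<longleftrightarrow>
     immersed_submanifold S \<iota> M \<and>
     (\<forall>x\<in>points S. map_differential S M \<iota> x ` tangent_space S x = \<Delta> (\<iota> x))"

text \<open>
  Injectivity of \<open>\<iota>\<close> and of its differential shows that, up to isomorphism, every immersed
  submanifold of \<open>M\<close> is carried by a set of points of type \<open>'m\<close> and modelled on a coordinate
  subspace of \<open>'e\<close>, so the types of \<open>S\<close> in the next definition are no restriction.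
\<close>

definition integrable_distribution ::
  "('m, 'e::euclidean_space) manifold \<Rightarrow> ('m \<Rightarrow> ('m, 'e) tvec set) \<Rightarrow> bool" where
  "integrable_distribution M \<Delta> \<longleftrightarrow>
     smooth_distribution M \<Delta> \<and>
     (\<forall>p\<in>points M. \<exists>(S :: ('m, 'e) manifold) \<iota>.
        integral_submanifold M \<Delta> S \<iota> \<and> p \<in> \<iota> ` points S)"


section \<open>The groupoid of germs of local diffeomorphisms\<close>

text \<open>Here \<open>\<real>\<^sup>q\<close> is \<open>span Q\<close> with \<open>q = card Q\<close>.\<close>

definition local_diffeo :: "'q::euclidean_space set \<Rightarrow> 'q set \<Rightarrow> ('q \<Rightarrow> 'q) \<Rightarrow> bool" where
  "local_diffeo Q U g \<longleftrightarrow>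
     openin (coord_top Q) U \<and> openin (coord_top Q) (g ` U) \<and> inj_on g U \<and>
     smooth_on Q U g \<and> smooth_on Q (g ` U) (inv_into U g)"

text \<open>
  A germ is its source together with the set of all functions representing it, that is, of all
  total functions that agree near the source with a given one.
\<close>

type_synonym 'q germ = "'q \<times> ('q \<Rightarrow> 'q) set"

definition germ_at :: "'q::euclidean_space set \<Rightarrow> ('q \<Rightarrow> 'q) \<Rightarrow> 'q \<Rightarrow> 'q germ" where
  "germ_at Q g x = (x, {h. \<exists>V. openin (coord_top Q) V \<and> x \<in> V \<and> (\<forall>y\<in>V. h y = g y)})"

definition germ_rep :: "'q germ \<Rightarrow> 'q \<Rightarrow> 'q" where
  "germ_rep \<gamma> = (SOME g. g \<in> snd \<gamma>)"

definition germ_source :: "'q germ \<Rightarrow> 'q" where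
  "germ_source \<gamma> = fst \<gamma>"

definition germ_range :: "'q germ \<Rightarrow> 'q" where
  "germ_range \<gamma> = germ_rep \<gamma> (germ_source \<gamma>)"

definition germ_comp :: "'q::euclidean_space set \<Rightarrow> 'q germ \<Rightarrow> 'q germ \<Rightarrow> 'q germ" where
  "germ_comp Q \<gamma> \<gamma>' = germ_at Q (germ_rep \<gamma> \<circ> germ_rep \<gamma>') (germ_source \<gamma>')"

text \<open>The charts of the germ space are the restrictions of the source map to basic open sets.\<close>

definition Gamma :: "'q::euclidean_space set \<Rightarrow> ('q germ, 'q) manifold" where
  "Gamma Q =
     \<lparr> mtop = topology_generated_by {germ_at Q g ` U | g U. local_diffeo Q U g},
       atlas = {(germ_at Q g ` U, germ_source) | g U. local_diffeo Q U g},
       axes = Q \<rparr>"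


section \<open>Haefliger cocycles and their distributions\<close>

text \<open>Products of germs require the source of the left factor to be the range of the right one.\<close>

definition haefliger_cocycle ::
  "('m, 'e::euclidean_space) manifold \<Rightarrow> 'q::euclidean_space set \<Rightarrow> 'i set \<Rightarrow> ('i \<Rightarrow> 'm set) \<Rightarrow>
   ('i \<Rightarrow> 'i \<Rightarrow> 'm \<Rightarrow> 'q germ) \<Rightarrow> bool" where
  "haefliger_cocycle M Q I U h \<longleftrightarrow>
     (\<forall>\<alpha>\<in>I. openin (mtop M) (U \<alpha>)) \<and> (\<Union>\<alpha>\<in>I. U \<alpha>) = points M \<and>
     (\<forall>\<alpha>\<in>I. \<forall>\<beta>\<in>I. smooth_map_on M (U \<alpha> \<inter> U \<beta>) (Gamma Q) (h \<alpha> \<beta>)) \<and>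
     (\<forall>\<alpha>\<in>I. \<forall>\<beta>\<in>I. \<forall>\<delta>\<in>I. \<forall>x\<in>U \<alpha> \<inter> U \<beta> \<inter> U \<delta>.
        germ_source (h \<alpha> \<beta> x) = germ_range (h \<beta> \<delta> x) \<and>
        germ_comp Q (h \<alpha> \<beta> x) (h \<beta> \<delta> x) = h \<alpha> \<delta> x)"

definition haefliger_chart :: "('i \<Rightarrow> 'i \<Rightarrow> 'm \<Rightarrow> 'q germ) \<Rightarrow> 'i \<Rightarrow> 'm \<Rightarrow> 'q" where
  "haefliger_chart h \<alpha> x = germ_source (h \<alpha> \<alpha> x)"

text \<open>The pullback \<open>f\<^sup>* dx\<^sup>i\<close> of a standard coordinate form along an \<open>\<real>\<^sup>q\<close>-valued function.\<close>

definition pullback_dx ::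
  "('m, 'e::euclidean_space) manifold \<Rightarrow> ('m \<Rightarrow> 'q::euclidean_space) \<Rightarrow> 'q \<Rightarrow>
   'm \<Rightarrow> ('m, 'e) tvec \<Rightarrow> real" where
  "pullback_dx M f i p \<xi> = fun_differential M f p \<xi> \<bullet> i"

text \<open>
  The 1-forms over \<open>W\<close> in the sheaf of ideals generated over each \<open>U \<alpha>\<close> by the forms
  \<open>f\<^sub>\<alpha>\<^sup>* dx\<^sup>i\<close>: since the generators have degree 1, the degree-1 part of the ideal consists of the
  1-forms that are locally combinations of the generators with smooth functions as coefficients.
\<close>

definition haefliger_ideal ::
  "('m, 'e::euclidean_space) manifold \<Rightarrow> 'q::euclidean_space set \<Rightarrow> 'i set \<Rightarrow> ('i \<Rightarrow> 'm set) \<Rightarrow>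
   ('i \<Rightarrow> 'i \<Rightarrow> 'm \<Rightarrow> 'q germ) \<Rightarrow> 'm set \<Rightarrow> ('m \<Rightarrow> ('m, 'e) tvec \<Rightarrow> real) set" where
  "haefliger_ideal M Q I U h W =
     {\<omega>. one_form_on M W \<omega> \<and>
         (\<forall>\<alpha>\<in>I. \<forall>x\<in>W \<inter> U \<alpha>. \<exists>V a.
            openin (mtop M) V \<and> x \<in> V \<and> V \<subseteq> W \<inter> U \<alpha> \<and>
            (\<forall>i\<in>Q. smooth_fun_on M V (a i)) \<and>
            (\<forall>p\<in>V. \<forall>\<xi>\<in>tangent_space M p.
               \<omega> p \<xi> = (\<Sum>i\<in>Q. a i p * pullback_dx M (haefliger_chart h \<alpha>) i p \<xi>)))}"

definition haefliger_sheaf ::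
  "('m, 'e::euclidean_space) manifold \<Rightarrow> 'q::euclidean_space set \<Rightarrow> 'i set \<Rightarrow> ('i \<Rightarrow> 'm set) \<Rightarrow>
   ('i \<Rightarrow> 'i \<Rightarrow> 'm \<Rightarrow> 'q germ) \<Rightarrow> 'm set \<Rightarrow> ('m \<Rightarrow> ('m, 'e) tvec) set" where
  "haefliger_sheaf M Q I U h W =
     {X. vector_field_on M W X \<and>
         (\<forall>\<omega>\<in>haefliger_ideal M Q I U h W. \<forall>p\<in>W. \<omega> p (X p) = 0)}"

definition haefliger_distribution ::
  "('m, 'e::euclidean_space) manifold \<Rightarrow> 'q::euclidean_space set \<Rightarrow> 'i set \<Rightarrow> ('i \<Rightarrow> 'm set) \<Rightarrow>
   ('i \<Rightarrow> 'i \<Rightarrow> 'm \<Rightarrow> 'q germ) \<Rightarrow> 'm \<Rightarrow> ('m, 'e) tvec set" where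
  "haefliger_distribution M Q I U h p = section_values M (haefliger_sheaf M Q I U h) p"

end

theory Submission
  imports Defs
begin

text \<open>
  A vector field belongs to the Haefliger sheaf exactly when it annihilates all Haefliger charts
  \<open>f\<^sub>\<alpha>\<close>, i.e. is tangent to their level sets (\<open>haefliger_sheaf_iff\<close>; bump functions are needed to
  extend the local generators \<open>f\<^sub>\<alpha>\<^sup>* dx\<^sup>i\<close> of the ideal to sections over larger sets, and the relation
  \<open>f\<^sub>\<alpha> = g \<circ> f\<^sub>\<beta>\<close> to see that the extensions lie in the ideal).  In a chart the distribution is thus
  the set of values of smooth fields \<open>Y\<close> with \<open>dF(Y) = 0\<close>, for one smooth map \<open>F\<close>
  (\<open>kernel_values\<close>, \<open>haefliger_distribution_in_chart\<close>), and the question is local.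

  The flow of such a field preserves \<open>F\<close>, hence preserves the set of such fields, hence the
  distribution: its rank is constant along the flow although it may jump elsewhere.  The proof
  exploits this for one flow with parameters.  Choose fields \<open>X\<^sub>b\<close> whose values at \<open>a\<close> form a basis of
  the distribution at \<open>a\<close>, and let \<open>\<phi> (z, u)\<close> be the result of following \<open>\<Sum> u\<^sub>b X\<^sub>b\<close> from \<open>z\<close>.
  Then \<open>F (\<phi> (z, u)) = F z\<close>, the inverse of \<open>\<phi> (_, u)\<close> is \<open>\<phi> (_, - u)\<close>, and the derivative of
  \<open>\<phi> (a, u)\<close> in \<open>u\<close> at 0 maps onto the distribution at \<open>a\<close> (\<open>level_preserving_family\<close>).  The
  derivatives in \<open>u\<close>, moved to the point \<open>\<phi> (z, u)\<close>, are themselves annihilated fields, so the orbit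
  \<open>u \<mapsto> \<phi> (a, u)\<close> is tangent to the distribution; invariance bounds the rank along the orbit by the
  rank at \<open>a\<close>, so the orbit is an integral submanifold (\<open>local_leaf\<close>).

  What this needs from analysis is a flow that depends smoothly on initial point and parameters
  (\<open>smooth_flow\<close>).  The integral equation of a field is solved by the contraction principle in the
  Banach space of bounded continuous curves, with time rescaled so that the contraction constant is
  \<open>1/2\<close>.  The solution, as a curve-valued function of the starting point, is differentiable, and its
  partial derivatives solve a linear equation \<open>y = T y + H\<close> in the same space whose coefficients are
  as often differentiable as the solution itself.  Solutions of such equations inherit the
  differentiability of the coefficients (\<open>Ck_on_linear_equation\<close>), so each order yields the next.
\<close>


section \<open>Calculus on coordinate subspaces\<close>

lemma eventually_at_openin:
  assumes "openin (coord_top B) A" "x \<in> A" "\<And>y. y \<in> A \<Longrightarrow> P y"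
  shows "\<forall>\<^sub>F y in at x within span B. P y"
proof -
  obtain T where T: "open T" "A = span B \<inter> T"
    using assms(1) by (auto simp: openin_open)
  then show ?thesis
    using assms(2,3) by (auto simp: eventually_at_topological)
qed

lemma at_within_openin_eq:
  assumes "openin (coord_top B) A" "x \<in> A"
  shows "at x within A = at x within span B"
proof -
  obtain T where "open T" "A = span B \<inter> T"
    using assms(1) by (auto simp: openin_open)
  then show ?thesis
    using assms(2) by (intro at_within_nhd[of x T]) auto
qed

lemma openin_coord_subset: "openin (coord_top B) A \<Longrightarrow> A \<subseteq> span B"
  using openin_imp_subset by blast

lemma has_derivative_openin_cong:
  assumes "openin (coord_top B) A" "x \<in> A" "\<And>y. y \<in> A \<Longrightarrow> f y = g y"
  shows "(f has_derivative f') (at x within span B) \<longleftrightarrow> (g has_derivative f') (at x within span B)"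
proof -
  have "\<forall>\<^sub>F y in at x within span B. f y = g y" "\<forall>\<^sub>F y in at x within span B. g y = f y"
    using eventually_at_openin[OF assms(1,2)] assms(3) by (metis (mono_tags, lifting))+
  moreover have "x \<in> span B" "f x = g x"
    using assms openin_coord_subset by auto
  ultimately show ?thesis
    by (metis has_derivative_transform_eventually)
qed

lemma
  assumes "openin (coord_top B) A" "x \<in> A" "\<And>y. y \<in> A \<Longrightarrow> f y = g y"
  shows deriv_along_cong: "deriv_along B f x v = deriv_along B g x v"
    and differentiable_openin_cong:
      "f differentiable (at x within span B) \<longleftrightarrow> g differentiable (at x within span B)"
  using has_derivative_openin_cong[OF assms]
  unfolding deriv_along_def frechet_derivative_def differentiable_def by simp_all

lemma has_vector_derivative_along:
  assumes "(f has_derivative f') (at x within span B)" "x \<in> span B" "v \<in> span B"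
  shows "((\<lambda>t. f (x + t *\<^sub>R v)) has_vector_derivative f' v) (at 0)"
proof -
  have 1: "((\<lambda>t::real. x + t *\<^sub>R v) has_derivative (\<lambda>t. t *\<^sub>R v)) (at 0)"
    by (auto intro!: derivative_eq_intros)
  have "(f has_derivative f') (at (x + 0 *\<^sub>R v) within range (\<lambda>t::real. x + t *\<^sub>R v))"
    using assms by (auto intro!: has_derivative_subset[OF assms(1)] span_add span_scale)
  from has_derivative_in_compose[OF 1 this]
  have "((\<lambda>t. f (x + t *\<^sub>R v)) has_derivative (\<lambda>t. f' (t *\<^sub>R v))) (at 0)" .
  moreover have "f' (t *\<^sub>R v) = t *\<^sub>R f' v" for t
    using assms(1) has_derivative_linear linear_scale by blast
  ultimately show ?thesis
    by (simp add: has_vector_derivative_def)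
qed

text \<open>
  The Frechet derivative chosen by \<^const>\<open>deriv_along\<close> is arbitrary off \<^term>\<open>span B\<close>; restricting
  to lines inside the subspace is what pins it down there.
\<close>

lemma deriv_along_eq:
  assumes "(f has_derivative f') (at x within span B)" "x \<in> span B" "v \<in> span B"
  shows "deriv_along B f x v = f' v"
proof -
  have "(f has_derivative frechet_derivative f (at x within span B)) (at x within span B)"
    using assms(1) frechet_derivative_works differentiable_def by blast
  from has_vector_derivative_along[OF this assms(2,3)] has_vector_derivative_along[OF assms]
  show ?thesis
    unfolding deriv_along_def by (rule vector_derivative_unique_at)
qed

lemma has_derivative_deriv_along:
  "f differentiable (at x within span B) \<Longrightarrow>
   (f has_derivative deriv_along B f x) (at x within span B)"
  unfolding deriv_along_def[abs_def] using frechet_derivative_works by blast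

lemma deriv_along_linear:
  "f differentiable (at x within span B) \<Longrightarrow> linear (deriv_along B f x)"
  using has_derivative_deriv_along has_derivative_linear by blast

lemma span_coord_iff:
  fixes B :: "'a::euclidean_space set"
  assumes "B \<subseteq> Basis"
  shows "v \<in> span B \<longleftrightarrow> (\<forall>b\<in>Basis - B. v \<bullet> b = 0)"
proof
  show "\<forall>b\<in>Basis - B. v \<bullet> b = 0" if "v \<in> span B"
    using that
  proof (induction rule: span_induct_alt)
    case (step c b y)
    then show ?case
      using assms by (auto simp: inner_add_left inner_Basis)
  qed auto
next
  assume *: "\<forall>b\<in>Basis - B. v \<bullet> b = 0"
  have "v = (\<Sum>b\<in>Basis. (v \<bullet> b) *\<^sub>R b)"
    by (simp add: euclidean_representation)
  also have "\<dots> = (\<Sum>b\<in>B. (v \<bullet> b) *\<^sub>R b)"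
    using * assms by (intro sum.mono_neutral_right) auto
  also have "\<dots> \<in> span B"
    by (intro span_sum span_scale span_base)
  finally show "v \<in> span B" .
qed

lemma span_coord_expansion:
  fixes B :: "'a::euclidean_space set"
  assumes "B \<subseteq> Basis" "v \<in> span B"
  shows "(\<Sum>b\<in>B. (v \<bullet> b) *\<^sub>R b) = v"
proof -
  have "v = (\<Sum>b\<in>Basis. (v \<bullet> b) *\<^sub>R b)"
    by (simp add: euclidean_representation)
  also have "\<dots> = (\<Sum>b\<in>B. (v \<bullet> b) *\<^sub>R b)"
    using assms span_coord_iff[OF assms(1)] by (intro sum.mono_neutral_right) auto
  finally show ?thesis by simp
qed

lemma linear_coord_expansion:
  fixes B :: "'a::euclidean_space set"
  assumes "B \<subseteq> Basis" "linear L" "v \<in> span B"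
  shows "L v = (\<Sum>b\<in>B. (v \<bullet> b) *\<^sub>R L b)"
proof -
  have "L v = L (\<Sum>b\<in>B. (v \<bullet> b) *\<^sub>R b)"
    by (simp add: span_coord_expansion[OF assms(1,3)])
  then show ?thesis
    by (simp add: linear_sum[OF assms(2)] linear_scale[OF assms(2)])
qed

lemma deriv_along_expansion:
  fixes B :: "'a::euclidean_space set"
  assumes "B \<subseteq> Basis" "f differentiable (at x within span B)" "v \<in> span B"
  shows "deriv_along B f x v = (\<Sum>b\<in>B. (v \<bullet> b) *\<^sub>R deriv_along B f x b)"
  using linear_coord_expansion[OF assms(1) deriv_along_linear[OF assms(2)] assms(3)] .


lemma Ck_on_cong:
  assumes "openin (coord_top B) A" "\<And>y. y \<in> A \<Longrightarrow> f y = g y"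
  shows "Ck_on B k A f \<longleftrightarrow> Ck_on B k A g"
  using assms(2)
proof (induction k arbitrary: f g)
  case 0
  then show ?case
    by (simp cong: continuous_on_cong)
next
  case (Suc k)
  have 1: "f differentiable (at x within span B) \<longleftrightarrow> g differentiable (at x within span B)"
    if "x \<in> A" for x
    using differentiable_openin_cong[OF assms(1) that Suc.prems] .
  have "Ck_on B k A (\<lambda>x. deriv_along B f x b) \<longleftrightarrow> Ck_on B k A (\<lambda>x. deriv_along B g x b)" for b
    by (rule Suc.IH) (rule deriv_along_cong[OF assms(1) _ Suc.prems])
  with 1 show ?case by simp
qed

lemma Ck_on_subset: "Ck_on B k A f \<Longrightarrow> A' \<subseteq> A \<Longrightarrow> Ck_on B k A' f"
  by (induction k arbitrary: f) (auto intro: continuous_on_subset)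

lemma Ck_on_SucI:
  assumes "openin (coord_top B) A"
    and "\<And>x. x \<in> A \<Longrightarrow> (f has_derivative D x) (at x within span B)"
    and "\<And>b. b \<in> B \<Longrightarrow> Ck_on B k A (\<lambda>x. D x b)"
  shows "Ck_on B (Suc k) A f"
proof -
  have "deriv_along B f x b = D x b" if "x \<in> A" "b \<in> B" for x b
    using deriv_along_eq[OF assms(2)[OF that(1)]] that openin_coord_subset[OF assms(1)]
    by (auto intro: span_base)
  then have "Ck_on B k A (\<lambda>x. deriv_along B f x b)" if "b \<in> B" for b
    using Ck_on_cong[OF assms(1), of "\<lambda>x. deriv_along B f x b" "\<lambda>x. D x b"] assms(3) that by auto
  then show ?thesis
    using assms(2) by (auto simp: differentiable_def)
qed

lemma Ck_on_Suc_has_derivative: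
  "Ck_on B (Suc k) A f \<Longrightarrow> x \<in> A \<Longrightarrow> (f has_derivative deriv_along B f x) (at x within span B)"
  by (auto intro: has_derivative_deriv_along)

lemma Ck_on_Suc_imp: "Ck_on B (Suc k) A f \<Longrightarrow> A \<subseteq> span B \<Longrightarrow> Ck_on B k A f"
proof (induction k arbitrary: f)
  case 0
  have "continuous (at x within A) f" if "x \<in> A" for x
    by (rule continuous_within_subset[OF differentiable_imp_continuous_within]) (use 0 that in auto)
  then show ?case
    by (simp add: continuous_on_eq_continuous_within)
next
  case (Suc k)
  have "Ck_on B k A (\<lambda>x. deriv_along B f x b)" if "b \<in> B" for b
    using Suc that by auto
  then show ?case
    using Suc.prems by auto
qed

lemma Ck_on_0: "Ck_on B k A f \<Longrightarrow> A \<subseteq> span B \<Longrightarrow> continuous_on A f"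
proof (induction k)
  case (Suc k)
  then show ?case
    using Ck_on_Suc_imp by blast
qed simp

lemma Ck_on_local:
  assumes "A \<subseteq> span B"
    and "\<And>x. x \<in> A \<Longrightarrow> \<exists>A'. openin (coord_top B) A' \<and> x \<in> A' \<and> Ck_on B k A' f"
  shows "Ck_on B k A f"
  using assms(2)
proof (induction k arbitrary: f)
  case 0
  have "continuous (at x within A) f" if x: "x \<in> A" for x
  proof -
    obtain A' where A': "openin (coord_top B) A'" "x \<in> A'" "continuous_on A' f"
      using 0 x by auto
    then have "continuous (at x within A') f"
      using continuous_on_eq_continuous_within by blast
    then have "continuous (at x within span B) f"
      using at_within_openin_eq[OF A'(1,2)] by simp
    then show ?thesis
      using continuous_within_subset assms(1) by blast
  qed
  then show ?case
    by (simp add: continuous_on_eq_continuous_within)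
next
  case (Suc k)
  have "Ck_on B k A (\<lambda>x. deriv_along B f x b)" if "b \<in> B" for b
    using that by (intro Suc.IH) (use Suc.prems in force)
  moreover have "f differentiable (at x within span B)" if "x \<in> A" for x
    using Suc.prems[OF that] by auto
  ultimately show ?case by simp
qed

lemma Ck_on_const: "openin (coord_top B) A \<Longrightarrow> Ck_on B k A (\<lambda>x. c)"
proof (induction k arbitrary: c)
  case (Suc k)
  show ?case
    by (rule Ck_on_SucI[where D = "\<lambda>x h. 0"]) (use Suc in auto)
qed simp

lemma Ck_on_bounded_linear:
  assumes "openin (coord_top B) A" "bounded_linear T"
  shows "Ck_on B k A T"
proof (cases k)
  case 0
  then show ?thesis
    using assms(2) by (simp add: linear_continuous_on)
next
  case (Suc l)
  have "Ck_on B (Suc l) A T"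
    by (rule Ck_on_SucI[where D = "\<lambda>x. T"])
      (use assms in \<open>auto intro: Ck_on_const bounded_linear_imp_has_derivative\<close>)
  then show ?thesis using Suc by simp
qed

lemma Ck_on_bounded_linear_compose:
  assumes "openin (coord_top B) A" "bounded_linear T" "Ck_on B k A f"
  shows "Ck_on B k A (\<lambda>x. T (f x))"
  using assms(3)
proof (induction k arbitrary: f)
  case 0
  then show ?case
    using assms(2) bounded_linear.continuous_on by auto
next
  case (Suc k)
  show ?case
    by (rule Ck_on_SucI[where D = "\<lambda>x h. T (deriv_along B f x h)"])
      (use assms Suc Ck_on_Suc_has_derivative[OF Suc.prems] in
        \<open>auto intro: bounded_linear.has_derivative\<close>)
qed

lemma Ck_on_add:
  assumes "openin (coord_top B) A" "Ck_on B k A f" "Ck_on B k A g"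
  shows "Ck_on B k A (\<lambda>x. f x + g x)"
  using assms(2,3)
proof (induction k arbitrary: f g)
  case 0
  then show ?case by (auto intro: continuous_on_add)
next
  case (Suc k)
  show ?case
    by (rule Ck_on_SucI[where D = "\<lambda>x h. deriv_along B f x h + deriv_along B g x h"])
      (use assms(1) Suc Ck_on_Suc_has_derivative[OF Suc.prems(1)]
         Ck_on_Suc_has_derivative[OF Suc.prems(2)] in \<open>auto intro: has_derivative_add\<close>)
qed

lemma Ck_on_sum:
  assumes "openin (coord_top B) A" "\<And>i. i \<in> J \<Longrightarrow> Ck_on B k A (f i)"
  shows "Ck_on B k A (\<lambda>x. \<Sum>i\<in>J. f i x)"
  using assms(2)
  by (induction J rule: infinite_finite_induct) (auto intro: Ck_on_const Ck_on_add assms(1))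

lemma Ck_on_bilinear:
  assumes "bounded_bilinear pr" "openin (coord_top B) A" "Ck_on B k A f" "Ck_on B k A g"
  shows "Ck_on B k A (\<lambda>x. pr (f x) (g x))"
  using assms(3,4)
proof (induction k arbitrary: f g)
  case 0
  then show ?case
    using bounded_bilinear.continuous_on[OF assms(1)] by auto
next
  case (Suc k)
  have 1: "Ck_on B k A f" "Ck_on B k A g"
    using Suc.prems Ck_on_Suc_imp openin_coord_subset[OF assms(2)] by blast+
  show ?case
  proof (rule Ck_on_SucI[where D = "\<lambda>x h. pr (f x) (deriv_along B g x h) + pr (deriv_along B f x h) (g x)"])
    fix b assume b: "b \<in> B"
    show "Ck_on B k A (\<lambda>x. pr (f x) (deriv_along B g x b) + pr (deriv_along B f x b) (g x))"
      by (intro Ck_on_add assms(2) Suc.IH 1) (use Suc.prems b in auto)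
  next
    fix x assume "x \<in> A"
    then show "((\<lambda>x. pr (f x) (g x)) has_derivative
        (\<lambda>h. pr (f x) (deriv_along B g x h) + pr (deriv_along B f x h) (g x))) (at x within span B)"
      by (intro bounded_bilinear.FDERIV[OF assms(1)] Ck_on_Suc_has_derivative[OF Suc.prems(1)]
          Ck_on_Suc_has_derivative[OF Suc.prems(2)])
  qed (rule assms(2))
qed

text \<open>
  A map into \<^term>\<open>span B'\<close> has derivatives in \<^term>\<open>span B'\<close>: its coordinates in the other
  directions vanish identically.
\<close>

lemma deriv_along_in_span:
  fixes f :: "'a::euclidean_space \<Rightarrow> 'b::euclidean_space"
  assumes "openin (coord_top B) A" "B' \<subseteq> Basis" "\<And>y. y \<in> A \<Longrightarrow> f y \<in> span B'"
    and "x \<in> A" "f differentiable (at x within span B)" "v \<in> span B"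
  shows "deriv_along B f x v \<in> span B'"
  unfolding span_coord_iff[OF assms(2)]
proof
  fix b assume b: "b \<in> Basis - B'"
  have x: "x \<in> span B"
    using assms(1,4) openin_coord_subset by auto
  have "((\<lambda>x. f x \<bullet> b) has_derivative (\<lambda>h. deriv_along B f x h \<bullet> b)) (at x within span B)"
    using has_derivative_deriv_along[OF assms(5)] by (auto intro!: derivative_eq_intros)
  moreover have "((\<lambda>x. f x \<bullet> b) has_derivative (\<lambda>h. 0)) (at x within span B)"
    by (subst has_derivative_openin_cong[OF assms(1,4), of _ "\<lambda>x. 0"])
      (use assms(3) b span_coord_iff[OF assms(2)] in auto)
  ultimately show "deriv_along B f x v \<bullet> b = 0"
    using deriv_along_eq x assms(6) by metis
qed

lemma has_derivative_chain_along:
  fixes f :: "'a::euclidean_space \<Rightarrow> 'b::euclidean_space"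
  assumes "openin (coord_top B) A" "\<And>y. y \<in> A \<Longrightarrow> f y \<in> span B'" "x \<in> A"
    and "f differentiable (at x within span B)" "g differentiable (at (f x) within span B')"
  shows "((\<lambda>x. g (f x)) has_derivative (\<lambda>h. deriv_along B' g (f x) (deriv_along B f x h)))
    (at x within span B)"
proof -
  have "(f has_derivative deriv_along B f x) (at x within A)"
    using has_derivative_deriv_along[OF assms(4)] at_within_openin_eq[OF assms(1,3)] by simp
  moreover have "(g has_derivative deriv_along B' g (f x)) (at (f x) within f ` A)"
    using has_derivative_deriv_along[OF assms(5)] assms(2) has_derivative_subset by blast
  ultimately have "((\<lambda>x. g (f x)) has_derivative (\<lambda>h. deriv_along B' g (f x) (deriv_along B f x h)))
    (at x within A)"
    by (rule has_derivative_in_compose)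
  then show ?thesis
    using at_within_openin_eq[OF assms(1,3)] by simp
qed

lemma deriv_along_chain:
  fixes f :: "'a::euclidean_space \<Rightarrow> 'b::euclidean_space"
  assumes "openin (coord_top B) A" "\<And>y. y \<in> A \<Longrightarrow> f y \<in> span B'" "x \<in> A"
    and "f differentiable (at x within span B)" "g differentiable (at (f x) within span B')"
    and "v \<in> span B"
  shows "deriv_along B (\<lambda>x. g (f x)) x v = deriv_along B' g (f x) (deriv_along B f x v)"
  using deriv_along_eq[OF has_derivative_chain_along[OF assms(1-5)] _ assms(6)]
    openin_coord_subset[OF assms(1)] assms(3) by blast

text \<open>
  The chain rule expresses each partial derivative of the composite through products of partial
  derivatives of lower order; the inner derivative has to be expanded in the basis vectors of the
  target subspace because only these occur in the definition of \<^const>\<open>Ck_on\<close>.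
\<close>

lemma Ck_on_compose:
  fixes f :: "'a::euclidean_space \<Rightarrow> 'b::euclidean_space"
  assumes "openin (coord_top B) A" "openin (coord_top B') A'" "B' \<subseteq> Basis"
    and "\<And>y. y \<in> A \<Longrightarrow> f y \<in> A'" "Ck_on B k A f" "Ck_on B' k A' g"
  shows "Ck_on B k A (\<lambda>x. g (f x))"
  using assms(5,6)
proof (induction k arbitrary: g)
  case 0
  then show ?case
    using assms(4) continuous_on_compose2[of A' g A f] by auto
next
  case (Suc k)
  have sp: "\<And>y. y \<in> A \<Longrightarrow> f y \<in> span B'"
    using assms(2,4) openin_coord_subset by blast
  have fk: "Ck_on B k A f"
    using Suc.prems Ck_on_Suc_imp openin_coord_subset[OF assms(1)] by blast
  show ?case
  proof (rule Ck_on_SucI[where D = "\<lambda>x h. deriv_along B' g (f x) (deriv_along B f x h)"])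
    show "((\<lambda>x. g (f x)) has_derivative (\<lambda>h. deriv_along B' g (f x) (deriv_along B f x h)))
        (at x within span B)" if "x \<in> A" for x
      using Suc.prems assms(4) that by (intro has_derivative_chain_along[OF assms(1) sp]) auto
  next
    fix b assume b: "b \<in> B"
    have "Ck_on B k A (\<lambda>x. \<Sum>b'\<in>B'. (deriv_along B f x b \<bullet> b') *\<^sub>R deriv_along B' g (f x) b')"
      using Suc.prems b
      by (intro Ck_on_sum assms(1) Ck_on_bilinear[OF bounded_bilinear_scaleR] Suc.IH fk
          Ck_on_bounded_linear_compose[OF assms(1) bounded_linear_inner_left]) auto
    also have "?this \<longleftrightarrow> Ck_on B k A (\<lambda>x. deriv_along B' g (f x) (deriv_along B f x b))"
    proof (rule Ck_on_cong[OF assms(1)])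
      fix x assume x: "x \<in> A"
      have "deriv_along B f x b \<in> span B'"
        by (rule deriv_along_in_span[OF assms(1,3)]) (use sp Suc.prems x b in \<open>auto intro: span_base\<close>)
      then show "(\<Sum>b'\<in>B'. (deriv_along B f x b \<bullet> b') *\<^sub>R deriv_along B' g (f x) b') =
          deriv_along B' g (f x) (deriv_along B f x b)"
        using deriv_along_expansion[OF assms(3), of g "f x"] Suc.prems assms(4) x by auto
    qed
    finally show "Ck_on B k A (\<lambda>x. deriv_along B' g (f x) (deriv_along B f x b))" .
  qed (rule assms(1))
qed


lemma smooth_on_cong:
  assumes "openin (coord_top B) A" "\<And>y. y \<in> A \<Longrightarrow> f y = g y"
  shows "smooth_on B A f \<longleftrightarrow> smooth_on B A g"
  using Ck_on_cong[OF assms] by (simp add: smooth_on_def)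

lemma smooth_on_subset: "smooth_on B A f \<Longrightarrow> A' \<subseteq> A \<Longrightarrow> smooth_on B A' f"
  unfolding smooth_on_def using Ck_on_subset by blast

lemma smooth_on_continuous: "smooth_on B A f \<Longrightarrow> continuous_on A f"
  unfolding smooth_on_def by (metis Ck_on.simps(1))

lemma smooth_on_differentiable:
  "smooth_on B A f \<Longrightarrow> x \<in> A \<Longrightarrow> f differentiable (at x within span B)"
  unfolding smooth_on_def by (metis Ck_on.simps(2))

lemma smooth_on_local:
  assumes "A \<subseteq> span B"
    and "\<And>x. x \<in> A \<Longrightarrow> \<exists>A'. openin (coord_top B) A' \<and> x \<in> A' \<and> smooth_on B A' f"
  shows "smooth_on B A f"
  unfolding smooth_on_def
proof
  show "Ck_on B k A f" for k
    by (rule Ck_on_local[OF assms(1)]) (use assms(2) in \<open>auto simp: smooth_on_def\<close>)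
qed

lemma smooth_on_const: "openin (coord_top B) A \<Longrightarrow> smooth_on B A (\<lambda>x. c)"
  by (simp add: smooth_on_def Ck_on_const)

lemma smooth_on_bounded_linear: "openin (coord_top B) A \<Longrightarrow> bounded_linear T \<Longrightarrow> smooth_on B A T"
  by (simp add: smooth_on_def Ck_on_bounded_linear)

lemma smooth_on_id: "openin (coord_top B) A \<Longrightarrow> smooth_on B A (\<lambda>x. x)"
  by (simp add: smooth_on_bounded_linear bounded_linear_ident)

lemma smooth_on_bounded_linear_compose:
  "openin (coord_top B) A \<Longrightarrow> bounded_linear T \<Longrightarrow> smooth_on B A f \<Longrightarrow> smooth_on B A (\<lambda>x. T (f x))"
  by (simp add: smooth_on_def Ck_on_bounded_linear_compose)

lemma smooth_on_add:
  "openin (coord_top B) A \<Longrightarrow> smooth_on B A f \<Longrightarrow> smooth_on B A g \<Longrightarrow> smooth_on B A (\<lambda>x. f x + g x)"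
  by (simp add: smooth_on_def Ck_on_add)

lemma smooth_on_sum:
  "openin (coord_top B) A \<Longrightarrow> (\<And>i. i \<in> J \<Longrightarrow> smooth_on B A (f i)) \<Longrightarrow>
   smooth_on B A (\<lambda>x. \<Sum>i\<in>J. f i x)"
  by (simp add: smooth_on_def Ck_on_sum)

lemma smooth_on_bilinear:
  "bounded_bilinear pr \<Longrightarrow> openin (coord_top B) A \<Longrightarrow> smooth_on B A f \<Longrightarrow> smooth_on B A g \<Longrightarrow>
   smooth_on B A (\<lambda>x. pr (f x) (g x))"
  by (simp add: smooth_on_def Ck_on_bilinear)

lemmas smooth_on_scaleR = smooth_on_bilinear[OF bounded_bilinear_scaleR]
lemmas smooth_on_mult = smooth_on_bilinear[OF bounded_bilinear_mult]

lemma smooth_on_Pair: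
  assumes "openin (coord_top B) A" "smooth_on B A f" "smooth_on B A g"
  shows "smooth_on B A (\<lambda>x. (f x, g x))"
proof -
  have "smooth_on B A (\<lambda>x. (f x, 0) + (0, g x))"
    using assms
    by (intro smooth_on_add smooth_on_bounded_linear_compose[where T = "\<lambda>y. (y, 0)"]
        smooth_on_bounded_linear_compose[where T = "\<lambda>y. (0, y)"])
      (auto intro!: bounded_linear_intros)
  then show ?thesis by simp
qed

lemma smooth_on_compose:
  fixes f :: "'a::euclidean_space \<Rightarrow> 'b::euclidean_space"
  assumes "openin (coord_top B) A" "openin (coord_top B') A'" "B' \<subseteq> Basis"
    and "\<And>y. y \<in> A \<Longrightarrow> f y \<in> A'" "smooth_on B A f" "smooth_on B' A' g"
  shows "smooth_on B A (\<lambda>x. g (f x))"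
  unfolding smooth_on_def
proof
  show "Ck_on B k A (\<lambda>x. g (f x))" for k
    by (rule Ck_on_compose[OF assms(1-3)]) (use assms(4-6) in \<open>auto simp: smooth_on_def\<close>)
qed

lemma smooth_on_deriv:
  assumes "smooth_on B A f" "b \<in> B"
  shows "smooth_on B A (\<lambda>x. deriv_along B f x b)"
  using assms unfolding smooth_on_def by (metis Ck_on.simps(2))

lemma smooth_on_deriv_field:
  fixes Y :: "'a::euclidean_space \<Rightarrow> 'b::euclidean_space"
  assumes "openin (coord_top B) A" "openin (coord_top B') A'" "B' \<subseteq> Basis"
    and "\<And>y. y \<in> A \<Longrightarrow> g y \<in> A'" "smooth_on B A g"
    and "smooth_on B' A' f" "smooth_on B A Y" "\<And>x. x \<in> A \<Longrightarrow> Y x \<in> span B'"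
  shows "smooth_on B A (\<lambda>x. deriv_along B' f (g x) (Y x))"
proof -
  have "smooth_on B A (\<lambda>x. \<Sum>b\<in>B'. (Y x \<bullet> b) *\<^sub>R deriv_along B' f (g x) b)"
    using assms
    by (intro smooth_on_sum smooth_on_scaleR smooth_on_compose[OF assms(1-5)] smooth_on_deriv
        smooth_on_bounded_linear_compose[OF _ bounded_linear_inner_left])
  also have "?this \<longleftrightarrow> ?thesis"
  proof (rule smooth_on_cong[OF assms(1)])
    fix y assume "y \<in> A"
    then show "(\<Sum>b\<in>B'. (Y y \<bullet> b) *\<^sub>R deriv_along B' f (g y) b) = deriv_along B' f (g y) (Y y)"
      using deriv_along_expansion[OF assms(3) smooth_on_differentiable[OF assms(6)]] assms(4,8)
      by simp
  qed
  finally show ?thesis .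
qed


section \<open>Fixed-point equations depending on a parameter\<close>

text \<open>
  The Neumann series of a contraction, obtained from the contraction principle instead of
  summation.
\<close>

lemma contraction_resolvent:
  fixes \<tau> :: "'c::{real_normed_vector,complete_space} \<Rightarrow> 'c"
  assumes "bounded_linear \<tau>" "\<And>v. norm (\<tau> v) \<le> 1/2 * norm v"
  obtains S where "bounded_linear S" "\<And>v. S (v - \<tau> v) = v" "\<And>v. S v - \<tau> (S v) = v"
proof -
  interpret \<tau>: bounded_linear \<tau> by fact
  have ex1: "\<exists>!v. x + \<tau> v = v" for x
  proof (rule banach_fix_type[where c = "1/2"])
    show "\<forall>v w. dist (x + \<tau> v) (x + \<tau> w) \<le> 1/2 * dist v w"
      using assms(2) by (simp add: dist_norm \<tau>.diff[symmetric])
  qed auto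
  define S where "S x = (THE v. x + \<tau> v = v)" for x
  have S: "x + \<tau> (S x) = S x" for x
    unfolding S_def by (rule theI') (rule ex1)
  have S_eq: "S x = v" if "x + \<tau> v = v" for x v
    using ex1[of x] S[of x] that by blast
  have "S (x + y) = S x + S y" for x y
    by (rule S_eq) (metis S \<tau>.add add.assoc add.left_commute)
  moreover have "S (r *\<^sub>R x) = r *\<^sub>R S x" for r x
    by (rule S_eq) (metis S \<tau>.scaleR scaleR_add_right)
  moreover have "norm (S x) \<le> norm x * 2" for x
    using norm_triangle_ineq[of x "\<tau> (S x)"] assms(2)[of "S x"] S[of x] by simp
  ultimately have "bounded_linear S"
    by (rule bounded_linear_intro)
  moreover have "S (v - \<tau> v) = v" for v
    by (rule S_eq) simp
  moreover have "S v - \<tau> (S v) = v" for v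
    using S[of v] by (simp add: algebra_simps)
  ultimately show thesis
    using that by blast
qed

text \<open>
  Differentiability of the solution of a fixed-point equation: only the defect
  \<^term>\<open>Y w - \<tau> (Y w)\<close> has to be differentiated, since inverting \<^term>\<open>id - \<tau>\<close> is a bounded
  linear operation.
\<close>

lemma has_derivative_resolvent:
  fixes \<tau> :: "'c::{real_normed_vector,complete_space} \<Rightarrow> 'c"
  assumes "bounded_linear \<tau>" "\<And>v. norm (\<tau> v) \<le> 1/2 * norm v"
    and "((\<lambda>w. Y w - \<tau> (Y w)) has_derivative D) F"
  obtains D' where "(Y has_derivative D') F" "\<And>h. D' h = \<tau> (D' h) + D h"
proof -
  obtain S where S: "bounded_linear S" "\<And>v. S (v - \<tau> v) = v" "\<And>v. S v - \<tau> (S v) = v"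
    using contraction_resolvent[OF assms(1,2)] by blast
  have "((\<lambda>w. S (Y w - \<tau> (Y w))) has_derivative (\<lambda>h. S (D h))) F"
    by (rule bounded_linear.has_derivative[OF S(1) assms(3)])
  then have "(Y has_derivative (\<lambda>h. S (D h))) F"
    by (simp add: S(2))
  moreover have "S (D h) = \<tau> (S (D h)) + D h" for h
    using S(3)[of "D h"] by (simp add: algebra_simps)
  ultimately show thesis
    using that by blast
qed

text \<open>
  At a zero of the first factor the product rule needs only continuity of the second one.  This is
  what makes the solution of a linear equation differentiable as soon as it is continuous.
\<close>

lemma has_derivative_bilinear_vanishing:
  assumes "bounded_bilinear pr" "(f has_derivative f') (at x within S)" "f x = 0"
    and "continuous (at x within S) g"
  shows "((\<lambda>y. pr (f y) (g y)) has_derivative (\<lambda>h. pr (f' h) (g x))) (at x within S)"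
proof -
  interpret pr: bounded_bilinear pr by fact
  obtain K where K: "K > 0" "\<And>a b. norm (pr a b) \<le> norm a * norm b * K"
    using pr.pos_bounded by blast
  obtain M where M: "M > 0" "\<And>h. norm (f' h) \<le> norm h * M"
    using bounded_linear.pos_bounded[OF has_derivative_bounded_linear[OF assms(2)]] by blast
  have "((\<lambda>y. pr (f y) (g y - g x)) has_derivative (\<lambda>h. 0)) (at x within S)"
    unfolding has_derivative_within_alt
  proof (intro conjI allI impI)
    fix e :: real assume e: "e > 0"
    obtain d1 where d1: "d1 > 0"
      "\<And>y. y \<in> S \<Longrightarrow> norm (y - x) < d1 \<Longrightarrow> norm (f y - f x - f' (y - x)) \<le> 1 * norm (y - x)"
      using assms(2) unfolding has_derivative_within_alt by (meson zero_less_one)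
    define e' where "e' = e / ((M + 1) * K)"
    have e': "e' > 0"
      using e M(1) K(1) by (auto simp: e'_def)
    then obtain d2 where d2: "d2 > 0"
      "\<And>y. y \<in> S \<Longrightarrow> norm (y - x) < d2 \<Longrightarrow> norm (g y - g x) < e'"
      using assms(4) unfolding continuous_within_eps_delta by (metis dist_norm)
    show "\<exists>d>0. \<forall>y\<in>S. norm (y - x) < d \<longrightarrow>
        norm (pr (f y) (g y - g x) - pr (f x) (g x - g x) - 0) \<le> e * norm (y - x)"
    proof (intro exI[of _ "min d1 d2"] conjI ballI impI)
      fix y assume y: "y \<in> S" "norm (y - x) < min d1 d2"
      have "norm (f y) \<le> norm (f' (y - x)) + norm (f y - f' (y - x))"
        using norm_triangle_ineq[of "f' (y - x)" "f y - f' (y - x)"] by simp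
      also have "\<dots> \<le> (M + 1) * norm (y - x)"
        using d1(2)[of y] y assms(3) M(2)[of "y - x"] by (simp add: algebra_simps)
      finally have 1: "norm (f y) \<le> (M + 1) * norm (y - x)" .
      have "norm (pr (f y) (g y - g x)) \<le> norm (f y) * norm (g y - g x) * K"
        by (rule K)
      also have "\<dots> \<le> ((M + 1) * norm (y - x)) * e' * K"
        using 1 d2(2)[of y] y K(1) e' M(1) by (intro mult_mono mult_right_mono) auto
      also have "\<dots> = e * norm (y - x)"
        using K(1) M(1) by (simp add: e'_def)
      finally show "norm (pr (f y) (g y - g x) - pr (f x) (g x - g x) - 0) \<le> e * norm (y - x)"
        by (simp add: pr.zero_right)
    qed (use d1 d2 in auto)
  qed simp
  moreover have "((\<lambda>y. pr (f y) (g x)) has_derivative (\<lambda>h. pr (f' h) (g x))) (at x within S)"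
    by (rule bounded_linear.has_derivative[OF pr.bounded_linear_left assms(2)])
  ultimately have "((\<lambda>y. pr (f y) (g y - g x) + pr (f y) (g x)) has_derivative
      (\<lambda>h. 0 + pr (f' h) (g x))) (at x within S)"
    by (rule has_derivative_add)
  then show ?thesis
    by (simp add: pr.diff_right)
qed

lemma has_derivative_zero_compose_lipschitz:
  assumes "(\<phi> has_derivative (\<lambda>h. 0)) (at (f x) within T)" "\<And>y. y \<in> S \<Longrightarrow> f y \<in> T"
    and "\<And>y. y \<in> S \<Longrightarrow> norm (f y - f x) \<le> L * norm (y - x)"
  shows "((\<lambda>y. \<phi> (f y)) has_derivative (\<lambda>h. 0)) (at x within S)"
  unfolding has_derivative_within_alt
proof (intro conjI allI impI)
  fix e :: real assume e: "e > 0"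
  define M where "M = \<bar>L\<bar> + 1"
  have M: "M > 0"
    by (simp add: M_def)
  have M_bound: "norm (f y - f x) \<le> M * norm (y - x)" if "y \<in> S" for y
    using order_trans[OF assms(3)[OF that] mult_right_mono[of L M "norm (y - x)"]]
    by (auto simp: M_def)
  have "e / M > 0"
    using e M by simp
  then obtain d where d: "d > 0"
    "\<And>z. z \<in> T \<Longrightarrow> norm (z - f x) < d \<Longrightarrow> norm (\<phi> z - \<phi> (f x) - 0) \<le> e / M * norm (z - f x)"
    using assms(1) unfolding has_derivative_within_alt by blast
  show "\<exists>d>0. \<forall>y\<in>S. norm (y - x) < d \<longrightarrow> norm (\<phi> (f y) - \<phi> (f x) - 0) \<le> e * norm (y - x)"
  proof (intro exI[of _ "d / M"] conjI ballI impI)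
    fix y assume y: "y \<in> S" "norm (y - x) < d / M"
    have "norm (f y - f x) < d"
      using M_bound[OF y(1)] y(2) M by (simp add: field_simps)
    then have "norm (\<phi> (f y) - \<phi> (f x) - 0) \<le> e / M * norm (f y - f x)"
      using d(2) assms(2) y(1) by blast
    also have "\<dots> \<le> e / M * (M * norm (y - x))"
      using M e M_bound[OF y(1)] by (intro mult_left_mono) auto
    finally show "norm (\<phi> (f y) - \<phi> (f x) - 0) \<le> e * norm (y - x)"
      using M(1) by simp
  qed (use d M in auto)
qed simp

text \<open>
  Differentiating the equation yields an equation of the same shape for every partial derivative
  of \<^term>\<open>y\<close>, with the same coefficients; this is why an induction on the order of
  differentiability closes without changing the type of the unknown.
\<close>

lemma Ck_on_linear_equation:
  fixes y :: "'a::euclidean_space \<Rightarrow> 'c::{real_normed_vector,complete_space}"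
  assumes op: "openin (coord_top B) W"
    and bil: "\<And>i. i \<in> J \<Longrightarrow> bounded_bilinear (\<beta> i)"
    and contr: "\<And>w v. w \<in> W \<Longrightarrow> norm (\<Sum>i\<in>J. \<beta> i (x i w) v) \<le> 1/2 * norm v"
    and coeff: "\<And>i. i \<in> J \<Longrightarrow> Ck_on B k W (x i)" and inhom: "Ck_on B k W H"
    and eq: "\<And>w. w \<in> W \<Longrightarrow> y w = (\<Sum>i\<in>J. \<beta> i (x i w) (y w)) + H w"
  shows "Ck_on B k W y"
  using coeff inhom eq
proof (induction k arbitrary: y H)
  case 0
  have "continuous (at w within W) y" if w: "w \<in> W" for w
  proof -
    define \<rho> where "\<rho> z = (\<Sum>i\<in>J. \<beta> i (x i z - x i w) (y w)) + (H z - H w)" for z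
    have bound: "norm (y z - y w) \<le> 2 * norm (\<rho> z)" if z: "z \<in> W" for z
    proof -
      have "y z - y w = (\<Sum>i\<in>J. \<beta> i (x i z) (y z)) - (\<Sum>i\<in>J. \<beta> i (x i w) (y w)) + (H z - H w)"
        using "0.prems"(3)[OF w] "0.prems"(3)[OF z] by (metis add_diff_add)
      also have "\<dots> = (\<Sum>i\<in>J. \<beta> i (x i z) (y z - y w)) + \<rho> z"
      proof -
        have "(\<Sum>i\<in>J. \<beta> i (x i z) (y z)) - (\<Sum>i\<in>J. \<beta> i (x i w) (y w)) =
            (\<Sum>i\<in>J. \<beta> i (x i z) (y z - y w) + \<beta> i (x i z - x i w) (y w))"
          unfolding sum_subtractf[symmetric]
          by (rule sum.cong) (simp_all add: bil bounded_bilinear.diff_left bounded_bilinear.diff_right)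
        then show ?thesis
          by (simp add: \<rho>_def sum.distrib)
      qed
      finally have "norm (y z - y w) \<le> norm (\<Sum>i\<in>J. \<beta> i (x i z) (y z - y w)) + norm (\<rho> z)"
        by (metis norm_triangle_ineq)
      then show ?thesis
        using contr[OF z, of "y z - y w"] by simp
    qed
    have cont: "(x i \<longlongrightarrow> x i w) (at w within W)" if "i \<in> J" for i
      using "0.prems"(1) that w by (auto simp: continuous_on_def)
    have "(H \<longlongrightarrow> H w) (at w within W)"
      using "0.prems"(2) w by (auto simp: continuous_on_def)
    then have "((\<lambda>z. H z - H w) \<longlongrightarrow> 0) (at w within W)"
      by (simp add: LIM_zero_iff)
    moreover have "((\<lambda>z. \<Sum>i\<in>J. \<beta> i (x i z - x i w) (y w)) \<longlongrightarrow> (\<Sum>i\<in>J. 0)) (at w within W)"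
    proof (rule tendsto_sum)
      fix i assume i: "i \<in> J"
      have "((\<lambda>z. \<beta> i (x i z - x i w) (y w)) \<longlongrightarrow> \<beta> i (x i w - x i w) (y w)) (at w within W)"
        by (intro bounded_bilinear.tendsto[OF bil[OF i]] tendsto_diff cont[OF i] tendsto_const)
      then show "((\<lambda>z. \<beta> i (x i z - x i w) (y w)) \<longlongrightarrow> 0) (at w within W)"
        by (simp add: bounded_bilinear.zero_left[OF bil[OF i]])
    qed
    ultimately have "(\<rho> \<longlongrightarrow> 0) (at w within W)"
      unfolding \<rho>_def using tendsto_add by fastforce
    then have "((\<lambda>z. 2 * norm (\<rho> z)) \<longlongrightarrow> 0) (at w within W)"
      using tendsto_mult_left[OF tendsto_norm_zero, of \<rho> _ 2] by simp
    then have "((\<lambda>z. y z - y w) \<longlongrightarrow> 0) (at w within W)"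
      by (rule Lim_null_comparison[rotated]) (auto simp: eventually_at_filter bound)
    then show ?thesis
      by (simp add: continuous_within LIM_zero_iff)
  qed
  then show ?case
    by (simp add: continuous_on_eq_continuous_within)
next
  case (Suc k)
  have WB: "W \<subseteq> span B"
    using openin_coord_subset[OF op] .
  have xk: "Ck_on B k W (x i)" if "i \<in> J" for i
    using Suc.prems(1)[OF that] Ck_on_Suc_imp[OF _ WB] by blast
  have yk: "Ck_on B k W y"
  proof (rule Suc.IH[where H = H])
    show "Ck_on B k W H"
      by (rule Ck_on_Suc_imp[OF Suc.prems(2) WB])
  qed (use xk Suc.prems(3) in auto)
  have D: "(y has_derivative deriv_along B y w) (at w within span B) \<and>
      (\<forall>b\<in>B. deriv_along B y w b = (\<Sum>i\<in>J. \<beta> i (x i w) (deriv_along B y w b)) +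
        ((\<Sum>i\<in>J. \<beta> i (deriv_along B (x i) w b) (y w)) + deriv_along B H w b))"
    if w: "w \<in> W" for w
  proof -
    define \<tau> where "\<tau> v = (\<Sum>i\<in>J. \<beta> i (x i w) v)" for v
    have lin: "bounded_linear \<tau>"
      unfolding \<tau>_def
      by (intro bounded_linear_sum bounded_bilinear.bounded_linear_right bil)
    have 1: "y z - \<tau> (y z) = (\<Sum>i\<in>J. \<beta> i (x i z - x i w) (y z)) + H z" if z: "z \<in> W" for z
    proof -
      have "(\<Sum>i\<in>J. \<beta> i (x i z - x i w) (y z)) = (\<Sum>i\<in>J. \<beta> i (x i z) (y z)) - \<tau> (y z)"
        unfolding \<tau>_def sum_subtractf[symmetric]
        by (rule sum.cong) (simp_all add: bil bounded_bilinear.diff_left)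
      then show ?thesis
        using Suc.prems(3)[OF z] by (metis add.commute add_diff_eq diff_add_eq)
    qed
    have cont: "continuous (at w within span B) y"
      using Ck_on_0[OF yk WB] w at_within_openin_eq[OF op w]
      by (metis continuous_on_eq_continuous_within)
    have "((\<lambda>z. (\<Sum>i\<in>J. \<beta> i (x i z - x i w) (y z)) + H z) has_derivative
        (\<lambda>h. (\<Sum>i\<in>J. \<beta> i (deriv_along B (x i) w h) (y w)) + deriv_along B H w h))
        (at w within span B)"
    proof (rule has_derivative_add)
      show "(H has_derivative deriv_along B H w) (at w within span B)"
        by (rule Ck_on_Suc_has_derivative[OF Suc.prems(2) w])
      show "((\<lambda>z. \<Sum>i\<in>J. \<beta> i (x i z - x i w) (y z)) has_derivative
          (\<lambda>h. \<Sum>i\<in>J. \<beta> i (deriv_along B (x i) w h) (y w))) (at w within span B)"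
      proof (rule has_derivative_sum)
        fix i assume i: "i \<in> J"
        have "((\<lambda>z. x i z - x i w) has_derivative (\<lambda>h. deriv_along B (x i) w h - 0))
            (at w within span B)"
          by (intro has_derivative_diff has_derivative_const
              Ck_on_Suc_has_derivative[OF Suc.prems(1)[OF i] w])
        then show "((\<lambda>z. \<beta> i (x i z - x i w) (y z)) has_derivative
            (\<lambda>h. \<beta> i (deriv_along B (x i) w h) (y w))) (at w within span B)"
          by (intro has_derivative_bilinear_vanishing[OF bil[OF i]] cont) auto
      qed
    qed
    then have "((\<lambda>z. y z - \<tau> (y z)) has_derivative
        (\<lambda>h. (\<Sum>i\<in>J. \<beta> i (deriv_along B (x i) w h) (y w)) + deriv_along B H w h))
        (at w within span B)"
      by (subst has_derivative_openin_cong[OF op w 1])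
    from has_derivative_resolvent[OF lin _ this]
    obtain D' where D': "(y has_derivative D') (at w within span B)"
      "\<And>h. D' h = \<tau> (D' h) + ((\<Sum>i\<in>J. \<beta> i (deriv_along B (x i) w h) (y w)) + deriv_along B H w h)"
      using contr[OF w] unfolding \<tau>_def by blast
    have "deriv_along B y w b = D' b" if "b \<in> B" for b
      using deriv_along_eq[OF D'(1)] WB w span_base[OF that] by blast
    with D'(2) have "\<forall>b\<in>B. deriv_along B y w b = \<tau> (deriv_along B y w b) +
        ((\<Sum>i\<in>J. \<beta> i (deriv_along B (x i) w b) (y w)) + deriv_along B H w b)"
      by simp
    moreover have "y differentiable (at w within span B)"
      using D'(1) by (auto simp: differentiable_def)
    ultimately show ?thesis
      unfolding \<tau>_def by (auto intro: has_derivative_deriv_along)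
  qed
  show ?case
  proof (rule Ck_on_SucI[OF op])
    show "(y has_derivative deriv_along B y w) (at w within span B)" if "w \<in> W" for w
      using D[OF that] by blast
    fix b assume b: "b \<in> B"
    show "Ck_on B k W (\<lambda>w. deriv_along B y w b)"
    proof (rule Suc.IH)
      show "Ck_on B k W (\<lambda>w. (\<Sum>i\<in>J. \<beta> i (deriv_along B (x i) w b) (y w)) + deriv_along B H w b)"
        using Suc.prems(1,2) b by (intro Ck_on_add op Ck_on_sum Ck_on_bilinear[OF bil] yk) auto
    qed (use xk D b in auto)
  qed
qed


section \<open>Calculus on spaces of curves\<close>

lemma apply_Bcontfun:
  assumes "continuous_on UNIV f" "\<And>t. norm (f t) \<le> b"
  shows "apply_bcontfun (Bcontfun f) = f"
  using bcontfun_normI[OF assms] by (rule Bcontfun_inverse)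

lemma apply_bcontfun_sum:
  fixes f :: "'i \<Rightarrow> ('a::topological_space \<Rightarrow>\<^sub>C 'b::real_normed_vector)"
  shows "apply_bcontfun (\<Sum>i\<in>J. f i) t = (\<Sum>i\<in>J. apply_bcontfun (f i) t)"
  by (induction J rule: infinite_finite_induct) auto

lemma bounded_linear_apply_bcontfun:
  "bounded_linear (\<lambda>c::'a::topological_space \<Rightarrow>\<^sub>C 'b::real_normed_vector. apply_bcontfun c t)"
  by (rule bounded_linear_intro[where K = 1]) (auto simp: norm_bounded)

lemma bounded_linear_const_bcontfun:
  "bounded_linear (const_bcontfun :: 'b::real_normed_vector \<Rightarrow> 'a::topological_space \<Rightarrow>\<^sub>C 'b)"
  by (rule bounded_linear_intro[where K = 1]) (auto intro!: bcontfun_eqI norm_bound)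

text \<open>
  Curves are bounded functions on the whole real line; clamping the upper limit of integration to
  \<open>[0, 1]\<close> keeps the primitive bounded, and only its values on that interval matter.
\<close>

definition curve_integral :: "(real \<Rightarrow>\<^sub>C 'a::euclidean_space) \<Rightarrow> (real \<Rightarrow>\<^sub>C 'a)" where
  "curve_integral f = Bcontfun (\<lambda>t. integral {0..max 0 (min 1 t)} (apply_bcontfun f))"

lemma apply_curve_integral:
  "apply_bcontfun (curve_integral f) t = integral {0..max 0 (min 1 t)} (apply_bcontfun f)"
proof -
  have "continuous_on {0..1} (\<lambda>t. integral {0..t} (apply_bcontfun f))"
    by (intro indefinite_integral_continuous_1 integrable_continuous_real) simp
  then have "continuous_on UNIV (\<lambda>t. integral {0..max 0 (min 1 t)} (apply_bcontfun f))"
    by (rule continuous_on_compose2) (auto intro!: continuous_intros)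
  moreover have "norm (integral {0..max 0 (min 1 t)} (apply_bcontfun f)) \<le> norm f" for t
  proof -
    have "norm (integral {0..max 0 (min 1 t)} (apply_bcontfun f)) \<le>
        norm f * (max 0 (min 1 t) - 0)"
      by (intro integral_bound) (auto simp: norm_bounded)
    also have "\<dots> \<le> norm f * 1"
      by (intro mult_left_mono) auto
    finally show ?thesis by simp
  qed
  ultimately show ?thesis
    unfolding curve_integral_def by (subst apply_Bcontfun) auto
qed

lemma norm_curve_integral_le: "norm (curve_integral f) \<le> norm f"
proof (rule norm_bound)
  fix t
  have "norm (integral {0..max 0 (min 1 t)} (apply_bcontfun f)) \<le>
      norm f * (max 0 (min 1 t) - 0)"
    by (intro integral_bound) (auto simp: norm_bounded)
  also have "\<dots> \<le> norm f * 1"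
    by (intro mult_left_mono) auto
  finally show "norm (apply_bcontfun (curve_integral f) t) \<le> norm f"
    by (simp add: apply_curve_integral)
qed

lemma bounded_linear_curve_integral: "bounded_linear curve_integral"
proof (rule bounded_linear_intro[where K = 1])
  have int: "apply_bcontfun f integrable_on {a..b}" for f :: "real \<Rightarrow>\<^sub>C 'a" and a b
    by (intro integrable_continuous_real) simp
  show "curve_integral (f + g) = curve_integral f + curve_integral g" for f g :: "real \<Rightarrow>\<^sub>C 'a"
    by (rule bcontfun_eqI) (simp add: apply_curve_integral integral_add int)
  show "curve_integral (r *\<^sub>R f) = r *\<^sub>R curve_integral f" for r and f :: "real \<Rightarrow>\<^sub>C 'a"
    by (rule bcontfun_eqI) (simp add: apply_curve_integral)
qed (simp add: norm_curve_integral_le)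

definition curve_scale ::
  "'a::euclidean_space \<Rightarrow> (real \<Rightarrow>\<^sub>C 'b::real_normed_vector) \<Rightarrow> (real \<Rightarrow>\<^sub>C 'a) \<Rightarrow> (real \<Rightarrow>\<^sub>C 'b)"
  where "curve_scale a x v = Bcontfun (\<lambda>t. (apply_bcontfun v t \<bullet> a) *\<^sub>R apply_bcontfun x t)"

lemma curve_scale_bound:
  "norm ((apply_bcontfun v t \<bullet> a) *\<^sub>R apply_bcontfun x t) \<le> norm x * norm v * norm a"
proof -
  have "\<bar>apply_bcontfun v t \<bullet> a\<bar> \<le> norm v * norm a"
    using Cauchy_Schwarz_ineq2[of "apply_bcontfun v t" a]
      mult_right_mono[OF norm_bounded[of v t] norm_ge_zero[of a]] by linarith
  then have "\<bar>apply_bcontfun v t \<bullet> a\<bar> * norm (apply_bcontfun x t) \<le> (norm v * norm a) * norm x"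
    by (intro mult_mono) (auto simp: norm_bounded)
  then show ?thesis
    by (simp add: mult_ac)
qed

lemma apply_curve_scale:
  "apply_bcontfun (curve_scale a x v) t = (apply_bcontfun v t \<bullet> a) *\<^sub>R apply_bcontfun x t"
  unfolding curve_scale_def
  by (subst apply_Bcontfun[OF _ curve_scale_bound[of v _ a x]]) (auto intro!: continuous_intros)

lemma bounded_bilinear_curve_scale: "bounded_bilinear (curve_scale a)"
proof
  show "curve_scale a (x + y) v = curve_scale a x v + curve_scale a y v" for x y v
    by (rule bcontfun_eqI) (simp add: apply_curve_scale algebra_simps)
  show "curve_scale a x (v + w) = curve_scale a x v + curve_scale a x w" for x v w
    by (rule bcontfun_eqI) (simp add: apply_curve_scale algebra_simps inner_add_left)
  show "curve_scale a (r *\<^sub>R x) v = r *\<^sub>R curve_scale a x v" for r x v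
    by (rule bcontfun_eqI) (simp add: apply_curve_scale)
  show "curve_scale a x (r *\<^sub>R v) = r *\<^sub>R curve_scale a x v" for r x v
    by (rule bcontfun_eqI) (simp add: apply_curve_scale)
  show "\<exists>K. \<forall>x v. norm (curve_scale a x v) \<le> norm x * norm v * K"
    by (intro exI[of _ "norm a"] allI norm_bound) (simp add: apply_curve_scale curve_scale_bound del: norm_scaleR)
qed

lemma bounded_bilinear_compose_linear:
  assumes "bounded_linear T" "bounded_bilinear pr"
  shows "bounded_bilinear (\<lambda>x y. T (pr x y))"
proof -
  interpret T: bounded_linear T by fact
  interpret pr: bounded_bilinear pr by fact
  obtain K where K: "K > 0" "\<And>x. norm (T x) \<le> norm x * K"
    using T.pos_bounded by blast
  obtain L where L: "L > 0" "\<And>a b. norm (pr a b) \<le> norm a * norm b * L"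
    using pr.pos_bounded by blast
  have "norm (T (pr a b)) \<le> norm a * norm b * (L * K)" for a b
    using order_trans[OF K(2) mult_right_mono[OF L(2)]] K(1) by (simp add: mult.assoc)
  then show ?thesis
    by unfold_locales
      (auto simp: pr.add_left pr.add_right pr.scaleR_left pr.scaleR_right T.add T.scaleR)
qed


text \<open>
  Superposing a function on a curve is meaningful only while the curve stays in the domain of the
  function.  Projecting onto a closed ball first makes the operation total on the Banach space of
  curves, without increasing Lipschitz constants.
\<close>

locale ball_field =
  fixes A :: "'a::euclidean_space set" and z0 :: 'a and r :: real
  assumes r_pos: "r > 0" and open_A: "open A" and cball_A: "cball z0 r \<subseteq> A"
begin

abbreviation K where "K \<equiv> cball z0 r"

definition superpose :: "('a \<Rightarrow> 'b::real_normed_vector) \<Rightarrow> (real \<Rightarrow>\<^sub>C 'a) \<Rightarrow> (real \<Rightarrow>\<^sub>C 'b)" where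
  "superpose g c = Bcontfun (\<lambda>t. g (closest_point K (apply_bcontfun c t)))"

definition curves :: "(real \<Rightarrow>\<^sub>C 'a) set" where
  "curves = {c. \<forall>t. apply_bcontfun c t \<in> K}"

lemma K_facts: "convex K" "closed K" "K \<noteq> {}" "compact K"
  using r_pos by auto

lemma clamp_in: "closest_point K x \<in> K"
  by (rule closest_point_in_set[OF K_facts(2,3)])

lemma clamp_lipschitz: "norm (closest_point K x - closest_point K y) \<le> norm (x - y)"
  using closest_point_lipschitz[OF K_facts(1-3)] by (simp add: dist_norm)

lemma apply_superpose:
  assumes "continuous_on K g"
  shows "apply_bcontfun (superpose g c) t = g (closest_point K (apply_bcontfun c t))"
proof -
  have "continuous_on UNIV (\<lambda>t. closest_point K (apply_bcontfun c t))"
    by (rule continuous_on_compose2[OF continuous_on_closest_point[OF K_facts(1-3)]]) auto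
  then have "continuous_on UNIV (\<lambda>t. g (closest_point K (apply_bcontfun c t)))"
    by (rule continuous_on_compose2[OF assms]) (use clamp_in in auto)
  moreover obtain b where "\<forall>x\<in>K. norm (g x) \<le> b"
    using compact_imp_bounded[OF compact_continuous_image[OF assms K_facts(4)]]
    by (auto simp: bounded_iff)
  ultimately show ?thesis
    unfolding superpose_def by (subst apply_Bcontfun) (use clamp_in in auto)
qed

lemma apply_superpose_curves:
  "continuous_on K g \<Longrightarrow> c \<in> curves \<Longrightarrow> apply_bcontfun (superpose g c) t = g (apply_bcontfun c t)"
  by (simp add: apply_superpose curves_def closest_point_self)

lemma continuous_on_superpose:
  assumes "continuous_on K g"
  shows "continuous_on UNIV (superpose g)"
  unfolding continuous_on_iff
proof (intro ballI allI impI)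
  fix c :: "real \<Rightarrow>\<^sub>C 'a" and e :: real assume e: "e > 0"
  have "uniformly_continuous_on K g"
    using assms K_facts(4) compact_uniformly_continuous by blast
  then obtain d where d: "d > 0"
    "\<And>x y. x \<in> K \<Longrightarrow> y \<in> K \<Longrightarrow> dist y x < d \<Longrightarrow> dist (g y) (g x) < e / 2"
    unfolding uniformly_continuous_on_def using e half_gt_zero by metis
  have "dist (superpose g c') (superpose g c) < e" if "dist c' c < d" for c'
  proof -
    have "dist (superpose g c') (superpose g c) \<le> e / 2"
    proof (rule dist_bound)
      fix t
      have "dist (closest_point K (apply_bcontfun c' t)) (closest_point K (apply_bcontfun c t)) < d"
        using closest_point_lipschitz[OF K_facts(1-3)] dist_fun_lt_imp_dist_val_lt[OF that]
        by (rule le_less_trans)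
      then show "dist (apply_bcontfun (superpose g c') t) (apply_bcontfun (superpose g c) t) \<le> e / 2"
        using d(2)[OF clamp_in clamp_in] by (simp add: apply_superpose[OF assms] less_imp_le)
    qed
    then show ?thesis using e by simp
  qed
  then show "\<exists>d>0. \<forall>x'\<in>UNIV. dist x' c < d \<longrightarrow> dist (superpose g x') (superpose g c) < e"
    using d(1) by blast
qed

lemma smooth_continuous_K: "smooth_on Basis A g \<Longrightarrow> continuous_on K g"
  using smooth_on_continuous continuous_on_subset cball_A by blast

lemma smooth_deriv_continuous_K:
  "smooth_on Basis A g \<Longrightarrow> a \<in> Basis \<Longrightarrow> continuous_on K (\<lambda>x. deriv_along Basis g x a)"
  by (intro smooth_continuous_K smooth_on_deriv)

lemma has_derivative_K:
  "smooth_on Basis A g \<Longrightarrow> x \<in> K \<Longrightarrow> (g has_derivative deriv_along Basis g x) (at x)"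
  using has_derivative_deriv_along[OF smooth_on_differentiable, of Basis A g x] cball_A by auto

lemma deriv_expansion_K:
  "smooth_on Basis A g \<Longrightarrow> x \<in> K \<Longrightarrow>
    deriv_along Basis g x v = (\<Sum>a\<in>Basis. (v \<bullet> a) *\<^sub>R deriv_along Basis g x a)"
  using deriv_along_expansion[OF subset_refl smooth_on_differentiable, of A g x v] cball_A by auto

definition superpose_deriv :: "('a \<Rightarrow> 'b::real_normed_vector) \<Rightarrow> (real \<Rightarrow>\<^sub>C 'a) \<Rightarrow> (real \<Rightarrow>\<^sub>C 'a) \<Rightarrow> (real \<Rightarrow>\<^sub>C 'b)"
  where "superpose_deriv g c v =
    (\<Sum>a\<in>Basis. curve_scale a (superpose (\<lambda>x. deriv_along Basis g x a) c) v)"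

lemma apply_superpose_deriv:
  assumes "smooth_on Basis A g" "c \<in> curves"
  shows "apply_bcontfun (superpose_deriv g c v) t =
    deriv_along Basis g (apply_bcontfun c t) (apply_bcontfun v t)"
proof -
  have "apply_bcontfun c t \<in> K"
    using assms(2) by (simp add: curves_def)
  then show ?thesis
    using assms
    by (simp add: superpose_deriv_def apply_bcontfun_sum apply_curve_scale apply_superpose_curves
        smooth_deriv_continuous_K deriv_expansion_K[OF assms(1), of _ "apply_bcontfun v t"])
qed

lemma bounded_linear_superpose_deriv: "bounded_linear (superpose_deriv g c)"
  unfolding superpose_deriv_def
  by (intro bounded_linear_sum bounded_bilinear.bounded_linear_right bounded_bilinear_curve_scale)

text \<open>
  Superposition with \<^term>\<open>g\<close> is differentiable at curves inside the ball, because the derivative of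
  \<^term>\<open>g\<close> is uniformly continuous there and so the linearization error is small uniformly in time.
\<close>

lemma superpose_has_derivative:
  assumes "smooth_on Basis A g" "c \<in> curves"
  shows "(superpose g has_derivative superpose_deriv g c) (at c within curves)"
  unfolding has_derivative_within_alt
proof (intro conjI allI impI bounded_linear_superpose_deriv)
  fix e :: real assume e: "e > 0"
  define e' where "e' = e / DIM('a)"
  have e': "e' > 0"
    using e by (simp add: e'_def)
  have "\<exists>d>0. \<forall>x\<in>K. \<forall>y\<in>K. dist y x < d \<longrightarrow>
      dist (deriv_along Basis g y a) (deriv_along Basis g x a) < e'" if "a \<in> Basis" for a
    using compact_uniformly_continuous[OF smooth_deriv_continuous_K[OF assms(1) that] K_facts(4)] e'
    unfolding uniformly_continuous_on_def by blast
  then obtain d where d: "\<And>a. a \<in> Basis \<Longrightarrow> d a > 0"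
    "\<And>a x y. a \<in> Basis \<Longrightarrow> x \<in> K \<Longrightarrow> y \<in> K \<Longrightarrow> dist y x < d a \<Longrightarrow>
      dist (deriv_along Basis g y a) (deriv_along Basis g x a) < e'"
    by metis
  define d0 where "d0 = Min (d ` (Basis :: 'a set))"
  have d0: "d0 > 0" "\<And>a. a \<in> Basis \<Longrightarrow> d0 \<le> d a"
    using d(1) by (auto simp: d0_def)
  have deriv_close: "norm (deriv_along Basis g y v - deriv_along Basis g x v) \<le> norm v * e"
    if "x \<in> K" "y \<in> K" "dist y x < d0" for x y v
  proof -
    have "deriv_along Basis g y v - deriv_along Basis g x v =
        (\<Sum>a\<in>Basis. (v \<bullet> a) *\<^sub>R (deriv_along Basis g y a - deriv_along Basis g x a))"
      using that by (simp add: deriv_expansion_K[OF assms(1), of _ v] sum_subtractf scaleR_diff_right)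
    also have "norm \<dots> \<le> (\<Sum>a\<in>(Basis::'a set). norm v * e')"
    proof (rule sum_norm_le)
      fix a :: 'a assume a: "a \<in> Basis"
      have "dist (deriv_along Basis g y a) (deriv_along Basis g x a) < e'"
        using d(2)[OF a] that d0(2)[OF a] by simp
      then have "norm (deriv_along Basis g y a - deriv_along Basis g x a) \<le> e'"
        by (simp add: dist_norm)
      then show "norm ((v \<bullet> a) *\<^sub>R (deriv_along Basis g y a - deriv_along Basis g x a)) \<le> norm v * e'"
        using Basis_le_norm[OF a, of v] by (simp add: mult_mono)
    qed
    finally show ?thesis
      by (simp add: e'_def)
  qed
  show "\<exists>d>0. \<forall>y\<in>curves. norm (y - c) < d \<longrightarrow>
      norm (superpose g y - superpose g c - superpose_deriv g c (y - c)) \<le> e * norm (y - c)"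
  proof (intro exI[of _ d0] conjI ballI impI d0(1) norm_bound)
    fix c' t assume c': "c' \<in> curves" "norm (c' - c) < d0"
    let ?x = "apply_bcontfun c t" and ?y = "apply_bcontfun c' t"
    have xy: "?x \<in> K" "?y \<in> K"
      using assms(2) c'(1) by (simp_all add: curves_def)
    have dxy: "norm (?y - ?x) \<le> norm (c' - c)"
      using norm_bounded[of "c' - c" t] by simp
    define S where "S = K \<inter> ball ?x d0"
    have S: "convex S" "?x \<in> S" "?y \<in> S"
      using xy dxy c'(2) d0(1) by (auto simp: S_def dist_norm norm_minus_commute convex_Int)
    have "norm (g ?y - g ?x - deriv_along Basis g ?x (?y - ?x)) \<le> norm (?y - ?x) * e"
    proof (rule differentiable_bound_linearization[where S = S and f' = "deriv_along Basis g"])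
      show "?x + s *\<^sub>R (?y - ?x) \<in> S" if "s \<in> {0..1}" for s
        using that S convexD_alt[OF S(1-3), of s] by (simp add: algebra_simps)
      show "(g has_derivative deriv_along Basis g z) (at z within S)" if "z \<in> S" for z
        using has_derivative_K[OF assms(1), of z] that
        by (auto simp: S_def intro: has_derivative_at_withinI)
      show "onorm (deriv_along Basis g z - deriv_along Basis g ?x) \<le> e" if "z \<in> S" for z
        using deriv_close[OF xy(1), of z] that e
        by (intro onorm_bound) (auto simp: S_def dist_commute mult.commute)
    qed (rule S(2))
    also have "\<dots> \<le> norm (c' - c) * e"
      using dxy e by (intro mult_right_mono) auto
    finally show "norm (apply_bcontfun
        (superpose g c' - superpose g c - superpose_deriv g c (c' - c)) t) \<le> e * norm (c' - c)"
      using assms c'(1)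
      by (simp add: apply_superpose_curves apply_superpose_deriv smooth_continuous_K mult.commute)
  qed
qed

lemma Ck_on_superpose:
  assumes op: "openin (coord_top B) W" and cW: "\<And>w. w \<in> W \<Longrightarrow> c w \<in> curves"
    and "Ck_on B k W c" "smooth_on Basis A g"
  shows "Ck_on B k W (\<lambda>w. superpose g (c w))"
  using assms(3,4)
proof (induction k arbitrary: g)
  case 0
  have "continuous_on K g"
    using smooth_continuous_K[OF 0(2)] .
  then show ?case
    using 0(1) continuous_on_compose2[OF continuous_on_superpose] by auto
next
  case (Suc k)
  have ck: "Ck_on B k W c"
    by (rule Ck_on_Suc_imp[OF Suc.prems(1) openin_coord_subset[OF op]])
  show ?case
  proof (rule Ck_on_SucI[OF op])
    fix w assume w: "w \<in> W"
    have "(c has_derivative deriv_along B c w) (at w within W)"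
      using Ck_on_Suc_has_derivative[OF Suc.prems(1) w] at_within_openin_eq[OF op w] by simp
    moreover have "(superpose g has_derivative superpose_deriv g (c w)) (at (c w) within c ` W)"
      by (rule has_derivative_subset[OF superpose_has_derivative[OF Suc.prems(2) cW[OF w]]])
        (use cW in auto)
    ultimately have "((\<lambda>w. superpose g (c w)) has_derivative
        (\<lambda>h. superpose_deriv g (c w) (deriv_along B c w h))) (at w within W)"
      by (rule has_derivative_in_compose)
    then show "((\<lambda>w. superpose g (c w)) has_derivative
        (\<lambda>h. superpose_deriv g (c w) (deriv_along B c w h))) (at w within span B)"
      using at_within_openin_eq[OF op w] by simp
  next
    fix b assume b: "b \<in> B"
    have "Ck_on B k W (\<lambda>w. deriv_along B c w b)"
      using Suc.prems(1) b by simp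
    then show "Ck_on B k W (\<lambda>w. superpose_deriv g (c w) (deriv_along B c w b))"
      unfolding superpose_deriv_def
      by (intro Ck_on_sum op Ck_on_bilinear[OF bounded_bilinear_curve_scale] Suc.IH ck
          smooth_on_deriv[OF Suc.prems(2)])
  qed
qed

end


section \<open>Smooth dependence of solutions of differential equations\<close>

definition solution_in :: "'a set \<Rightarrow> ('a::real_normed_vector \<Rightarrow> 'a) \<Rightarrow> (real \<Rightarrow> 'a) \<Rightarrow> bool" where
  "solution_in S G c \<longleftrightarrow>
     (\<forall>t\<in>{0..1}. c t \<in> S \<and> (c has_vector_derivative G (c t)) (at t within {0..1}))"

text \<open>
  After rescaling time, a smooth field satisfies these bounds on a small ball.  The integral
  equation of its solutions is then a contraction on all curves, and curves that start in the ball of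
  half the radius never reach the boundary, where the projection would matter.
\<close>

locale contracting_field = ball_field A z0 r
  for A :: "'a::euclidean_space set" and z0 r +
  fixes G :: "'a \<Rightarrow> 'a"
  assumes smooth_G: "smooth_on Basis A G"
    and small_G: "\<And>x. x \<in> cball z0 r \<Longrightarrow> norm (G x) \<le> r / 2"
    and small_deriv_G: "\<And>x v. x \<in> cball z0 r \<Longrightarrow> norm (deriv_along Basis G x v) \<le> 1/2 * norm v"
begin

lemma continuous_G: "continuous_on K G"
  by (rule smooth_continuous_K[OF smooth_G])

lemma superpose_G_contracts: "dist (superpose G c) (superpose G c') \<le> 1/2 * dist c c'"
proof (rule dist_bound)
  fix t
  have "norm (G (closest_point K (apply_bcontfun c t)) - G (closest_point K (apply_bcontfun c' t))) \<le>
      1/2 * norm (closest_point K (apply_bcontfun c t) - closest_point K (apply_bcontfun c' t))"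
  proof (rule differentiable_bound[OF K_facts(1), where f' = "deriv_along Basis G"])
    show "(G has_derivative deriv_along Basis G x) (at x within K)" if "x \<in> K" for x
      by (rule has_derivative_at_withinI[OF has_derivative_K[OF smooth_G that]])
    show "onorm (deriv_along Basis G x) \<le> 1/2" if "x \<in> K" for x
      using small_deriv_G[OF that] by (intro onorm_bound) auto
  qed (rule clamp_in)+
  also have "\<dots> \<le> 1/2 * norm (apply_bcontfun c t - apply_bcontfun c' t)"
    using clamp_lipschitz by simp
  also have "\<dots> \<le> 1/2 * dist c c'"
    using dist_bounded[of c t c'] by (simp add: dist_norm)
  finally show "dist (apply_bcontfun (superpose G c) t) (apply_bcontfun (superpose G c') t) \<le>
      1/2 * dist c c'"
    by (simp add: apply_superpose[OF continuous_G] dist_norm)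
qed

lemma integral_superpose_contracts:
  "norm (curve_integral (superpose G c) - curve_integral (superpose G c')) \<le> 1/2 * norm (c - c')"
  using order_trans[OF norm_curve_integral_le[of "superpose G c - superpose G c'"]
      superpose_G_contracts[unfolded dist_norm]]
  by (simp add: linear_diff[OF bounded_linear.linear[OF bounded_linear_curve_integral]])

lemma ex1_flow_curve: "\<exists>!c. const_bcontfun w + curve_integral (superpose G c) = c"
  by (rule banach_fix_type[where c = "1/2"])
    (use integral_superpose_contracts in \<open>auto simp: dist_norm\<close>)

definition flow_curve :: "'a \<Rightarrow> (real \<Rightarrow>\<^sub>C 'a)" where
  "flow_curve w = (THE c. const_bcontfun w + curve_integral (superpose G c) = c)"

lemma flow_curve_eq: "flow_curve w = const_bcontfun w + curve_integral (superpose G (flow_curve w))"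
  unfolding flow_curve_def by (rule theI'[OF ex1_flow_curve, symmetric])

lemma flow_curve_unique:
  "c = const_bcontfun w + curve_integral (superpose G c) \<Longrightarrow> flow_curve w = c"
  using ex1_flow_curve[of w] flow_curve_eq[of w] by metis

definition starts :: "'a set" where
  "starts = ball z0 (r / 2)"

lemma open_starts: "openin (coord_top Basis) starts" "open starts"
  by (simp_all add: starts_def)

lemma flow_curve_in_curves:
  assumes "w \<in> starts"
  shows "flow_curve w \<in> curves"
  unfolding curves_def
proof (intro CollectI allI)
  fix t
  have "norm (superpose G (flow_curve w)) \<le> r / 2"
    by (rule norm_bound) (simp only: apply_superpose[OF continuous_G] small_G[OF clamp_in])
  then have "norm (apply_bcontfun (curve_integral (superpose G (flow_curve w))) t) \<le> r / 2"
    using norm_bounded norm_curve_integral_le order_trans by metis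
  moreover have "apply_bcontfun (flow_curve w) t =
      w + apply_bcontfun (curve_integral (superpose G (flow_curve w))) t"
    by (subst flow_curve_eq) simp
  ultimately have "dist w (apply_bcontfun (flow_curve w) t) \<le> r / 2"
    by (simp add: dist_norm)
  moreover have "dist z0 w < r / 2"
    using assms by (simp add: starts_def)
  ultimately show "apply_bcontfun (flow_curve w) t \<in> K"
    using dist_triangle[of z0 "apply_bcontfun (flow_curve w) t" w] by simp
qed

lemma flow_curve_lipschitz: "norm (flow_curve w - flow_curve w') \<le> 2 * norm (w - w')"
proof -
  have "flow_curve w - flow_curve w' = const_bcontfun (w - w') +
      (curve_integral (superpose G (flow_curve w)) - curve_integral (superpose G (flow_curve w')))"
    by (subst flow_curve_eq, subst (2) flow_curve_eq) (auto intro!: bcontfun_eqI)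
  then have "norm (flow_curve w - flow_curve w') \<le> norm (const_bcontfun (w - w') :: real \<Rightarrow>\<^sub>C 'a) +
      norm (curve_integral (superpose G (flow_curve w)) - curve_integral (superpose G (flow_curve w')))"
    by (metis norm_triangle_ineq)
  also have "norm (const_bcontfun (w - w') :: real \<Rightarrow>\<^sub>C 'a) \<le> norm (w - w')"
    by (rule norm_bound) simp
  finally show ?thesis
    using integral_superpose_contracts[of "flow_curve w" "flow_curve w'"] by simp
qed

definition linearized :: "'a \<Rightarrow> (real \<Rightarrow>\<^sub>C 'a) \<Rightarrow> (real \<Rightarrow>\<^sub>C 'a)" where
  "linearized w v = curve_integral (superpose_deriv G (flow_curve w) v)"

lemma bounded_linear_linearized: "bounded_linear (linearized w)"
  unfolding linearized_def
  by (rule bounded_linear_compose[OF bounded_linear_curve_integral bounded_linear_superpose_deriv])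

lemma norm_linearized_le:
  assumes "w \<in> starts"
  shows "norm (linearized w v) \<le> 1/2 * norm v"
proof -
  have "norm (superpose_deriv G (flow_curve w) v) \<le> 1/2 * norm v"
  proof (rule norm_bound)
    fix t
    have "apply_bcontfun (flow_curve w) t \<in> K"
      using flow_curve_in_curves[OF assms] by (simp add: curves_def)
    then have "norm (deriv_along Basis G (apply_bcontfun (flow_curve w) t) (apply_bcontfun v t)) \<le>
        1/2 * norm (apply_bcontfun v t)"
      by (rule small_deriv_G)
    then show "norm (apply_bcontfun (superpose_deriv G (flow_curve w) v) t) \<le> 1/2 * norm v"
      using norm_bounded[of v t]
      by (simp add: apply_superpose_deriv[OF smooth_G flow_curve_in_curves[OF assms]])
  qed
  then show ?thesis
    unfolding linearized_def by (rule order_trans[OF norm_curve_integral_le])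
qed

text \<open>
  The nonlinear term of the integral equation differs from its linearization by a term of higher
  order in the curve, hence, the curve being Lipschitz in its starting point, by a term of higher
  order in the starting point.
\<close>

lemma flow_curve_has_derivative:
  assumes w: "w \<in> starts"
  obtains D where "(flow_curve has_derivative D) (at w)"
    "\<And>h. D h = linearized w (D h) + const_bcontfun h"
proof -
  define \<phi> where "\<phi> c = curve_integral (superpose G c) - linearized w c" for c
  have "(\<phi> has_derivative
      (\<lambda>h. curve_integral (superpose_deriv G (flow_curve w) h) - linearized w h))
      (at (flow_curve w) within curves)"
    unfolding \<phi>_def
    by (rule has_derivative_diff[OF
          bounded_linear.has_derivative[OF bounded_linear_curve_integral
            superpose_has_derivative[OF smooth_G flow_curve_in_curves[OF w]]]
          bounded_linear_imp_has_derivative[OF bounded_linear_linearized]])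
  then have \<phi>: "(\<phi> has_derivative (\<lambda>h. 0)) (at (flow_curve w) within curves)"
    by (simp add: linearized_def)
  have "((\<lambda>w'. \<phi> (flow_curve w')) has_derivative (\<lambda>h. 0)) (at w within starts)"
    by (rule has_derivative_zero_compose_lipschitz[where f = flow_curve and T = curves and L = 2
          and \<phi> = \<phi>, OF \<phi> flow_curve_in_curves flow_curve_lipschitz])
  moreover have "at w within starts = at w"
    by (rule at_within_open[OF w]) (simp add: starts_def)
  ultimately have "((\<lambda>w'. \<phi> (flow_curve w')) has_derivative (\<lambda>h. 0)) (at w)"
    by simp
  then have "((\<lambda>w'. const_bcontfun w' + \<phi> (flow_curve w')) has_derivative
      (\<lambda>h. const_bcontfun h + 0)) (at w)"
    by (rule has_derivative_add[OF
          bounded_linear_imp_has_derivative[OF bounded_linear_const_bcontfun]])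
  moreover have "const_bcontfun w' + \<phi> (flow_curve w') = flow_curve w' - linearized w (flow_curve w')" for w'
    unfolding \<phi>_def using flow_curve_eq[of w'] by (metis add_diff_eq)
  ultimately have "((\<lambda>w'. flow_curve w' - linearized w (flow_curve w')) has_derivative const_bcontfun)
      (at w)"
    by simp
  from has_derivative_resolvent[OF bounded_linear_linearized norm_linearized_le[OF w] this]
  show thesis
    using that by blast
qed

text \<open>
  The partial derivatives of the flow curve solve the linearized equation, whose coefficients
  are smooth functions superposed on the flow curve itself; each order of differentiability of the
  curve thus yields the next one.
\<close>

lemma Ck_on_flow_curve: "Ck_on Basis k starts flow_curve"
proof (induction k)
  case 0
  have "isCont flow_curve w" if "w \<in> starts" for w
    using flow_curve_has_derivative[OF that] has_derivative_continuous by metis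
  then show ?case
    by (simp add: continuous_at_imp_continuous_on)
next
  case (Suc k)
  have lin: "linearized w v = (\<Sum>a\<in>Basis. curve_integral
      (curve_scale a (superpose (\<lambda>x. deriv_along Basis G x a) (flow_curve w)) v))" for w v
    unfolding linearized_def superpose_deriv_def
    by (rule linear_sum[OF bounded_linear.linear[OF bounded_linear_curve_integral]])
  show ?case
  proof (rule Ck_on_SucI[OF open_starts(1)])
    fix w assume w: "w \<in> starts"
    show "(flow_curve has_derivative deriv_along Basis flow_curve w) (at w within span Basis)"
      by (rule flow_curve_has_derivative[OF w], rule has_derivative_deriv_along)
        (auto simp: differentiable_def)
  next
    fix b :: 'a assume b: "b \<in> Basis"
    show "Ck_on Basis k starts (\<lambda>w. deriv_along Basis flow_curve w b)"
    proof (rule Ck_on_linear_equation[where J = Basis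
          and \<beta> = "\<lambda>a x v. curve_integral (curve_scale a x v)"
          and x = "\<lambda>a w. superpose (\<lambda>x. deriv_along Basis G x a) (flow_curve w)"
          and H = "\<lambda>w. const_bcontfun b"])
      show "Ck_on Basis k starts (\<lambda>w. superpose (\<lambda>x. deriv_along Basis G x a) (flow_curve w))"
        if "a \<in> Basis" for a
        by (intro Ck_on_superpose open_starts(1) flow_curve_in_curves Suc smooth_on_deriv smooth_G that)
      show "norm (\<Sum>a\<in>Basis. curve_integral
          (curve_scale a (superpose (\<lambda>x. deriv_along Basis G x a) (flow_curve w)) v)) \<le> 1/2 * norm v"
        if "w \<in> starts" for w v
        using norm_linearized_le[OF that] by (simp add: lin)
      fix w assume w: "w \<in> starts"
      obtain D where D: "(flow_curve has_derivative D) (at w)"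
        "\<And>h. D h = linearized w (D h) + const_bcontfun h"
        using flow_curve_has_derivative[OF w] by blast
      have "deriv_along Basis flow_curve w b = D b"
        by (rule deriv_along_eq) (use D(1) in auto)
      with D(2)[of b] show "deriv_along Basis flow_curve w b = (\<Sum>a\<in>Basis. curve_integral
          (curve_scale a (superpose (\<lambda>x. deriv_along Basis G x a) (flow_curve w))
            (deriv_along Basis flow_curve w b))) + const_bcontfun b"
        by (simp add: lin)
    qed (auto intro: open_starts bounded_bilinear_compose_linear bounded_linear_curve_integral
        bounded_bilinear_curve_scale Ck_on_const)
  qed
qed

lemma smooth_on_flow: "smooth_on Basis starts (\<lambda>w. apply_bcontfun (flow_curve w) 1)"
  by (intro smooth_on_bounded_linear_compose[OF open_starts(1) bounded_linear_apply_bcontfun])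
    (simp add: smooth_on_def Ck_on_flow_curve)

lemma flow_curve_is_solution:
  assumes "w \<in> starts"
  shows "solution_in K G (apply_bcontfun (flow_curve w))"
  unfolding solution_in_def
proof (intro ballI conjI)
  fix t :: real assume t: "t \<in> {0..1}"
  let ?c = "apply_bcontfun (flow_curve w)"
  have c: "flow_curve w \<in> curves"
    by (rule flow_curve_in_curves[OF assms])
  then show "?c t \<in> cball z0 r"
    by (simp add: curves_def)
  have eq: "?c s = w + integral {0..s} (\<lambda>s. G (?c s))" if "s \<in> {0..1}" for s
  proof -
    have "?c s = w + apply_bcontfun (curve_integral (superpose G (flow_curve w))) s"
      by (subst flow_curve_eq) simp
    moreover have "max 0 (min 1 s) = s"
      using that by simp
    moreover have "apply_bcontfun (superpose G (flow_curve w)) = (\<lambda>s. G (?c s))"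
      using apply_superpose_curves[OF continuous_G c] by blast
    ultimately show ?thesis
      by (simp add: apply_curve_integral)
  qed
  have "continuous_on {0..1} (\<lambda>s. G (?c s))"
    by (rule continuous_on_compose2[OF continuous_G]) (use c in \<open>auto simp: curves_def\<close>)
  from integral_has_vector_derivative[OF this t]
  have "((\<lambda>s. w + integral {0..s} (\<lambda>s. G (?c s))) has_vector_derivative 0 + G (?c t))
      (at t within {0..1})"
    by (intro has_vector_derivative_add has_vector_derivative_const)
  then show "(?c has_vector_derivative G (?c t)) (at t within {0..1})"
    using has_vector_derivative_transform[OF t, of ?c] eq by simp
qed

lemma flow_curve_start: "apply_bcontfun (flow_curve w) 0 = w"
  by (subst flow_curve_eq) (simp add: apply_curve_integral)

lemma solution_unique:
  assumes c: "solution_in K G c" and t: "t \<in> {0..1}"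
  shows "apply_bcontfun (flow_curve (c 0)) t = c t"
proof -
  define c' where "c' t = c (max 0 (min 1 t))" for t
  have cont: "continuous_on {0..1} c"
    unfolding continuous_on_eq_continuous_within
  proof
    show "continuous (at t within {0..1}) c" if "t \<in> {0..1}" for t
      by (rule has_vector_derivative_continuous) (use c that in \<open>auto simp: solution_in_def\<close>)
  qed
  then have "continuous_on UNIV c'"
    unfolding c'_def by (rule continuous_on_compose2) (auto intro!: continuous_intros)
  moreover have c'K: "c' t \<in> K" for t
    using c by (auto simp: c'_def solution_in_def)
  moreover obtain b where "\<forall>x\<in>K. norm x \<le> b"
    using compact_imp_bounded[OF K_facts(4)] by (auto simp: bounded_iff)
  ultimately have app: "apply_bcontfun (Bcontfun c') = c'"
    by (intro apply_Bcontfun) auto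
  have curve: "Bcontfun c' \<in> curves"
    using c'K by (simp add: curves_def app)
  have "Bcontfun c' = const_bcontfun (c 0) + curve_integral (superpose G (Bcontfun c'))"
  proof (rule bcontfun_eqI)
    fix t :: real
    let ?t = "max 0 (min 1 t)"
    have "((\<lambda>s. G (c s)) has_integral (c ?t - c 0)) {0..?t}"
    proof (rule fundamental_theorem_of_calculus)
      fix s assume "s \<in> {0..?t}"
      then have "(c has_vector_derivative G (c s)) (at s within {0..1})"
        using c by (auto simp: solution_in_def)
      then show "(c has_vector_derivative G (c s)) (at s within {0..?t})"
        by (rule has_vector_derivative_within_subset) auto
    qed auto
    then have "integral {0..?t} (\<lambda>s. G (c s)) = c ?t - c 0"
      by (rule integral_unique)
    moreover have "integral {0..?t} (\<lambda>s. G (c s)) =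
        integral {0..?t} (apply_bcontfun (superpose G (Bcontfun c')))"
      by (rule integral_cong) (auto simp: apply_superpose_curves[OF continuous_G curve] app c'_def)
    ultimately show "apply_bcontfun (Bcontfun c') t =
        apply_bcontfun (const_bcontfun (c 0) + curve_integral (superpose G (Bcontfun c'))) t"
      by (simp add: apply_curve_integral app c'_def)
  qed
  from flow_curve_unique[OF this] show ?thesis
    using t by (simp add: app c'_def)
qed

end

text \<open>
  The field is multiplied by a small constant \<open>\<epsilon>\<close> so that \<open>\<Phi>\<close>, the flow at time 1 of
  the rescaled field, exists near \<^term>\<open>z0\<close>.  Uniqueness is recorded for arbitrary solutions in the
  ball, since it is what identifies \<open>\<Phi>\<close> with curves obtained by reversing or rescaling time.
\<close>

theorem smooth_flow:
  fixes G :: "'a::euclidean_space \<Rightarrow> 'a"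
  assumes "open A" "smooth_on Basis A G" "z0 \<in> A"
  shows "\<exists>r \<epsilon> \<rho> \<Phi>. r > 0 \<and> \<epsilon> > 0 \<and> \<rho> > 0 \<and> cball z0 r \<subseteq> A \<and> smooth_on Basis (ball z0 \<rho>) \<Phi> \<and>
    (\<forall>w\<in>ball z0 \<rho>. \<exists>c. solution_in (cball z0 r) (\<lambda>x. \<epsilon> *\<^sub>R G x) c \<and> c 0 = w) \<and>
    (\<forall>c. solution_in (cball z0 r) (\<lambda>x. \<epsilon> *\<^sub>R G x) c \<longrightarrow> c 0 \<in> ball z0 \<rho> \<longrightarrow> \<Phi> (c 0) = c 1)"
proof -
  obtain r where r: "r > 0" "cball z0 r \<subseteq> A"
    using open_contains_cball assms(1,3) by blast
  interpret ball_field A z0 r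
    by unfold_locales (use assms r in auto)
  obtain M where M: "\<forall>x\<in>K. norm (G x) \<le> M"
    using compact_imp_bounded[OF compact_continuous_image[OF smooth_continuous_K[OF assms(2)] K_facts(4)]]
    by (auto simp: bounded_iff)
  have "\<exists>N. \<forall>x\<in>K. norm (deriv_along Basis G x a) \<le> N" if "a \<in> Basis" for a
    using compact_imp_bounded[OF compact_continuous_image[OF
          smooth_deriv_continuous_K[OF assms(2) that] K_facts(4)]]
    by (auto simp: bounded_iff)
  then obtain N where N: "\<And>a x. a \<in> Basis \<Longrightarrow> x \<in> K \<Longrightarrow> norm (deriv_along Basis G x a) \<le> N a"
    by metis
  define L where "L = (\<Sum>a\<in>Basis. N a)"
  have L: "norm (deriv_along Basis G x v) \<le> L * norm v" if "x \<in> K" for x v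
  proof -
    have "norm (deriv_along Basis G x v) \<le> (\<Sum>a\<in>Basis. norm v * N a)"
      unfolding deriv_expansion_K[OF assms(2) that, of v]
    proof (rule sum_norm_le)
      fix a :: 'a assume a: "a \<in> Basis"
      show "norm ((v \<bullet> a) *\<^sub>R deriv_along Basis G x a) \<le> norm v * N a"
        using Basis_le_norm[OF a, of v] N[OF a that] by (simp add: mult_mono)
    qed
    then show ?thesis
      by (simp add: L_def sum_distrib_left mult.commute)
  qed
  define \<epsilon> where "\<epsilon> = min (r / 2 / (\<bar>M\<bar> + 1)) (1 / 2 / (\<bar>L\<bar> + 1))"
  have pos: "\<bar>M\<bar> + 1 > 0" "\<bar>L\<bar> + 1 > 0"
    by simp_all
  have \<epsilon>: "\<epsilon> > 0" "\<epsilon> * (\<bar>M\<bar> + 1) \<le> r / 2" "\<epsilon> * (\<bar>L\<bar> + 1) \<le> 1 / 2"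
    unfolding pos_le_divide_eq[OF pos(1), symmetric] pos_le_divide_eq[OF pos(2), symmetric]
    using r(1) by (simp_all only: \<epsilon>_def min.cobounded1 min.cobounded2) simp
  have deriv: "deriv_along Basis (\<lambda>x. \<epsilon> *\<^sub>R G x) x v = \<epsilon> *\<^sub>R deriv_along Basis G x v" if "x \<in> K" for x v
    by (rule deriv_along_eq)
      (use has_derivative_scaleR_right[OF has_derivative_K[OF assms(2) that], of \<epsilon>] in simp_all)
  interpret contracting_field A z0 r "\<lambda>x. \<epsilon> *\<^sub>R G x"
  proof
    show "smooth_on Basis A (\<lambda>x. \<epsilon> *\<^sub>R G x)"
      by (rule smooth_on_bounded_linear_compose[OF _ bounded_linear_scaleR_right assms(2)])
        (simp add: assms(1))
    show "norm (\<epsilon> *\<^sub>R G x) \<le> r / 2" if "x \<in> K" for x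
    proof -
      have "\<epsilon> * norm (G x) \<le> \<epsilon> * (\<bar>M\<bar> + 1)"
        using M that \<epsilon>(1) by (intro mult_left_mono) force+
      from order_trans[OF this \<epsilon>(2)] show ?thesis
        using \<epsilon>(1) by simp
    qed
    show "norm (deriv_along Basis (\<lambda>x. \<epsilon> *\<^sub>R G x) x v) \<le> 1 / 2 * norm v" if "x \<in> K" for x v
    proof -
      have "\<epsilon> * norm (deriv_along Basis G x v) \<le> \<epsilon> * ((\<bar>L\<bar> + 1) * norm v)"
        using order_trans[OF L[OF that, of v] mult_right_mono[of L "\<bar>L\<bar> + 1"]] \<epsilon>(1)
        by (intro mult_left_mono) auto
      also have "\<dots> \<le> 1/2 * norm v"
        using mult_right_mono[OF \<epsilon>(3), of "norm v"] by (simp add: mult.assoc)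
      finally show ?thesis
        using \<epsilon>(1) by (simp add: deriv[OF that])
    qed
  qed
  show ?thesis
  proof (intro exI conjI ballI allI impI)
    show "smooth_on Basis (ball z0 (r / 2)) (\<lambda>w. apply_bcontfun (flow_curve w) 1)"
      using smooth_on_flow by (simp add: starts_def)
    fix w assume "w \<in> ball z0 (r / 2)"
    then show "solution_in (cball z0 r) (\<lambda>x. \<epsilon> *\<^sub>R G x) (apply_bcontfun (flow_curve w))"
      by (intro flow_curve_is_solution) (simp add: starts_def)
    show "apply_bcontfun (flow_curve w) 0 = w"
      by (rule flow_curve_start)
  next
    show "apply_bcontfun (flow_curve (c 0)) 1 = c 1"
      if "solution_in (cball z0 r) (\<lambda>x. \<epsilon> *\<^sub>R G x) c" for c
      by (rule solution_unique[OF that]) simp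
  qed (use r \<epsilon>(1) in auto)
qed


section \<open>Families of diffeomorphisms along the fibres of a map\<close>

definition coord_proj :: "'a::euclidean_space set \<Rightarrow> 'a \<Rightarrow> 'a" where
  "coord_proj B x = (\<Sum>b\<in>B. (x \<bullet> b) *\<^sub>R b)"

lemma bounded_linear_coord_proj: "bounded_linear (coord_proj B)"
  unfolding coord_proj_def by (intro bounded_linear_intros)

lemma coord_proj_in_span: "coord_proj B x \<in> span B"
  unfolding coord_proj_def by (intro span_sum span_scale span_base)

lemma coord_proj_span: "B \<subseteq> Basis \<Longrightarrow> x \<in> span B \<Longrightarrow> coord_proj B x = x"
  unfolding coord_proj_def by (rule span_coord_expansion)

lemma norm_coord_proj_le:
  assumes "B \<subseteq> Basis"
  shows "norm (coord_proj B x) \<le> norm x"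
proof (rule norm_le_componentwise)
  fix i :: 'a assume i: "i \<in> Basis"
  have fin: "finite B"
    using assms finite_Basis finite_subset by blast
  have "coord_proj B x \<bullet> i = (\<Sum>b\<in>B. if b = i then x \<bullet> i else 0)"
    unfolding coord_proj_def inner_sum_left
    by (rule sum.cong) (use assms i in \<open>auto simp: inner_Basis\<close>)
  also have "\<dots> = (if i \<in> B then x \<bullet> i else 0)"
    using fin by simp
  finally show "\<bar>coord_proj B x \<bullet> i\<bar> \<le> \<bar>x \<bullet> i\<bar>"
    by simp
qed

text \<open>
  The coordinate form of the distribution.  It is in general smaller than the kernel of the
  differential at the point, whose elements need not extend to smooth annihilated fields.
\<close>

definition kernel_values ::
  "'a::euclidean_space set \<Rightarrow> 'a set \<Rightarrow> ('a \<Rightarrow> 'b::real_normed_vector) \<Rightarrow> 'a \<Rightarrow> 'a set" where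
  "kernel_values B A F y =
     {Y y | Y V. openin (coord_top B) V \<and> y \<in> V \<and> V \<subseteq> A \<and> smooth_on B V Y \<and>
        (\<forall>z\<in>V. Y z \<in> span B \<and> deriv_along B F z (Y z) = 0)}"

lemma kernel_valuesI:
  "openin (coord_top B) V \<Longrightarrow> y \<in> V \<Longrightarrow> V \<subseteq> A \<Longrightarrow> smooth_on B V Y \<Longrightarrow>
   (\<And>z. z \<in> V \<Longrightarrow> Y z \<in> span B) \<Longrightarrow> (\<And>z. z \<in> V \<Longrightarrow> deriv_along B F z (Y z) = 0) \<Longrightarrow>
   Y y \<in> kernel_values B A F y"
  unfolding kernel_values_def by blast

lemma kernel_valuesE:
  assumes "\<xi> \<in> kernel_values B A F y"
  obtains Y V where "openin (coord_top B) V" "y \<in> V" "V \<subseteq> A" "smooth_on B V Y"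
    "\<And>z. z \<in> V \<Longrightarrow> Y z \<in> span B" "\<And>z. z \<in> V \<Longrightarrow> deriv_along B F z (Y z) = 0" "\<xi> = Y y"
  using assms unfolding kernel_values_def by blast

lemma subspace_kernel_values:
  assumes "openin (coord_top B) A" "smooth_on B A F" "y \<in> A"
  shows "subspace (kernel_values B A F y)"
proof (rule subspaceI)
  have lin: "linear (deriv_along B F z)" if "z \<in> A" for z
    by (rule deriv_along_linear[OF smooth_on_differentiable[OF assms(2) that]])
  show "0 \<in> kernel_values B A F y"
    by (rule kernel_valuesI[where V = A and Y = "\<lambda>_. 0"])
      (use assms lin in \<open>auto intro: smooth_on_const span_zero linear_0\<close>)
  fix \<xi> \<eta> assume "\<xi> \<in> kernel_values B A F y" "\<eta> \<in> kernel_values B A F y"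
  note \<xi>\<eta> = this
  obtain X V where
    X: "openin (coord_top B) V" "y \<in> V" "V \<subseteq> A" "smooth_on B V X"
    "\<And>z. z \<in> V \<Longrightarrow> X z \<in> span B" "\<And>z. z \<in> V \<Longrightarrow> deriv_along B F z (X z) = 0" "\<xi> = X y"
    using kernel_valuesE[OF \<xi>\<eta>(1)] by metis
  obtain Y W where
    Y: "openin (coord_top B) W" "y \<in> W" "W \<subseteq> A" "smooth_on B W Y"
    "\<And>z. z \<in> W \<Longrightarrow> Y z \<in> span B" "\<And>z. z \<in> W \<Longrightarrow> deriv_along B F z (Y z) = 0" "\<eta> = Y y"
    using kernel_valuesE[OF \<xi>\<eta>(2)] by metis
  have "X y + Y y \<in> kernel_values B A F y"
  proof (rule kernel_valuesI[where V = "V \<inter> W" and Y = "\<lambda>z. X z + Y z"])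
    show "openin (coord_top B) (V \<inter> W)"
      using X(1) Y(1) by (rule openin_Int)
    then show "smooth_on B (V \<inter> W) (\<lambda>z. X z + Y z)"
      by (rule smooth_on_add) (use X(4) Y(4) smooth_on_subset in blast)+
    show "deriv_along B F z (X z + Y z) = 0" if "z \<in> V \<inter> W" for z
      using linear_add[OF lin[of z], of "X z" "Y z"] X Y that by auto
  qed (use X Y in \<open>auto intro: span_add\<close>)
  then show "\<xi> + \<eta> \<in> kernel_values B A F y"
    using X(7) Y(7) by simp
next
  fix r :: real and \<xi>
  have lin: "linear (deriv_along B F z)" if "z \<in> A" for z
    by (rule deriv_along_linear[OF smooth_on_differentiable[OF assms(2) that]])
  assume "\<xi> \<in> kernel_values B A F y"
  then obtain X V where
    X: "openin (coord_top B) V" "y \<in> V" "V \<subseteq> A" "smooth_on B V X"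
    "\<And>z. z \<in> V \<Longrightarrow> X z \<in> span B" "\<And>z. z \<in> V \<Longrightarrow> deriv_along B F z (X z) = 0" "\<xi> = X y"
    using kernel_valuesE by metis
  have "r *\<^sub>R X y \<in> kernel_values B A F y"
  proof (rule kernel_valuesI[where V = V and Y = "\<lambda>z. r *\<^sub>R X z"])
    show "smooth_on B V (\<lambda>z. r *\<^sub>R X z)"
      by (rule smooth_on_bounded_linear_compose[OF X(1) bounded_linear_scaleR_right X(4)])
    show "deriv_along B F z (r *\<^sub>R X z) = 0" if "z \<in> V" for z
      using linear_scale[OF lin[of z], of r "X z"] X that by auto
  qed (use X in \<open>auto intro: span_scale\<close>)
  then show "r *\<^sub>R \<xi> \<in> kernel_values B A F y"
    using X(7) by simp
qed

lemma subspace_parametrization: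
  fixes L :: "'a::euclidean_space set"
  assumes "subspace L"
  shows "\<exists>K \<xi>. K \<subseteq> (Basis :: 'a set) \<and> linear \<xi> \<and> \<xi> ` span K = L \<and> inj_on \<xi> (span K)"
proof -
  have "dim L \<le> card (Basis :: 'a set)"
    using dim_subset_UNIV[of L] by simp
  then obtain K :: "'a set" where K: "K \<subseteq> Basis" "card K = dim L"
    by (rule obtain_subset_with_card_n)
  have "dim (span K) = card K"
    using independent_mono[OF independent_Basis K(1)] by (simp add: dim_eq_card_independent)
  then obtain \<xi> where "linear \<xi>" "\<xi> ` span K = L" "inj_on \<xi> (span K)"
    using subspace_isomorphism[of "span K" L] assms K(2) by auto
  with K(1) show ?thesis
    by blast
qed

lemma smooth_on_Basis_has_derivative:
  "smooth_on Basis A f \<Longrightarrow> x \<in> A \<Longrightarrow> (f has_derivative deriv_along Basis f x) (at x)"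
  using has_derivative_deriv_along[OF smooth_on_differentiable, of Basis A f x] by simp

lemma deriv_along_Basis_eq: "(f has_derivative f') (at x) \<Longrightarrow> deriv_along Basis f x v = f' v"
  using deriv_along_eq[of f f' x Basis v] by simp

lemma constant_on_unit_interval:
  fixes f :: "real \<Rightarrow> 'b::real_normed_vector"
  assumes "\<And>t. t \<in> {0..1} \<Longrightarrow> (f has_vector_derivative 0) (at t within {0..1})" "t \<in> {0..1}"
  shows "f t = f 0"
  by (rule has_derivative_zero_unique[of "{0..1}"])
    (use assms in \<open>auto simp: has_vector_derivative_def\<close>)

text \<open>
  The flow of a linear family of fields annihilated by \<^term>\<open>F\<close>, with the parameter of the family
  carried along as part of the state.  The parameter space realises the whole space of values at
  \<^term>\<open>a\<close>, and reversing time amounts to negating the parameter.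
\<close>

lemma level_preserving_family:
  fixes A :: "'a::euclidean_space set" and F :: "'a \<Rightarrow> 'b::real_normed_vector"
  assumes "open A" "smooth_on Basis A F" "a \<in> A"
  obtains K \<xi> \<rho> \<phi> where "K \<subseteq> (Basis :: 'a set)" "linear \<xi>" "inj_on \<xi> (span K)"
    "\<xi> ` span K = kernel_values Basis A F a" "\<rho> > 0" "smooth_on Basis (ball (a, 0 :: 'a) \<rho>) \<phi>"
    "\<And>z u. (z, u) \<in> ball (a, 0) \<rho> \<Longrightarrow> z \<in> A \<and> \<phi> (z, u) \<in> A \<and> F (\<phi> (z, u)) = F z"
    "\<And>z u. (z, u) \<in> ball (a, 0) \<rho> \<Longrightarrow> (\<phi> (z, u), - u) \<in> ball (a, 0) \<rho> \<Longrightarrow>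
       \<phi> (\<phi> (z, u), - u) = z"
    "\<phi> (a, 0) = a" "\<And>u. u \<in> span K \<Longrightarrow> deriv_along Basis \<phi> (a, 0) (0, u) = \<xi> u"
proof -
  have sub: "subspace (kernel_values Basis A F a)"
    using subspace_kernel_values[of Basis A F a] assms by simp
  from subspace_parametrization[OF this] obtain K :: "'a set" and \<xi> where K: "K \<subseteq> Basis" and \<xi>: "linear \<xi>" "\<xi> ` span K = kernel_values Basis A F a"
    "inj_on \<xi> (span K)"
    by blast
  have finK: "finite K"
    using K finite_Basis finite_subset by blast
  have "\<exists>X V. open V \<and> a \<in> V \<and> V \<subseteq> A \<and> smooth_on Basis V X \<and>
      (\<forall>z\<in>V. deriv_along Basis F z (X z) = 0) \<and> X a = \<xi> b" if "b \<in> K" for b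
  proof -
    have "\<xi> b \<in> kernel_values Basis A F a"
      using \<xi>(2) span_base[OF that] by blast
    then show ?thesis
      by (rule kernel_valuesE) (auto; metis)
  qed
  then obtain X V where XV: "\<And>b. b \<in> K \<Longrightarrow> open (V b)" "\<And>b. b \<in> K \<Longrightarrow> a \<in> V b"
    "\<And>b. b \<in> K \<Longrightarrow> smooth_on Basis (V b) (X b)"
    "\<And>b z. b \<in> K \<Longrightarrow> z \<in> V b \<Longrightarrow> deriv_along Basis F z (X b z) = 0"
    "\<And>b. b \<in> K \<Longrightarrow> X b a = \<xi> b"
    by metis
  define V0 where "V0 = A \<inter> (\<Inter>b\<in>K. V b)"
  have V0: "open V0" "a \<in> V0" "V0 \<subseteq> A"
    using assms XV finK by (auto simp: V0_def intro!: open_Int open_INT)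
  define Y where "Y u z = (\<Sum>b\<in>K. (u \<bullet> b) *\<^sub>R X b z)" for u z
  define G where "G w = (Y (snd w) (fst w), 0 :: 'a)" for w :: "'a \<times> 'a"
  have DFY: "deriv_along Basis F z (Y u z) = 0" if "z \<in> V0" for z u
  proof -
    have lin: "linear (deriv_along Basis F z)"
      by (rule deriv_along_linear[OF smooth_on_differentiable[OF assms(2)]]) (use that V0 in auto)
    show ?thesis
      using XV(4) that unfolding Y_def linear_sum[OF lin] linear_scale[OF lin]
      by (auto intro!: sum.neutral simp: V0_def)
  qed
  have Ya: "Y u a = \<xi> u" if "u \<in> span K" for u
    unfolding Y_def linear_coord_expansion[OF K \<xi>(1) that] by (rule sum.cong) (auto simp: XV(5))
  have op: "open (V0 \<times> (UNIV :: 'a set))"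
    using V0(1) by (simp add: open_Times)
  have "smooth_on Basis (V0 \<times> (UNIV :: 'a set)) (\<lambda>w. X b (fst w))" if "b \<in> K" for b
    by (rule smooth_on_compose[where B' = Basis and A' = "V b" and f = fst and g = "X b"])
      (use op XV(1-3) that in \<open>auto simp: V0_def intro: smooth_on_bounded_linear bounded_linear_fst\<close>)
  moreover have "smooth_on Basis (V0 \<times> (UNIV :: 'a set)) (\<lambda>w. snd w \<bullet> b)" for b
    by (rule smooth_on_bounded_linear) (use op in \<open>auto intro!: bounded_linear_intros\<close>)
  ultimately have "smooth_on Basis (V0 \<times> (UNIV :: 'a set)) (\<lambda>w. \<Sum>b\<in>K. (snd w \<bullet> b) *\<^sub>R X b (fst w))"
    using op by (intro smooth_on_sum smooth_on_scaleR) auto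
  then have smooth_G: "smooth_on Basis (V0 \<times> UNIV) G"
    unfolding G_def Y_def using op by (intro smooth_on_Pair smooth_on_const) auto
  have "(a, 0) \<in> V0 \<times> (UNIV :: 'a set)"
    using V0(2) by simp
  from smooth_flow[OF op smooth_G this] obtain r \<epsilon> \<rho> \<Phi> where
    "r > 0 \<and> \<epsilon> > 0 \<and> \<rho> > 0 \<and> cball (a, 0 :: 'a) r \<subseteq> V0 \<times> UNIV \<and>
      smooth_on Basis (ball (a, 0 :: 'a) \<rho>) \<Phi> \<and>
     (\<forall>w\<in>ball (a, 0) \<rho>. \<exists>c. solution_in (cball (a, 0) r) (\<lambda>x. \<epsilon> *\<^sub>R G x) c \<and> c 0 = w) \<and>
     (\<forall>c. solution_in (cball (a, 0) r) (\<lambda>x. \<epsilon> *\<^sub>R G x) c \<longrightarrow> c 0 \<in> ball (a, 0) \<rho> \<longrightarrow>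
        \<Phi> (c 0) = c 1)"
    by (elim exE)
  then have flow: "r > 0" "\<epsilon> > 0" "\<rho> > 0" "cball (a, 0 :: 'a) r \<subseteq> V0 \<times> UNIV"
      "smooth_on Basis (ball (a, 0 :: 'a) \<rho>) \<Phi>"
    and flow_ex: "\<And>w. w \<in> ball (a, 0) \<rho> \<Longrightarrow>
      \<exists>c. solution_in (cball (a, 0) r) (\<lambda>x. \<epsilon> *\<^sub>R G x) c \<and> c 0 = w"
    and flow_unique: "\<And>c. solution_in (cball (a, 0) r) (\<lambda>x. \<epsilon> *\<^sub>R G x) c \<Longrightarrow>
      c 0 \<in> ball (a, 0) \<rho> \<Longrightarrow> \<Phi> (c 0) = c 1"
    by simp_all
  define \<phi> where "\<phi> w = fst (\<Phi> w)" for w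
  have smooth_\<phi>: "smooth_on Basis (ball (a, 0 :: 'a) \<rho>) \<phi>"
    unfolding \<phi>_def
    by (rule smooth_on_bounded_linear_compose[OF _ bounded_linear_fst flow(5)]) simp
  have path_ex: "\<exists>c. c 0 = z \<and> (\<forall>t\<in>{0..1}. (c t, u) \<in> cball (a, 0) r \<and>
      (c has_vector_derivative \<epsilon> *\<^sub>R Y u (c t)) (at t within {0..1}))"
    if zu: "(z, u) \<in> ball (a, 0) \<rho>" for z u
  proof -
    obtain c where c: "c 0 = (z, u)" "\<And>t. t \<in> {0..1} \<Longrightarrow> c t \<in> cball (a, 0) r"
      "\<And>t. t \<in> {0..1} \<Longrightarrow> (c has_vector_derivative \<epsilon> *\<^sub>R G (c t)) (at t within {0..1})"
      using flow_ex[OF zu] unfolding solution_in_def by blast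
    have fst': "((\<lambda>t. fst (c t)) has_vector_derivative fst (\<epsilon> *\<^sub>R G (c t))) (at t within {0..1})"
      and snd': "((\<lambda>t. snd (c t)) has_vector_derivative snd (\<epsilon> *\<^sub>R G (c t))) (at t within {0..1})"
      if "t \<in> {0..1}" for t
      by (rule bounded_linear.has_vector_derivative[OF bounded_linear_fst c(3)[OF that]]
          bounded_linear.has_vector_derivative[OF bounded_linear_snd c(3)[OF that]])+
    have snd_c: "snd (c t) = u" if "t \<in> {0..1}" for t
      using constant_on_unit_interval[OF _ that, of "\<lambda>t. snd (c t)"] snd' c(1)
      by (simp add: G_def)
    show ?thesis
    proof (intro exI[of _ "\<lambda>t. fst (c t)"] conjI ballI)
      fix t :: real assume t: "t \<in> {0..1}"
      show "(fst (c t), u) \<in> cball (a, 0) r"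
        using c(2)[OF t] snd_c[OF t] by (metis prod.collapse)
      show "((\<lambda>t. fst (c t)) has_vector_derivative \<epsilon> *\<^sub>R Y u (fst (c t))) (at t within {0..1})"
        using fst'[OF t] snd_c[OF t] by (simp add: G_def)
    qed (simp add: c(1))
  qed
  have path_unique: "\<phi> (c 0, u) = c 1"
    if c: "\<And>t. t \<in> {0..1} \<Longrightarrow> (c t, u) \<in> cball (a, 0) r"
      "\<And>t. t \<in> {0..1} \<Longrightarrow> (c has_vector_derivative \<epsilon> *\<^sub>R Y u (c t)) (at t within {0..1})"
      and start: "(c 0, u) \<in> ball (a, 0) \<rho>" for c u
  proof -
    have "((\<lambda>t. (c t, u)) has_vector_derivative \<epsilon> *\<^sub>R G (c t, u)) (at t within {0..1})"
      if "t \<in> {0..1}" for t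
      using has_vector_derivative_Pair[OF c(2)[OF that] has_vector_derivative_const, of u]
      by (simp add: G_def)
    then have "\<Phi> (c 0, u) = (c 1, u)"
      using flow_unique[of "\<lambda>t. (c t, u)"] c(1) start by (simp add: solution_in_def)
    then show ?thesis
      by (simp add: \<phi>_def)
  qed
  have in_V0: "x \<in> V0" if "(x, u) \<in> cball (a, 0) r" for x u :: 'a
    using flow(4) that by blast
  show thesis
  proof (rule that[of K "\<lambda>u. \<epsilon> *\<^sub>R \<xi> u" \<rho> \<phi>])
    show "linear (\<lambda>u. \<epsilon> *\<^sub>R \<xi> u)"
      by (rule linear_compose_scale_right[OF \<xi>(1)])
    show "inj_on (\<lambda>u. \<epsilon> *\<^sub>R \<xi> u) (span K)"
      using \<xi>(3) flow(2) by (auto simp: inj_on_def)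
    show "(\<lambda>u. \<epsilon> *\<^sub>R \<xi> u) ` span K = kernel_values Basis A F a"
    proof -
      have "(\<lambda>u. \<epsilon> *\<^sub>R \<xi> u) ` span K = (\<lambda>x. \<epsilon> *\<^sub>R x) ` kernel_values Basis A F a"
        using \<xi>(2) by (metis image_image)
      also have "\<dots> = kernel_values Basis A F a"
      proof
        show "(\<lambda>x. \<epsilon> *\<^sub>R x) ` kernel_values Basis A F a \<subseteq> kernel_values Basis A F a"
          using sub subspace_scale by blast
        show "kernel_values Basis A F a \<subseteq> (\<lambda>x. \<epsilon> *\<^sub>R x) ` kernel_values Basis A F a"
        proof
          fix x assume "x \<in> kernel_values Basis A F a"
          then have "inverse \<epsilon> *\<^sub>R x \<in> kernel_values Basis A F a"
            using sub subspace_scale by blast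
          then show "x \<in> (\<lambda>x. \<epsilon> *\<^sub>R x) ` kernel_values Basis A F a"
            using flow(2) by (auto intro!: rev_image_eqI)
        qed
      qed
      finally show ?thesis .
    qed
    show "smooth_on Basis (ball (a, 0 :: 'a) \<rho>) \<phi>"
      by (rule smooth_\<phi>)
  next
    fix z u :: 'a assume zu: "(z, u) \<in> ball (a, 0) \<rho>"
    obtain c where c: "c 0 = z" "\<And>t. t \<in> {0..1} \<Longrightarrow> (c t, u) \<in> cball (a, 0) r"
      "\<And>t. t \<in> {0..1} \<Longrightarrow> (c has_vector_derivative \<epsilon> *\<^sub>R Y u (c t)) (at t within {0..1})"
      using path_ex[OF zu] by blast
    have \<phi>: "\<phi> (z, u) = c 1"
      using path_unique[of c u] c zu by blast
    have "((\<lambda>t. F (c t)) has_vector_derivative 0) (at t within {0..1})" if t: "t \<in> {0..1}" for t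
    proof -
      have ct: "c t \<in> V0"
        using in_V0 c(2)[OF t] by blast
      then have "(F has_derivative deriv_along Basis F (c t)) (at (c t) within c ` {0..1})"
        using smooth_on_Basis_has_derivative[OF assms(2)] V0(3) has_derivative_at_withinI by blast
      from vector_derivative_diff_chain_within[OF c(3)[OF t] this]
      have "(F \<circ> c has_vector_derivative deriv_along Basis F (c t) (\<epsilon> *\<^sub>R Y u (c t)))
          (at t within {0..1})" .
      moreover have "linear (deriv_along Basis F (c t))"
        by (rule deriv_along_linear[OF smooth_on_differentiable[OF assms(2)]]) (use ct V0 in auto)
      then have "deriv_along Basis F (c t) (\<epsilon> *\<^sub>R Y u (c t)) = 0"
        using DFY[OF ct] by (simp add: linear_scale)
      ultimately show ?thesis
        by (simp add: o_def)
    qed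
    from constant_on_unit_interval[OF this, of 1] have "F (c 1) = F z"
      using c(1) by simp
    moreover have "c 1 \<in> V0" "z \<in> V0"
      using in_V0 c(2)[of 1] c(2)[of 0] c(1) by auto
    ultimately show "z \<in> A \<and> \<phi> (z, u) \<in> A \<and> F (\<phi> (z, u)) = F z"
      using \<phi> V0(3) by auto
    assume back_in: "(\<phi> (z, u), - u) \<in> ball (a, 0) \<rho>"
    \<comment> \<open>The time-reversed curve solves the equation of parameter \<open>- u\<close>.\<close>
    define c' where "c' t = c (1 - t)" for t
    have "\<phi> (c' 0, - u) = c' 1"
    proof (rule path_unique)
      fix t :: real assume t: "t \<in> {0..1}"
      then have t': "1 - t \<in> {0..1}" by auto
      show "(c' t, - u) \<in> cball (a, 0) r"
        using c(2)[OF t'] by (simp add: c'_def dist_Pair_Pair)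
      have "((\<lambda>t. 1 - t) has_vector_derivative - 1) (at t within {0..1})"
        by (auto intro!: derivative_eq_intros)
      moreover have "(c has_vector_derivative \<epsilon> *\<^sub>R Y u (c (1 - t)))
          (at (1 - t) within (\<lambda>t. 1 - t) ` {0..1})"
        by (rule has_vector_derivative_within_subset[OF c(3)[OF t']]) auto
      ultimately have "(c \<circ> (\<lambda>t. 1 - t) has_vector_derivative - 1 *\<^sub>R (\<epsilon> *\<^sub>R Y u (c (1 - t))))
          (at t within {0..1})"
        by (rule vector_diff_chain_within)
      moreover have "- 1 *\<^sub>R (\<epsilon> *\<^sub>R Y u (c (1 - t))) = \<epsilon> *\<^sub>R Y (- u) (c' t)"
        by (simp add: Y_def c'_def sum_negf)
      ultimately show "(c' has_vector_derivative \<epsilon> *\<^sub>R Y (- u) (c' t)) (at t within {0..1})"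
        by (simp add: c'_def[abs_def] o_def)
    qed (use back_in \<phi> in \<open>simp add: c'_def\<close>)
    then show "\<phi> (\<phi> (z, u), - u) = z"
      using \<phi> c(1) by (simp add: c'_def)
  next
    have Y0: "Y 0 z = 0" for z
      by (simp add: Y_def)
    show "\<phi> (a, 0) = a"
      using path_unique[of "\<lambda>_. a" 0] flow(1,3) by (simp add: Y0 has_vector_derivative_const)
    have "((\<lambda>w. \<phi> w) has_derivative deriv_along Basis \<phi> (a, 0)) (at (a, 0))"
      by (rule smooth_on_Basis_has_derivative[of "ball (a, 0) \<rho>"])
        (use flow(3) smooth_\<phi> in auto)
    note D\<phi> = this
    have lin: "linear (deriv_along Basis \<phi> (a, 0))"
      by (rule has_derivative_linear[OF D\<phi>])
    have small: "deriv_along Basis \<phi> (a, 0) (0, u) = \<epsilon> *\<^sub>R \<xi> u"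
      if u: "u \<in> span K" and nu: "norm u < \<rho>" for u
    proof -
      have "(a, u) \<in> ball (a, 0) \<rho>"
        using nu by (simp add: dist_Pair_Pair)
      from path_ex[OF this] obtain c where
        c: "c 0 = a" "\<And>t. t \<in> {0..1} \<Longrightarrow> (c t, u) \<in> cball (a, 0) r"
        "\<And>t. t \<in> {0..1} \<Longrightarrow> (c has_vector_derivative \<epsilon> *\<^sub>R Y u (c t)) (at t within {0..1})"
        by blast
      \<comment> \<open>Following the field of parameter \<open>s u\<close> for unit time is following the field of
        parameter \<open>u\<close> for time \<open>s\<close>.\<close>
      have rescale: "\<phi> (a, s *\<^sub>R u) = c s" if s: "s \<in> {0..1}" for s
      proof -
        have "\<phi> (c (s * 0), s *\<^sub>R u) = c (s * 1)"
        proof (rule path_unique)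
          fix t :: real assume t: "t \<in> {0..1}"
          then have st: "s * t \<in> {0..1}"
            using s by (auto intro: mult_le_one)
          have "(dist a (c (s * t)))\<^sup>2 + (norm (s *\<^sub>R u))\<^sup>2 \<le> (dist a (c (s * t)))\<^sup>2 + (norm u)\<^sup>2"
            using s by (auto intro!: power_mono mult_left_le_one_le)
          then have "dist (a, 0) (c (s * t), s *\<^sub>R u) \<le> dist (a, 0) (c (s * t), u)"
            by (simp add: dist_Pair_Pair)
          also have "\<dots> \<le> r"
            using c(2)[OF st] by simp
          finally show "(c (s * t), s *\<^sub>R u) \<in> cball (a, 0) r"
            by simp
          have "((\<lambda>t. s * t) has_vector_derivative s) (at t within {0..1})"
            by (auto intro!: derivative_eq_intros)
          moreover have "(c has_vector_derivative \<epsilon> *\<^sub>R Y u (c (s * t)))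
              (at (s * t) within (\<lambda>t. s * t) ` {0..1})"
            by (rule has_vector_derivative_within_subset[OF c(3)[OF st]])
              (use s in \<open>auto intro: mult_le_one\<close>)
          ultimately have "(c \<circ> (\<lambda>t. s * t) has_vector_derivative s *\<^sub>R (\<epsilon> *\<^sub>R Y u (c (s * t))))
              (at t within {0..1})"
            by (rule vector_diff_chain_within)
          moreover have "s *\<^sub>R (\<epsilon> *\<^sub>R Y u (c (s * t))) = \<epsilon> *\<^sub>R Y (s *\<^sub>R u) (c (s * t))"
            by (simp add: Y_def scaleR_sum_right mult_ac)
          ultimately show "((\<lambda>t. c (s * t)) has_vector_derivative \<epsilon> *\<^sub>R Y (s *\<^sub>R u) (c (s * t)))
              (at t within {0..1})"
            by (simp add: o_def)
        next
          have "norm (s *\<^sub>R u) < \<rho>"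
            using s nu mult_left_le_one_le[of "norm u" s] by simp
          then show "(c (s * 0), s *\<^sub>R u) \<in> ball (a, 0) \<rho>"
            by (simp add: c(1) dist_Pair_Pair)
        qed
        then show ?thesis
          by (simp add: c(1))
      qed
      have "((\<lambda>s. \<phi> ((a, 0) + s *\<^sub>R (0, u))) has_vector_derivative deriv_along Basis \<phi> (a, 0) (0, u))
          (at 0)"
        by (rule has_vector_derivative_along[where B = Basis]) (use D\<phi> in auto)
      then have 1: "((\<lambda>s. \<phi> (a, s *\<^sub>R u)) has_vector_derivative deriv_along Basis \<phi> (a, 0) (0, u))
          (at 0 within {0..1})"
        by (simp add: has_vector_derivative_at_within)
      have "(c has_vector_derivative \<epsilon> *\<^sub>R \<xi> u) (at 0 within {0..1})"
        using c(3)[of 0] c(1) Ya[OF u] by simp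
      then have 2: "((\<lambda>s. \<phi> (a, s *\<^sub>R u)) has_vector_derivative \<epsilon> *\<^sub>R \<xi> u) (at 0 within {0..1})"
        by (rule has_vector_derivative_transform[rotated 2]) (auto simp: rescale)
      have "at (0::real) within {0..1} \<noteq> bot"
        using at_within_Icc_at_right[of "0::real" 1] trivial_limit_at_right_real by auto
      from vector_derivative_unique_within[OF this 1 2] show ?thesis .
    qed
    fix u :: 'a assume u: "u \<in> span K"
    define \<delta> where "\<delta> = \<rho> / (norm u + 1)"
    have pos: "norm u + 1 > 0"
      by (simp add: add_nonneg_pos)
    have \<delta>: "\<delta> > 0"
      unfolding \<delta>_def by (rule divide_pos_pos[OF flow(3) pos])
    have "norm (\<delta> *\<^sub>R u) = \<rho> * norm u / (norm u + 1)"
      using flow(3) pos by (simp add: \<delta>_def)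
    also have "\<dots> < \<rho>"
      unfolding pos_divide_less_eq[OF pos] using flow(3) by simp
    finally have \<delta>u: "norm (\<delta> *\<^sub>R u) < \<rho>" .
    have "\<delta> *\<^sub>R deriv_along Basis \<phi> (a, 0) (0, u) = deriv_along Basis \<phi> (a, 0) (0, \<delta> *\<^sub>R u)"
      using linear_scale[OF lin, of \<delta> "(0, u)"] by simp
    also have "\<dots> = \<delta> *\<^sub>R (\<epsilon> *\<^sub>R \<xi> u)"
      using small[of "\<delta> *\<^sub>R u"] span_scale[OF u] \<delta>u linear_scale[OF \<xi>(1), of \<delta> u] by (simp add: mult.commute)
    finally show "deriv_along Basis \<phi> (a, 0) (0, u) = \<epsilon> *\<^sub>R \<xi> u"
      using \<delta> by (simp del: scaleR_scaleR)
  qed (use K flow in auto)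
qed


section \<open>Leaves in a Euclidean space\<close>

text \<open>
  Differentiating \<open>F (\<phi> (z, u)) = F z\<close>.  A direction in the parameter gives a vector killed by the
  differential of \<^term>\<open>F\<close>; a direction in \<open>z\<close> shows that the maps of the family preserve the
  annihilated fields.
\<close>

lemma family_preserves_kernel:
  fixes A :: "'a::euclidean_space set" and F :: "'a \<Rightarrow> 'b::real_normed_vector"
  assumes "smooth_on Basis A F" "open W" "smooth_on Basis W \<phi>"
    and "\<And>w. w \<in> W \<Longrightarrow> fst w \<in> A \<and> \<phi> w \<in> A \<and> F (\<phi> w) = F (fst w)" "w \<in> W"
  shows "deriv_along Basis F (\<phi> w) (deriv_along Basis \<phi> w h) = deriv_along Basis F (fst w) (fst h)"
proof -
  have op: "openin (coord_top Basis) W"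
    using assms(2) by simp
  have dF: "F differentiable (at x within span Basis)" if "x \<in> A" for x
    by (rule smooth_on_differentiable[OF assms(1) that])
  have "deriv_along Basis F (\<phi> w) (deriv_along Basis \<phi> w h) = deriv_along Basis (\<lambda>w. F (\<phi> w)) w h"
    by (rule deriv_along_chain[OF op, symmetric])
      (use assms(4,5) dF smooth_on_differentiable[OF assms(3,5)] in auto)
  also have "\<dots> = deriv_along Basis (\<lambda>w. F (fst w)) w h"
    by (rule deriv_along_cong[OF op assms(5)]) (use assms(4) in auto)
  also have "\<dots> = deriv_along Basis F (fst w) (deriv_along Basis fst w h)"
    by (rule deriv_along_chain[OF op])
      (use assms(4,5) dF in
        \<open>auto intro: bounded_linear_imp_differentiable bounded_linear_fst\<close>)
  also have "deriv_along Basis fst w h = fst h"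
    by (rule deriv_along_Basis_eq) (auto intro: bounded_linear_imp_has_derivative bounded_linear_fst)
  finally show ?thesis .
qed

text \<open>
  The leaf through \<^term>\<open>a\<close> is the orbit \<open>u \<mapsto> \<phi> (a, u)\<close> of a level-preserving family.  Its tangent
  vectors are values of annihilated fields, namely of the parameter derivatives of the family pulled
  back by the inverse \<open>\<phi> (_, - u)\<close>.  Conversely that inverse carries annihilated fields near
  \<open>\<phi> (a, u)\<close> to annihilated fields near \<^term>\<open>a\<close>, so the space of values cannot be larger at
  \<open>\<phi> (a, u)\<close> than at \<^term>\<open>a\<close>; equality follows by counting dimensions.
\<close>

lemma local_leaf:
  fixes A :: "'a::euclidean_space set" and F :: "'a \<Rightarrow> 'b::real_normed_vector"
  assumes "open A" "smooth_on Basis A F" "a \<in> A"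
  shows "\<exists>K s \<Psi>. K \<subseteq> (Basis :: 'a set) \<and> s > 0 \<and> smooth_on Basis (ball 0 s) \<Psi> \<and> \<Psi> 0 = a \<and>
    inj_on \<Psi> (ball 0 s \<inter> span K) \<and>
    (\<forall>u \<in> ball 0 s \<inter> span K. \<Psi> u \<in> A \<and> F (\<Psi> u) = F a \<and>
       inj_on (deriv_along Basis \<Psi> u) (span K) \<and>
       deriv_along Basis \<Psi> u ` span K = kernel_values Basis A F (\<Psi> u))"
proof -
  obtain K :: "'a set" and \<xi> \<rho> \<phi> where K: "K \<subseteq> Basis"
    and \<xi>: "linear \<xi>" "inj_on \<xi> (span K)" "\<xi> ` span K = kernel_values Basis A F a"
    and \<rho>: "\<rho> > 0" and smooth_\<phi>: "smooth_on Basis (ball (a, 0) \<rho>) \<phi>"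
    and level: "\<And>z u. (z, u) \<in> ball (a, 0) \<rho> \<Longrightarrow> z \<in> A \<and> \<phi> (z, u) \<in> A \<and> F (\<phi> (z, u)) = F z"
    and inverse: "\<And>z u. (z, u) \<in> ball (a, 0) \<rho> \<Longrightarrow> (\<phi> (z, u), - u) \<in> ball (a, 0) \<rho> \<Longrightarrow>
       \<phi> (\<phi> (z, u), - u) = z"
    and \<phi>0: "\<phi> (a, 0) = a"
    and D\<phi>0: "\<And>u. u \<in> span K \<Longrightarrow> deriv_along Basis \<phi> (a, 0) (0, u) = \<xi> u"
    using level_preserving_family[OF assms] by blast
  define W where "W = ball (a, 0 :: 'a) \<rho>"
  have W: "open W" "openin (coord_top Basis) W"
    by (simp_all add: W_def)
  have W_iff: "(a, u) \<in> W \<longleftrightarrow> norm u < \<rho>" for u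
    by (simp add: W_def dist_Pair_Pair)
  note smooth_\<phi> = smooth_\<phi>[folded W_def]
  note level = level[folded W_def]
  note inverse = inverse[folded W_def]
  have level': "fst w \<in> A \<and> \<phi> w \<in> A \<and> F (\<phi> w) = F (fst w)" if "w \<in> W" for w
    using level[of "fst w" "snd w"] that by simp
  have kernel: "deriv_along Basis F (\<phi> w) (deriv_along Basis \<phi> w h) =
      deriv_along Basis F (fst w) (fst h)" if "w \<in> W" for w h
    using family_preserves_kernel[OF assms(2) W(1) smooth_\<phi> level' that] .
  have D\<phi>: "(\<phi> has_derivative deriv_along Basis \<phi> w) (at w)" if "w \<in> W" for w
    by (rule smooth_on_Basis_has_derivative[OF smooth_\<phi> that])
  obtain \<kappa> where \<kappa>: "linear \<kappa>" "\<And>u. u \<in> span K \<Longrightarrow> \<kappa> (\<xi> u) = u"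
    using linear_exists_left_inverse_on[OF \<xi>(1) subspace_span \<xi>(2)] by blast
  interpret \<kappa>: bounded_linear \<kappa>
    using \<kappa>(1) by (simp add: linear_conv_bounded_linear)
  let ?P = "coord_proj K"
  interpret P: bounded_linear ?P
    by (rule bounded_linear_coord_proj)
  define \<Psi> where "\<Psi> u = \<phi> (a, ?P u)" for u
  have aP: "(a, ?P u) \<in> W" if "norm u < \<rho>" for u
    using that norm_coord_proj_le[OF K, of u] by (simp add: W_iff)
  have smooth_aP: "smooth_on Basis (ball 0 \<rho>) (\<lambda>u. (a, ?P u))"
    by (intro smooth_on_Pair smooth_on_const smooth_on_bounded_linear bounded_linear_coord_proj) auto
  have smooth_\<Psi>: "smooth_on Basis (ball 0 \<rho>) \<Psi>"
    unfolding \<Psi>_def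
    by (rule smooth_on_compose[OF _ W(2) subset_refl _ smooth_aP smooth_\<phi>]) (auto simp: aP)
  have D\<Psi>: "deriv_along Basis \<Psi> u v = deriv_along Basis \<phi> (a, ?P u) (0, ?P v)" if "norm u < \<rho>" for u v
  proof -
    have "((\<lambda>u. (a, ?P u)) has_derivative (\<lambda>v. (0, ?P v))) (at u)"
      by (intro has_derivative_Pair has_derivative_const
          bounded_linear_imp_has_derivative bounded_linear_coord_proj)
    from diff_chain_at[OF this D\<phi>[OF aP[OF that]]]
    have "(\<Psi> has_derivative (\<lambda>v. deriv_along Basis \<phi> (a, ?P u) (0, ?P v))) (at u)"
      by (simp add: \<Psi>_def[abs_def] o_def)
    then show ?thesis
      by (rule deriv_along_Basis_eq)
  qed
  have has_D\<Psi>: "(\<Psi> has_derivative deriv_along Basis \<Psi> u) (at u)" if "norm u < \<rho>" for u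
    by (rule smooth_on_Basis_has_derivative[OF smooth_\<Psi>]) (use that in auto)

  \<comment> \<open>Near 0, a left inverse of \<open>\<xi>\<close> turns \<open>\<Psi>\<close> into a small perturbation of the projection; this
    gives injectivity of \<open>\<Psi>\<close> and of its derivatives at once.\<close>
  define e where "e = 1 / (2 * real DIM('a))"
  have e: "e > 0" by (simp add: e_def)
  have "\<exists>d>0. \<forall>u. norm u < d \<longrightarrow> norm (\<kappa> (deriv_along Basis \<Psi> u b) - ?P b) \<le> e"
    if b: "b \<in> Basis" for b
  proof -
    have "continuous_on (ball 0 \<rho>) (\<lambda>u. \<kappa> (deriv_along Basis \<Psi> u b) - ?P b)"
      by (intro continuous_on_diff \<kappa>.continuous_on continuous_on_const
          smooth_on_continuous[OF smooth_on_deriv[OF smooth_\<Psi> b]])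
    then have "isCont (\<lambda>u. \<kappa> (deriv_along Basis \<Psi> u b) - ?P b) 0"
      using \<rho> by (simp add: continuous_on_eq_continuous_at)
    moreover have "\<kappa> (deriv_along Basis \<Psi> 0 b) - ?P b = 0"
      using D\<Psi>[of 0 b] \<rho> D\<phi>0[OF coord_proj_in_span] \<kappa>(2)[OF coord_proj_in_span] by (simp add: P.zero)
    ultimately have "\<exists>d>0. \<forall>u. dist u 0 < d \<longrightarrow> dist (\<kappa> (deriv_along Basis \<Psi> u b) - ?P b) 0 < e"
      unfolding continuous_at_eps_delta using e by metis
    then show ?thesis
      by (auto intro: less_imp_le)
  qed
  then obtain d where d: "\<And>b. b \<in> Basis \<Longrightarrow> d b > 0"
    "\<And>b u. b \<in> Basis \<Longrightarrow> norm u < d b \<Longrightarrow> norm (\<kappa> (deriv_along Basis \<Psi> u b) - ?P b) \<le> e"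
    by metis
  define d0 where "d0 = Min (d ` (Basis :: 'a set))"
  have d0: "d0 > 0" "\<And>b. b \<in> Basis \<Longrightarrow> d0 \<le> d b"
    using d(1) by (auto simp: d0_def)
  have near_id: "norm (\<kappa> (deriv_along Basis \<Psi> u v) - ?P v) \<le> 1/2 * norm v"
    if u: "norm u < \<rho>" "norm u < d0" for u v
  proof -
    have lin: "linear (\<lambda>v. \<kappa> (deriv_along Basis \<Psi> u v) - ?P v)"
      using has_derivative_linear[OF has_D\<Psi>[OF u(1)]] \<kappa>(1) P.linear
      by (intro linear_compose_sub) (auto intro: linear_compose[unfolded o_def])
    have "norm (\<kappa> (deriv_along Basis \<Psi> u v) - ?P v) \<le> (\<Sum>b\<in>(Basis::'a set). norm v * e)"
      unfolding linear_coord_expansion[OF subset_refl lin, of v, simplified]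
    proof (rule sum_norm_le)
      fix b :: 'a assume b: "b \<in> Basis"
      show "norm ((v \<bullet> b) *\<^sub>R (\<kappa> (deriv_along Basis \<Psi> u b) - ?P b)) \<le> norm v * e"
        using Basis_le_norm[OF b, of v] d(2)[OF b, of u] d0(2)[OF b] u(2) by (simp add: mult_mono)
    qed
    then show ?thesis
      by (simp add: e_def)
  qed

  have "continuous_on (ball 0 \<rho>) (\<lambda>u. (\<Psi> u, - ?P u))"
    by (intro continuous_on_Pair smooth_on_continuous[OF smooth_\<Psi>] continuous_on_minus
        P.continuous_on continuous_on_id)
  then have "isCont (\<lambda>u. (\<Psi> u, - ?P u)) 0"
    using \<rho> by (simp add: continuous_on_eq_continuous_at)
  moreover have "(\<Psi> 0, - ?P 0) \<in> W"
    using \<rho> by (simp add: \<Psi>_def P.zero \<phi>0 W_iff)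
  ultimately have "\<exists>d>0. \<forall>u. dist u 0 < d \<longrightarrow> (\<Psi> u, - ?P u) \<in> W"
    using W(1) unfolding continuous_at_open
    by (metis (no_types, lifting) dist_commute mem_ball open_contains_ball subsetD)
  then obtain d1 where d1: "d1 > 0" "\<And>u. norm u < d1 \<Longrightarrow> (\<Psi> u, - ?P u) \<in> W"
    by auto

  define s where "s = min \<rho> (min d0 d1)"
  have s: "s > 0" "\<And>u. norm u < s \<Longrightarrow> norm u < \<rho> \<and> norm u < d0 \<and> norm u < d1"
    using \<rho> d0(1) d1(1) by (auto simp: s_def)

  have inj_D: "inj_on (deriv_along Basis \<Psi> u) (span K)" if u: "norm u < s" for u
  proof -
    have lin: "linear (deriv_along Basis \<Psi> u)"
      using has_derivative_linear[OF has_D\<Psi>] s(2)[OF u] by blast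
    have "v = 0" if "v \<in> span K" "deriv_along Basis \<Psi> u v = 0" for v
      using near_id[of u v] s(2)[OF u] that coord_proj_span[OF K that(1)] by (simp add: \<kappa>.zero)
    then show ?thesis
      using linear_inj_on_iff_eq_0[OF lin subspace_span] by blast
  qed
  have inj_\<Psi>: "inj_on \<Psi> (ball 0 s \<inter> span K)"
  proof (rule inj_onI)
    fix u u' assume u: "u \<in> ball 0 s \<inter> span K" "u' \<in> ball 0 s \<inter> span K" and eq: "\<Psi> u = \<Psi> u'"
    have "norm ((\<kappa> (\<Psi> u) - ?P u) - (\<kappa> (\<Psi> u') - ?P u')) \<le> 1/2 * norm (u - u')"
    proof (rule differentiable_bound[where S = "ball 0 s"
          and f' = "\<lambda>x v. \<kappa> (deriv_along Basis \<Psi> x v) - ?P v"])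
      fix x :: 'a assume "x \<in> ball 0 s"
      then have x: "norm x < \<rho>" "norm x < d0"
        using s(2) by auto
      show "((\<lambda>x. \<kappa> (\<Psi> x) - ?P x) has_derivative (\<lambda>v. \<kappa> (deriv_along Basis \<Psi> x v) - ?P v))
          (at x within ball 0 s)"
        by (rule has_derivative_at_withinI,
            rule has_derivative_diff[OF \<kappa>.has_derivative[OF has_D\<Psi>[OF x(1)]]
              bounded_linear_imp_has_derivative[OF bounded_linear_coord_proj]])
      show "onorm (\<lambda>v. \<kappa> (deriv_along Basis \<Psi> x v) - ?P v) \<le> 1/2"
        by (rule onorm_bound[OF _ near_id[OF x]]) simp
    qed (use u in auto)
    then have "norm (u - u') \<le> 1/2 * norm (u - u')"
      using eq u coord_proj_span[OF K] by (simp add: norm_minus_commute)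
    then show "u = u'"
      by simp
  qed

  have image_D: "deriv_along Basis \<Psi> u ` span K = kernel_values Basis A F (\<Psi> u)"
    if u: "norm u < s" "u \<in> span K" for u
  proof -
    define y0 where "y0 = \<Psi> u"
    have Pu: "?P u = u"
      by (rule coord_proj_span[OF K u(2)])
    have au: "(a, u) \<in> W"
      using aP[of u] s(2)[OF u(1)] Pu by simp
    have y0: "y0 = \<phi> (a, u)" "(y0, - u) \<in> W" "y0 \<in> A"
      using d1(2)[of u] s(2)[OF u(1)] level[OF au] by (simp_all add: y0_def \<Psi>_def Pu)
    have return_a: "\<phi> (y0, - u) = a"
      using inverse[OF au] y0 by simp
    have lin_F: "linear (deriv_along Basis F z)" if "z \<in> A" for z
      by (rule deriv_along_linear[OF smooth_on_differentiable[OF assms(2) that]])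
    define W1 where "W1 c = {z. (z, c) \<in> W}" for c
    define W2 where "W2 c d = W1 c \<inter> (\<lambda>z. (\<phi> (z, c), d)) -` W" for c d
    have "W1 c = UNIV \<inter> (\<lambda>z. (z, c)) -` W" for c
      by (auto simp: W1_def)
    then have open_W1: "open (W1 c)" for c
      using continuous_open_preimage[of UNIV "\<lambda>z. (z, c)" W] W(1)
      by (simp add: continuous_on_Pair)
    have smooth_shift: "smooth_on Basis (W1 c) (\<lambda>z. \<phi> (z, c))" for c
      by (rule smooth_on_compose[OF _ W(2) subset_refl _ _ smooth_\<phi>])
        (auto intro!: smooth_on_Pair smooth_on_id smooth_on_const open_W1, auto simp: W1_def)
    have open_W2: "open (W2 c d)" for c d
      unfolding W2_def
      by (intro continuous_open_preimage continuous_on_Pair continuous_on_const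
          smooth_on_continuous[OF smooth_shift] open_W1 W(1))
    have smooth_W2: "smooth_on Basis (W2 c d) (\<lambda>z. (\<phi> (z, c), d))" for c d
      by (intro smooth_on_Pair smooth_on_const smooth_on_subset[OF smooth_shift])
        (auto simp: open_W2, auto simp: W2_def)
    have W2: "(\<phi> (z, c), d) \<in> W" "(z, c) \<in> W" if "z \<in> W2 c d" for z c d
      using that by (auto simp: W2_def W1_def)
    have y0_W2: "y0 \<in> W2 (- u) u"
      using y0 au return_a by (simp add: W2_def W1_def)
    have a_W2: "a \<in> W2 u (- u)"
      using y0 au by (simp add: W2_def W1_def)
    have undo: "\<phi> (\<phi> (y, - u), u) = y" if "y \<in> W2 (- u) u" for y
      using inverse[of y "- u"] W2[OF that] by simp
    have sub_y0: "subspace (kernel_values Basis A F y0)"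
      using subspace_kernel_values[of Basis A F y0] assms y0(3) by simp

    have tangent: "deriv_along Basis \<Psi> u v \<in> kernel_values Basis A F y0" if v: "v \<in> span K" for v
    proof -
      let ?Z = "\<lambda>y. deriv_along Basis \<phi> (\<phi> (y, - u), u) (0, v)"
      have "?Z y0 \<in> kernel_values Basis A F y0"
      proof (rule kernel_valuesI[where V = "W2 (- u) u" and Y = ?Z])
        show "smooth_on Basis (W2 (- u) u) ?Z"
          by (rule smooth_on_deriv_field[OF _ W(2) subset_refl _ smooth_W2 smooth_\<phi>])
            (use open_W2 smooth_on_const[of Basis "W2 (- u) u"] in \<open>auto intro: W2\<close>)
        show "W2 (- u) u \<subseteq> A"
          using undo level[OF W2(1)] by force
        fix y assume y: "y \<in> W2 (- u) u"
        have "deriv_along Basis F y (?Z y) = deriv_along Basis F (\<phi> (y, - u)) 0"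
          using kernel[OF W2(1)[OF y], of "(0, v)"] undo[OF y] by simp
        also have "\<dots> = 0"
          using lin_F level[OF W2(1)[OF y]] by (intro linear_0) auto
        finally show "deriv_along Basis F y (?Z y) = 0" .
      qed (use y0_W2 open_W2 in auto)
      moreover have "?Z y0 = deriv_along Basis \<Psi> u v"
        using D\<Psi>[of u v] s(2)[OF u(1)] Pu coord_proj_span[OF K v] return_a by simp
      ultimately show ?thesis
        by simp
    qed

    \<comment> \<open>The derivative at \<open>y0\<close> of the inverse \<open>\<phi> (_, - u)\<close>.\<close>
    define T where "T \<eta> = deriv_along Basis \<phi> (y0, - u) (\<eta>, 0)" for \<eta>
    have lin_T: "linear T"
    proof -
      have "linear (deriv_along Basis \<phi> (y0, - u))"
        by (rule has_derivative_linear[OF D\<phi>[OF y0(2)]])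
      moreover have "linear (\<lambda>\<eta>::'a. (\<eta>, 0 :: 'a))"
        by (intro bounded_linear.linear bounded_linear_Pair bounded_linear_ident bounded_linear_zero)
      ultimately show ?thesis
        unfolding T_def[abs_def] using linear_compose by (fastforce simp: o_def)
    qed
    have T_kernel: "T \<eta> \<in> kernel_values Basis A F a" if \<eta>: "\<eta> \<in> kernel_values Basis A F y0" for \<eta>
    proof -
      obtain X V where X: "open V" "y0 \<in> V" "smooth_on Basis V X"
        "\<And>z. z \<in> V \<Longrightarrow> deriv_along Basis F z (X z) = 0" "\<eta> = X y0"
        by (rule kernel_valuesE[OF \<eta>]) auto
      define V' where "V' = W2 u (- u) \<inter> (\<lambda>z. \<phi> (z, u)) -` V"
      have V': "open V'"
        unfolding V'_def
        by (intro continuous_open_preimage open_W2 X(1)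
            continuous_on_subset[OF smooth_on_continuous[OF smooth_shift[of u]]])
          (auto simp: W2_def)
      let ?X = "\<lambda>z. deriv_along Basis \<phi> (\<phi> (z, u), - u) (X (\<phi> (z, u)), 0)"
      have "?X a \<in> kernel_values Basis A F a"
      proof (rule kernel_valuesI[where V = V' and Y = ?X])
        have "smooth_on Basis V' (\<lambda>z. \<phi> (z, u))"
          by (rule smooth_on_subset[OF smooth_shift]) (auto simp: V'_def W2_def)
        then have "smooth_on Basis V' (\<lambda>z. X (\<phi> (z, u)))"
          by (rule smooth_on_compose[OF _ _ subset_refl _ _ X(3), rotated 3])
            (use X(1) V' in \<open>auto simp: V'_def\<close>)
        then show "smooth_on Basis V' ?X"
          by (intro smooth_on_deriv_field[OF _ W(2) subset_refl, where f = \<phi>] smooth_\<phi>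
              smooth_on_Pair smooth_on_const smooth_on_subset[OF smooth_W2[of u "- u"]])
            (use V' W2 in \<open>auto simp: V'_def\<close>)
        show "V' \<subseteq> A"
          using level[OF W2(2)] by (force simp: V'_def)
        fix z assume z: "z \<in> V'"
        then have z': "z \<in> W2 u (- u)" "\<phi> (z, u) \<in> V"
          by (auto simp: V'_def)
        have "deriv_along Basis F (\<phi> (\<phi> (z, u), - u)) (?X z) =
            deriv_along Basis F (\<phi> (z, u)) (X (\<phi> (z, u)))"
          using kernel[OF W2(1)[OF z'(1)], of "(X (\<phi> (z, u)), 0)"] by simp
        then show "deriv_along Basis F z (?X z) = 0"
          using inverse[OF W2(2)[OF z'(1)] W2(1)[OF z'(1)]] X(4)[OF z'(2)] by simp
      qed (use V' a_W2 y0 X in \<open>auto simp: V'_def\<close>)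
      then show ?thesis
        by (simp add: T_def X(5) y0(1))
    qed
    have inj_T: "inj T"
    proof -
      have "\<eta> = 0" if \<eta>: "T \<eta> = 0" for \<eta>
      proof -
        have 1: "((\<lambda>y. \<phi> (y, - u)) has_derivative T) (at y0)"
        proof -
          have "((\<lambda>y. (y, - u)) has_derivative (\<lambda>\<eta>. (\<eta>, 0))) (at y0)"
            by (intro has_derivative_Pair has_derivative_ident has_derivative_const)
          from diff_chain_at[OF this D\<phi>[OF y0(2)]] show ?thesis
            by (simp add: o_def T_def[abs_def])
        qed
        have "((\<lambda>y. (\<phi> (y, - u), u)) has_derivative (\<lambda>\<eta>. (T \<eta>, 0))) (at y0)"
          by (intro has_derivative_Pair 1 has_derivative_const)
        moreover have "(\<phi> has_derivative deriv_along Basis \<phi> (a, u)) (at (\<phi> (y0, - u), u))"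
          using D\<phi>[OF au] return_a by simp
        ultimately have "((\<lambda>y. \<phi> (\<phi> (y, - u), u)) has_derivative
            (\<lambda>\<eta>. deriv_along Basis \<phi> (a, u) (T \<eta>, 0))) (at y0)"
          using diff_chain_at[of "\<lambda>y. (\<phi> (y, - u), u)"] by (fastforce simp: o_def)
        moreover have "((\<lambda>y. \<phi> (\<phi> (y, - u), u)) has_derivative (\<lambda>\<eta>. \<eta>)) (at y0)"
          by (rule has_derivative_transform_within_open[OF has_derivative_ident open_W2 y0_W2])
            (simp add: undo)
        ultimately have "(\<lambda>\<eta>. deriv_along Basis \<phi> (a, u) (T \<eta>, 0)) = (\<lambda>\<eta>. \<eta>)"
          by (rule has_derivative_unique)
        then have "\<eta> = deriv_along Basis \<phi> (a, u) (T \<eta>, 0)"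
          by metis
        then show "\<eta> = 0"
          using linear_0[OF has_derivative_linear[OF D\<phi>[OF au]]] \<eta> by (simp add: zero_prod_def)
      qed
      then show ?thesis
        using linear_injective_0[OF lin_T] by blast
    qed
    have dim_K: "dim (deriv_along Basis \<Psi> u ` span K) = dim (span K)"
      using has_derivative_linear[OF has_D\<Psi>] s(2)[OF u(1)] inj_D[OF u(1)]
      by (intro dim_image_eq) (auto simp: span_span)
    have "dim (kernel_values Basis A F y0) = dim (T ` kernel_values Basis A F y0)"
      by (rule dim_image_eq[symmetric, OF lin_T]) (use inj_T in \<open>auto intro: inj_on_subset\<close>)
    also have "\<dots> \<le> dim (kernel_values Basis A F a)"
      by (rule dim_subset) (use T_kernel in auto)
    also have "\<dots> = dim (span K)"
      unfolding \<xi>(3)[symmetric] by (rule dim_image_eq[OF \<xi>(1)]) (simp add: \<xi>(2) span_span)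
    finally have "dim (kernel_values Basis A F y0) \<le> dim (deriv_along Basis \<Psi> u ` span K)"
      by (simp add: dim_K)
    moreover have "subspace (deriv_along Basis \<Psi> u ` span K)"
      using has_derivative_linear[OF has_D\<Psi>] s(2)[OF u(1)]
      by (intro linear_subspace_image subspace_span) auto
    ultimately have "deriv_along Basis \<Psi> u ` span K = kernel_values Basis A F y0"
      using tangent sub_y0 by (intro subspace_dim_equal) auto
    then show ?thesis
      by (simp add: y0_def)
  qed
  have \<Psi>0: "\<Psi> 0 = a"
    by (simp add: \<Psi>_def P.zero \<phi>0)
  have \<Psi>_level: "\<Psi> u \<in> A \<and> F (\<Psi> u) = F a" if "norm u < s" for u
    using level[OF aP] s(2)[OF that] by (simp add: \<Psi>_def)
  have "smooth_on Basis (ball 0 s) \<Psi>"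
    by (rule smooth_on_subset[OF smooth_\<Psi>]) (simp add: s_def subset_ball)
  with K s(1) \<Psi>0 inj_\<Psi> inj_D image_D \<Psi>_level show ?thesis
    by (intro exI[of _ K] exI[of _ s] exI[of _ \<Psi>]) auto
qed


section \<open>Leaves in a coordinate subspace\<close>

lemma
  assumes "open S" "smooth_on Basis S f"
  shows smooth_on_restrict_span: "smooth_on K (S \<inter> span K) f"
    and deriv_along_restrict_span:
      "u \<in> S \<inter> span K \<Longrightarrow> v \<in> span K \<Longrightarrow> deriv_along K f u v = deriv_along Basis f u v"
proof -
  have op: "openin (coord_top K) (S \<inter> span K)"
    using openin_open_Int[OF assms(1), of "span K"] by (simp add: Int_commute)
  have "smooth_on K (S \<inter> span K) (\<lambda>x. f x)"
    by (rule smooth_on_compose[OF op _ subset_refl _ smooth_on_id[OF op] assms(2)])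
      (use assms(1) in auto)
  then show "smooth_on K (S \<inter> span K) f" .
  assume "u \<in> S \<inter> span K" "v \<in> span K"
  then show "deriv_along K f u v = deriv_along Basis f u v"
    using smooth_on_Basis_has_derivative[OF assms(2), of u]
    by (intro deriv_along_eq[OF has_derivative_at_withinI]) auto
qed

text \<open>
  To stay inside \<^term>\<open>span B\<close>, the function is extended by the projection and supplemented by the
  coordinates transverse to \<^term>\<open>span B\<close>: the fields annihilated by the supplemented function are
  exactly those that are tangent to \<^term>\<open>span B\<close> and annihilated by the original one.
\<close>

lemma local_leaf_span:
  fixes A :: "'a::euclidean_space set" and F :: "'a \<Rightarrow> 'b::real_normed_vector"
  assumes B: "B \<subseteq> Basis" and A: "openin (coord_top B) A" and F: "smooth_on B A F" and a: "a \<in> A"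
  shows "\<exists>K s \<Psi>. K \<subseteq> (Basis :: 'a set) \<and> s > 0 \<and> \<Psi> 0 = a \<and>
    smooth_on K (ball 0 s \<inter> span K) \<Psi> \<and> inj_on \<Psi> (ball 0 s \<inter> span K) \<and>
    (\<forall>u \<in> ball 0 s \<inter> span K. \<Psi> u \<in> A \<and> inj_on (deriv_along K \<Psi> u) (span K) \<and>
       deriv_along K \<Psi> u ` span K = kernel_values B A F (\<Psi> u))"
proof -
  let ?P = "coord_proj B"
  interpret P: bounded_linear ?P
    by (rule bounded_linear_coord_proj)
  have P_id: "?P x = x" if "x \<in> span B" for x
    by (rule coord_proj_span[OF B that])
  have P_span: "?P x \<in> span B" for x
    by (rule coord_proj_in_span)
  have A_span: "A \<subseteq> span B"
    by (rule openin_coord_subset[OF A])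
  have open_P: "open (?P -` V)" if "openin (coord_top B) V" for V
  proof -
    obtain T where "open T" "V = span B \<inter> T"
      using \<open>openin (coord_top B) V\<close> by (auto simp: openin_open)
    moreover from this have "?P -` V = ?P -` T"
      using P_span by auto
    ultimately show ?thesis
      using continuous_open_vimage[of T ?P] P.continuous_on by (simp add: linear_continuous_at P.bounded_linear_axioms)
  qed
  have smooth_P: "smooth_on Basis (?P -` V) ?P" if "openin (coord_top B) V" for V
    using open_P[OF that] by (intro smooth_on_bounded_linear P.bounded_linear_axioms) simp
  have smooth_comp_P: "smooth_on Basis (?P -` V) (\<lambda>x. Y (?P x))"
    if "openin (coord_top B) V" "smooth_on B V Y" for V and Y :: "'a \<Rightarrow> 'c::real_normed_vector"
    by (rule smooth_on_compose[OF _ that(1) B _ smooth_P[OF that(1)] that(2)])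
      (use open_P[OF that(1)] in auto)
  define G where "G x = (F (?P x), x - ?P x)" for x
  have "smooth_on Basis (?P -` A) (\<lambda>x. x - ?P x)"
    using open_P[OF A]
    by (intro smooth_on_bounded_linear bounded_linear_sub bounded_linear_ident P.bounded_linear_axioms) simp
  then have smooth_G: "smooth_on Basis (?P -` A) G"
    unfolding G_def using open_P[OF A]
    by (intro smooth_on_Pair smooth_comp_P[OF A F]) auto
  have DG: "deriv_along Basis G z h = (deriv_along B F (?P z) (?P h), h - ?P h)"
    if z: "z \<in> ?P -` A" for z h
  proof -
    have op: "openin (coord_top Basis) (?P -` A)"
      using open_P[OF A] by simp
    have DP: "(?P has_derivative ?P) (at z within span Basis)"
      by (rule bounded_linear_imp_has_derivative[OF P.bounded_linear_axioms])
    have "((\<lambda>x. F (?P x)) has_derivative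
        (\<lambda>h. deriv_along B F (?P z) (deriv_along Basis ?P z h))) (at z within span Basis)"
      by (rule has_derivative_chain_along[OF op P_span z])
        (use DP smooth_on_differentiable[OF F, of "?P z"] z in \<open>auto simp: differentiable_def\<close>)
    moreover have "deriv_along Basis ?P z h = ?P h" for h
      using deriv_along_eq[OF DP] by simp
    ultimately have "((\<lambda>x. F (?P x)) has_derivative (\<lambda>h. deriv_along B F (?P z) (?P h))) (at z)"
      by simp
    moreover have "((\<lambda>x. x - ?P x) has_derivative (\<lambda>h. h - ?P h)) (at z)"
      using DP by (intro has_derivative_diff has_derivative_ident) simp
    ultimately have "(G has_derivative (\<lambda>h. (deriv_along B F (?P z) (?P h), h - ?P h))) (at z)"
      unfolding G_def[abs_def] by (rule has_derivative_Pair)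
    then show ?thesis
      by (rule deriv_along_Basis_eq)
  qed
  have kernel_eq: "kernel_values Basis (?P -` A) G y = kernel_values B A F y" if y: "y \<in> A" for y
  proof (intro equalityI subsetI)
    fix \<xi> assume "\<xi> \<in> kernel_values Basis (?P -` A) G y"
    then show "\<xi> \<in> kernel_values B A F y"
    proof (rule kernel_valuesE)
      fix Y V assume "openin (coord_top Basis) V"
        and Y: "y \<in> V" "V \<subseteq> ?P -` A" "smooth_on Basis V Y"
          "\<And>z. z \<in> V \<Longrightarrow> deriv_along Basis G z (Y z) = 0" "\<xi> = Y y"
      then have V: "open V"
        by simp
      have "Y y \<in> kernel_values B A F y"
      proof (rule kernel_valuesI[where V = "V \<inter> span B"])
        show "openin (coord_top B) (V \<inter> span B)"
          using openin_open_Int[OF V, of "span B"] by (simp add: Int_commute)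
        show "smooth_on B (V \<inter> span B) Y"
          by (rule smooth_on_restrict_span[OF V Y(3)])
        fix z assume z: "z \<in> V \<inter> span B"
        then have "(deriv_along B F z (?P (Y z)), Y z - ?P (Y z)) = 0"
          using Y(4)[of z] DG[of z "Y z"] Y(2) P_id by auto
        then have *: "?P (Y z) = Y z" "deriv_along B F z (Y z) = 0"
          by (auto simp: zero_prod_def)
        then show "Y z \<in> span B" "deriv_along B F z (Y z) = 0"
          using P_span by metis+
      qed (use Y y A_span P_id in auto)
      then show "\<xi> \<in> kernel_values B A F y"
        using Y(5) by simp
    qed
  next
    fix \<xi> assume "\<xi> \<in> kernel_values B A F y"
    then show "\<xi> \<in> kernel_values Basis (?P -` A) G y"
    proof (rule kernel_valuesE)
      fix Y V assume V: "openin (coord_top B) V"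
        and Y: "y \<in> V" "V \<subseteq> A" "smooth_on B V Y" "\<And>z. z \<in> V \<Longrightarrow> Y z \<in> span B"
          "\<And>z. z \<in> V \<Longrightarrow> deriv_along B F z (Y z) = 0" "\<xi> = Y y"
      have "Y (?P y) \<in> kernel_values Basis (?P -` A) G y"
      proof (rule kernel_valuesI[where V = "?P -` V"])
        show "smooth_on Basis (?P -` V) (\<lambda>x. Y (?P x))"
          by (rule smooth_comp_P[OF V Y(3)])
        fix z assume z: "z \<in> ?P -` V"
        then show "deriv_along Basis G z (Y (?P z)) = 0"
          using DG[of z "Y (?P z)"] Y(2,4,5) P_id by (auto simp: zero_prod_def)
      qed (use open_P[OF V] Y y A_span P_id in auto)
      then show "\<xi> \<in> kernel_values Basis (?P -` A) G y"
        using Y(6) P_id[of y] y A_span by auto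
    qed
  qed
  have "a \<in> ?P -` A"
    using a A_span P_id by auto
  from local_leaf[OF open_P[OF A] smooth_G this] obtain K :: "'a set" and s \<Psi> where
    "K \<subseteq> Basis \<and> s > 0 \<and> smooth_on Basis (ball 0 s) \<Psi> \<and> \<Psi> 0 = a \<and>
     inj_on \<Psi> (ball 0 s \<inter> span K) \<and>
     (\<forall>u \<in> ball 0 s \<inter> span K. \<Psi> u \<in> ?P -` A \<and> G (\<Psi> u) = G a \<and>
       inj_on (deriv_along Basis \<Psi> u) (span K) \<and>
       deriv_along Basis \<Psi> u ` span K = kernel_values Basis (?P -` A) G (\<Psi> u))"
    by (elim exE)
  then have K: "K \<subseteq> Basis" and s: "s > 0" and \<Psi>: "smooth_on Basis (ball 0 s) \<Psi>" "\<Psi> 0 = a"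
    "inj_on \<Psi> (ball 0 s \<inter> span K)"
    and leaf: "\<forall>u \<in> ball 0 s \<inter> span K. \<Psi> u \<in> ?P -` A \<and> G (\<Psi> u) = G a \<and>
       inj_on (deriv_along Basis \<Psi> u) (span K) \<and>
       deriv_along Basis \<Psi> u ` span K = kernel_values Basis (?P -` A) G (\<Psi> u)"
    by blast+
  have "\<Psi> u \<in> A \<and> inj_on (deriv_along K \<Psi> u) (span K) \<and>
      deriv_along K \<Psi> u ` span K = kernel_values B A F (\<Psi> u)" if u: "u \<in> ball 0 s \<inter> span K" for u
  proof -
    have leaf_u: "\<Psi> u \<in> ?P -` A" "G (\<Psi> u) = G a" "inj_on (deriv_along Basis \<Psi> u) (span K)"
      "deriv_along Basis \<Psi> u ` span K = kernel_values Basis (?P -` A) G (\<Psi> u)"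
      using leaf u by blast+
    have "\<Psi> u = ?P (\<Psi> u)"
      using leaf_u(2) a A_span P_id[of a] by (auto simp: G_def)
    with leaf_u(1) have mem: "\<Psi> u \<in> A"
      by simp
    have deriv: "deriv_along K \<Psi> u v = deriv_along Basis \<Psi> u v" if "v \<in> span K" for v
      by (rule deriv_along_restrict_span[OF _ \<Psi>(1) u that]) simp
    have "inj_on (deriv_along K \<Psi> u) (span K) \<longleftrightarrow> inj_on (deriv_along Basis \<Psi> u) (span K)"
      by (rule inj_on_cong) (rule deriv)
    moreover have "deriv_along K \<Psi> u ` span K = deriv_along Basis \<Psi> u ` span K"
      by (rule image_cong) (simp_all add: deriv)
    ultimately show ?thesis
      using mem leaf_u(3,4) kernel_eq[OF mem] by simp
  qed
  moreover have "smooth_on K (ball 0 s \<inter> span K) \<Psi>"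
    by (rule smooth_on_restrict_span[OF _ \<Psi>(1)]) simp
  ultimately show ?thesis
    using K s \<Psi>(2,3) by (intro exI[of _ K] exI[of _ s] exI[of _ \<Psi>]) simp
qed


section \<open>Charts and tangent vectors\<close>

text \<open>
  The calculus in charts for an arbitrary smooth structure; it serves both the ambient manifold and
  its leaves.
\<close>

locale smooth_space =
  fixes M :: "('m, 'e::euclidean_space) manifold"
  assumes smooth_structure: "smooth_structure M"
begin

abbreviation B where "B \<equiv> axes M"

abbreviation transition :: "('m, 'e) chart \<Rightarrow> ('m, 'e) chart \<Rightarrow> 'e \<Rightarrow> 'e" where
  "transition c d \<equiv> snd d \<circ> chart_inv c"

lemma axes_Basis: "B \<subseteq> Basis"
  using smooth_structure unfolding smooth_structure_def by blast

lemma charts_cover: "p \<in> points M \<Longrightarrow> \<exists>c. c \<in> charts_at M p"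
  using smooth_structure unfolding smooth_structure_def charts_at_def by blast

lemma charts_atD: "c \<in> charts_at M p \<Longrightarrow> c \<in> atlas M" "c \<in> charts_at M p \<Longrightarrow> p \<in> fst c"
  by (simp_all add: charts_at_def)

lemma chart_at_in: "p \<in> points M \<Longrightarrow> chart_at M p \<in> charts_at M p"
  unfolding chart_at_def using charts_cover by (rule someI_ex)

lemma openin_chart: "c \<in> atlas M \<Longrightarrow> openin (mtop M) (fst c)"
  using smooth_structure unfolding smooth_structure_def by blast

lemma chart_subset: "c \<in> atlas M \<Longrightarrow> fst c \<subseteq> points M"
  using openin_chart openin_subset by blast

lemma chart_homeo:
  "c \<in> atlas M \<Longrightarrow>
    homeomorphic_map (subtopology (mtop M) (fst c)) (top_of_set (snd c ` fst c)) (snd c)"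
  using smooth_structure unfolding smooth_structure_def by blast

lemma topspace_chart: "c \<in> atlas M \<Longrightarrow> topspace (subtopology (mtop M) (fst c)) = fst c"
  using chart_subset[of c] by (simp add: Int_absorb1)

lemma inj_chart: "c \<in> atlas M \<Longrightarrow> inj_on (snd c) (fst c)"
  using homeomorphic_imp_injective_map[OF chart_homeo] topspace_chart by metis

lemma chart_inv_chart: "c \<in> atlas M \<Longrightarrow> p \<in> fst c \<Longrightarrow> chart_inv c (snd c p) = p"
  by (simp add: chart_inv_def inv_into_f_f inj_chart)

lemma chart_chart_inv: "y \<in> snd c ` fst c \<Longrightarrow> snd c (chart_inv c y) = y"
  unfolding chart_inv_def by (rule f_inv_into_f)

lemma chart_inv_in: "y \<in> snd c ` fst c \<Longrightarrow> chart_inv c y \<in> fst c"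
  unfolding chart_inv_def by (rule inv_into_into)

lemma openin_chart_image_dom: "c \<in> atlas M \<Longrightarrow> openin (coord_top B) (snd c ` fst c)"
  using smooth_structure unfolding smooth_structure_def by blast

lemma openin_chart_image:
  assumes "c \<in> atlas M" "openin (mtop M) V"
  shows "openin (coord_top B) (snd c ` (V \<inter> fst c))"
proof -
  have "openin (subtopology (mtop M) (fst c)) (V \<inter> fst c)"
    using assms(2) by (auto simp: openin_subtopology)
  then have "openin (top_of_set (snd c ` fst c)) (snd c ` (V \<inter> fst c))"
    using homeomorphic_imp_open_map[OF chart_homeo[OF assms(1)]] by (auto simp: open_map_def)
  then show ?thesis
    using openin_chart_image_dom[OF assms(1)] openin_trans by blast
qed

lemma chart_image_subset_span: "c \<in> atlas M \<Longrightarrow> p \<in> fst c \<Longrightarrow> snd c p \<in> span B"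
  using openin_coord_subset[OF openin_chart_image_dom] by blast

lemma openin_chart_inv_image:
  assumes "c \<in> atlas M" "openin (coord_top B) V" "V \<subseteq> snd c ` fst c"
  shows "openin (mtop M) (chart_inv c ` V)"
proof -
  have 1: "openin (top_of_set (snd c ` fst c)) V"
    using assms(2,3) openin_coord_subset[OF openin_chart_image_dom[OF assms(1)]]
    by (auto simp: openin_open)
  have "openin (subtopology (mtop M) (fst c)) {p \<in> fst c. snd c p \<in> V}"
    using openin_continuous_map_preimage[OF
        homeomorphic_imp_continuous_map[OF chart_homeo[OF assms(1)]] 1]
    by (simp only: topspace_chart[OF assms(1)])
  then have "openin (mtop M) {p \<in> fst c. snd c p \<in> V}"
    using openin_chart[OF assms(1)] openin_trans_full by blast
  moreover have "{p \<in> fst c. snd c p \<in> V} = chart_inv c ` V"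
  proof (intro equalityI subsetI)
    show "p \<in> chart_inv c ` V" if "p \<in> {p \<in> fst c. snd c p \<in> V}" for p
      using that chart_inv_chart[OF assms(1), of p] by (metis (no_types, lifting) CollectD imageI)
    fix p assume "p \<in> chart_inv c ` V"
    then obtain y where "y \<in> V" "p = chart_inv c y" by blast
    then show "p \<in> {p \<in> fst c. snd c p \<in> V}"
      using assms(3) chart_chart_inv[of y c] chart_inv_in[of y c] by auto
  qed
  ultimately show ?thesis by simp
qed

lemma continuous_chart_inv:
  assumes "c \<in> atlas M"
  shows "continuous_map (top_of_set (snd c ` fst c)) (mtop M) (chart_inv c)"
proof -
  obtain g where g: "homeomorphic_maps (subtopology (mtop M) (fst c)) (top_of_set (snd c ` fst c)) (snd c) g"
    using chart_homeo[OF assms] homeomorphic_map_maps by blast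
  have eq: "g y = chart_inv c y" if y: "y \<in> topspace (top_of_set (snd c ` fst c))" for y
  proof -
    obtain p where "p \<in> fst c" "y = snd c p"
      using y by auto
    then show ?thesis
      using g topspace_chart[OF assms] chart_inv_chart[OF assms]
      by (auto simp: homeomorphic_maps_def)
  qed
  have "continuous_map (top_of_set (snd c ` fst c)) (mtop M) g"
    using g continuous_map_into_fulltopology by (auto simp: homeomorphic_maps_def)
  then show ?thesis
    using eq by (rule continuous_map_eq)
qed

lemma smooth_transition:
  "c \<in> atlas M \<Longrightarrow> d \<in> atlas M \<Longrightarrow> smooth_on B (snd c ` (fst c \<inter> fst d)) (transition c d)"
  using smooth_structure unfolding smooth_structure_def by blast

lemma openin_overlap:
  "c \<in> atlas M \<Longrightarrow> d \<in> atlas M \<Longrightarrow> openin (coord_top B) (snd c ` (fst c \<inter> fst d))"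
  using openin_chart_image[of c "fst d"] openin_chart[of d] by (simp add: Int_commute)

lemma smooth_in_other_chart:
  assumes c: "c \<in> atlas M" and d: "d \<in> atlas M" and V: "openin (mtop M) V"
    and f: "smooth_on B (snd c ` (V \<inter> fst c)) (f \<circ> chart_inv c)"
  shows "smooth_on B (snd d ` (V \<inter> fst c \<inter> fst d)) (f \<circ> chart_inv d)"
proof -
  have op: "openin (coord_top B) (snd d ` (V \<inter> fst c \<inter> fst d))"
    using openin_chart_image[OF d openin_Int[OF V openin_chart[OF c]]] by simp
  have "smooth_on B (snd d ` (V \<inter> fst c \<inter> fst d)) (\<lambda>y. (f \<circ> chart_inv c) (transition d c y))"
  proof (rule smooth_on_compose[OF op openin_chart_image[OF c V] axes_Basis _ _ f])
    show "smooth_on B (snd d ` (V \<inter> fst c \<inter> fst d)) (transition d c)"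
      by (rule smooth_on_subset[OF smooth_transition[OF d c]]) auto
  qed (auto simp: chart_inv_chart[OF d])
  then show ?thesis
    by (subst (asm) smooth_on_cong[OF op, of _ "f \<circ> chart_inv d"])
      (auto simp: chart_inv_chart[OF d] chart_inv_chart[OF c])
qed

lemma smooth_fun_onI:
  assumes V: "openin (mtop M) V"
    and "\<And>p. p \<in> V \<Longrightarrow> \<exists>c W. c \<in> atlas M \<and> openin (mtop M) W \<and> p \<in> W \<and> W \<subseteq> fst c \<and>
      smooth_on B (snd c ` W) (f \<circ> chart_inv c)"
  shows "smooth_fun_on M V f"
  unfolding smooth_fun_on_def
proof
  fix d assume d: "d \<in> atlas M"
  show "smooth_on B (snd d ` (V \<inter> fst d)) (f \<circ> chart_inv d)"
  proof (rule smooth_on_local)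
    show "snd d ` (V \<inter> fst d) \<subseteq> span B"
      using chart_image_subset_span[OF d] by auto
    fix y assume "y \<in> snd d ` (V \<inter> fst d)"
    then obtain p where p: "p \<in> V" "p \<in> fst d" "y = snd d p" by auto
    obtain c W where c: "c \<in> atlas M" "openin (mtop M) W" "p \<in> W" "W \<subseteq> fst c"
      "smooth_on B (snd c ` W) (f \<circ> chart_inv c)"
      using assms(2)[OF p(1)] by blast
    have "smooth_on B (snd d ` (W \<inter> fst c \<inter> fst d)) (f \<circ> chart_inv d)"
      by (rule smooth_in_other_chart[OF c(1) d c(2)]) (use c(4,5) in \<open>simp add: Int_absorb2\<close>)
    then show "\<exists>A'. openin (coord_top B) A' \<and> y \<in> A' \<and> smooth_on B A' (f \<circ> chart_inv d)"
      using openin_chart_image[OF d c(2)] c(3,4) p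
      by (intro exI[of _ "snd d ` (W \<inter> fst d)"]) (simp add: Int_absorb2)
  qed
qed

text \<open>
  The chain rule for a coordinate change, which makes tangent vectors and differentials independent
  of the chart.
\<close>

lemma deriv_change_chart:
  assumes c: "c \<in> atlas M" and d: "d \<in> atlas M" and p: "p \<in> fst c" "p \<in> fst d"
    and f: "(f \<circ> chart_inv d) differentiable (at (snd d p) within span B)" and v: "v \<in> span B"
  shows "deriv_along B (f \<circ> chart_inv c) (snd c p) v =
    deriv_along B (f \<circ> chart_inv d) (snd d p) (deriv_along B (transition c d) (snd c p) v)"
proof -
  have op: "openin (coord_top B) (snd c ` (fst c \<inter> fst d))"
    by (rule openin_overlap[OF c d])
  have y: "snd c p \<in> snd c ` (fst c \<inter> fst d)"
    using p by blast
  have "deriv_along B (f \<circ> chart_inv c) (snd c p) v =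
      deriv_along B (\<lambda>y. (f \<circ> chart_inv d) (transition c d y)) (snd c p) v"
    by (rule deriv_along_cong[OF op y]) (auto simp: chart_inv_chart[OF c] chart_inv_chart[OF d])
  also have "\<dots> = deriv_along B (f \<circ> chart_inv d) (transition c d (snd c p))
      (deriv_along B (transition c d) (snd c p) v)"
  proof (rule deriv_along_chain[OF op _ y _ _ v])
    show "transition c d y \<in> span B" if "y \<in> snd c ` (fst c \<inter> fst d)" for y
      using that chart_image_subset_span[OF d] by (auto simp: chart_inv_chart[OF c])
    show "transition c d differentiable (at (snd c p) within span B)"
      by (rule smooth_on_differentiable[OF smooth_transition[OF c d] y])
  qed (use f p in \<open>simp add: chart_inv_chart[OF c] o_def\<close>)
  finally show ?thesis
    by (simp add: chart_inv_chart[OF c p(1)])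
qed

lemma transition_differentiable:
  "c \<in> charts_at M p \<Longrightarrow> d \<in> charts_at M p \<Longrightarrow>
    transition c d differentiable (at (snd c p) within span B)"
  by (rule smooth_on_differentiable[OF smooth_transition]) (auto simp: charts_at_def)

lemma transition_deriv_in_span:
  assumes "c \<in> charts_at M p" "d \<in> charts_at M p" "v \<in> span B"
  shows "deriv_along B (transition c d) (snd c p) v \<in> span B"
proof -
  have c: "c \<in> atlas M" "p \<in> fst c" and d: "d \<in> atlas M" "p \<in> fst d"
    using assms by (auto simp: charts_at_def)
  show ?thesis
    by (rule deriv_along_in_span[OF openin_overlap[OF c(1) d(1)] axes_Basis])
      (use c d assms transition_differentiable chart_image_subset_span[OF d(1)] in
        \<open>auto simp: chart_inv_chart[OF c(1)]\<close>)
qed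

lemma transition_self_deriv:
  assumes "c \<in> charts_at M p" "v \<in> span B"
  shows "deriv_along B (transition c c) (snd c p) v = v"
proof -
  have c: "c \<in> atlas M" "p \<in> fst c"
    using assms by (auto simp: charts_at_def)
  have "deriv_along B (transition c c) (snd c p) v = deriv_along B (\<lambda>y. y) (snd c p) v"
    by (rule deriv_along_cong[OF openin_chart_image_dom[OF c(1)]])
      (use c chart_inv_chart[OF c(1)] in auto)
  also have "\<dots> = v"
    by (rule deriv_along_eq[OF has_derivative_ident chart_image_subset_span[OF c] assms(2)])
  finally show ?thesis .
qed

lemma tangent_of_coord_in:
  assumes "c \<in> charts_at M p" "v \<in> span B"
  shows "tangent_of_coord M c p v \<in> tangent_space M p"
  unfolding tangent_space_def tangent_of_coord_def
proof (intro CollectI conjI ballI allI impI)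
  fix d assume d: "d \<in> charts_at M p"
  show "(if d \<in> charts_at M p then deriv_along B (transition c d) (snd c p) v else 0) \<in> span B"
    using transition_deriv_in_span[OF assms(1) d assms(2)] d by simp
  fix e assume e: "e \<in> charts_at M p"
  show "(if e \<in> charts_at M p then deriv_along B (transition c e) (snd c p) v else 0) =
      deriv_along B (transition d e) (snd d p)
        (if d \<in> charts_at M p then deriv_along B (transition c d) (snd c p) v else 0)"
    using d e deriv_change_chart[OF charts_atD(1)[OF assms(1)] charts_atD(1)[OF d]
        charts_atD(2)[OF assms(1)] charts_atD(2)[OF d] transition_differentiable[OF d e] assms(2)]
    by simp
qed simp

lemma tangent_of_coord_self:
  "c \<in> charts_at M p \<Longrightarrow> v \<in> span B \<Longrightarrow> tangent_of_coord M c p v c = v"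
  by (simp add: tangent_of_coord_def transition_self_deriv)

lemma tangent_space_span: "\<xi> \<in> tangent_space M p \<Longrightarrow> c \<in> charts_at M p \<Longrightarrow> \<xi> c \<in> span B"
  unfolding tangent_space_def by blast

lemma tangent_space_change:
  "\<xi> \<in> tangent_space M p \<Longrightarrow> c \<in> charts_at M p \<Longrightarrow> d \<in> charts_at M p \<Longrightarrow>
    deriv_along B (transition c d) (snd c p) (\<xi> c) = \<xi> d"
  unfolding tangent_space_def by fastforce

lemma tangent_space_off: "\<xi> \<in> tangent_space M p \<Longrightarrow> c \<notin> charts_at M p \<Longrightarrow> \<xi> c = 0"
  unfolding tangent_space_def by blast

lemma tangent_space_eq:
  assumes "\<xi> \<in> tangent_space M p" "c \<in> charts_at M p"
  shows "\<xi> = tangent_of_coord M c p (\<xi> c)"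
proof
  show "\<xi> d = tangent_of_coord M c p (\<xi> c) d" for d
    using tangent_space_change[OF assms] tangent_space_off[OF assms(1)]
    by (simp add: tangent_of_coord_def)
qed

lemma tangent_of_coord_add:
  assumes "c \<in> charts_at M p"
  shows "(\<lambda>d. tangent_of_coord M c p u d + tangent_of_coord M c p v d) = tangent_of_coord M c p (u + v)"
  using linear_add[OF deriv_along_linear[OF transition_differentiable[OF assms]]]
  by (auto simp: tangent_of_coord_def fun_eq_iff)

lemma tangent_of_coord_scale:
  assumes "c \<in> charts_at M p"
  shows "(\<lambda>d. r *\<^sub>R tangent_of_coord M c p v d) = tangent_of_coord M c p (r *\<^sub>R v)"
  using linear_scale[OF deriv_along_linear[OF transition_differentiable[OF assms]]]
  by (auto simp: tangent_of_coord_def fun_eq_iff)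

lemma fun_differential_eq:
  assumes "smooth_fun_on M V f" "p \<in> V" "openin (mtop M) V"
    and "\<xi> \<in> tangent_space M p" "c \<in> charts_at M p"
  shows "fun_differential M f p \<xi> = deriv_along B (f \<circ> chart_inv c) (snd c p) (\<xi> c)"
proof -
  let ?d = "chart_at M p"
  have p: "p \<in> points M"
    using assms(2,3) openin_subset by blast
  have d: "?d \<in> charts_at M p"
    by (rule chart_at_in[OF p])
  have c': "c \<in> atlas M" "p \<in> fst c"
    using assms(5) by (auto simp: charts_at_def)
  have diff: "(f \<circ> chart_inv c) differentiable (at (snd c p) within span B)"
    by (rule smooth_on_differentiable[where A = "snd c ` (V \<inter> fst c)"])
      (use assms(1,2) c' in \<open>auto simp: smooth_fun_on_def\<close>)
  have "deriv_along B (f \<circ> chart_inv ?d) (snd ?d p) (\<xi> ?d) = deriv_along B (f \<circ> chart_inv c) (snd c p)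
      (deriv_along B (transition ?d c) (snd ?d p) (\<xi> ?d))"
    by (rule deriv_change_chart[OF charts_atD(1)[OF d] c'(1) charts_atD(2)[OF d] c'(2) diff
          tangent_space_span[OF assms(4) d]])
  also have "deriv_along B (transition ?d c) (snd ?d p) (\<xi> ?d) = \<xi> c"
    by (rule tangent_space_change[OF assms(4) d assms(5)])
  finally show ?thesis
    by (simp add: fun_differential_def Let_def o_def)
qed

lemma fun_differential_linear:
  assumes "smooth_fun_on M V f" "p \<in> V" "openin (mtop M) V" "\<xi> \<in> tangent_space M p" 
  shows "\<eta> \<in> tangent_space M p \<Longrightarrow>
      fun_differential M f p (\<lambda>c. \<xi> c + \<eta> c) = fun_differential M f p \<xi> + fun_differential M f p \<eta>"
    and "fun_differential M f p (\<lambda>c. r *\<^sub>R \<xi> c) = r *\<^sub>R fun_differential M f p \<xi>"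
proof -
  let ?d = "chart_at M p"
  have p: "p \<in> points M"
    using assms(2,3) openin_subset by blast
  have d: "?d \<in> atlas M" "p \<in> fst ?d"
    using chart_at_in[OF p] by (auto simp: charts_at_def)
  have "(f \<circ> chart_inv ?d) differentiable (at (snd ?d p) within span B)"
    by (rule smooth_on_differentiable[where A = "snd ?d ` (V \<inter> fst ?d)"])
      (use assms(1,2) d in \<open>auto simp: smooth_fun_on_def\<close>)
  note lin = deriv_along_linear[OF this]
  show "fun_differential M f p (\<lambda>c. \<xi> c + \<eta> c) = fun_differential M f p \<xi> + fun_differential M f p \<eta>"
    by (simp add: fun_differential_def Let_def linear_add[OF lin])
  show "fun_differential M f p (\<lambda>c. r *\<^sub>R \<xi> c) = r *\<^sub>R fun_differential M f p \<xi>"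
    by (simp add: fun_differential_def Let_def linear_scale[OF lin])
qed

text \<open>
  In another chart the coordinates of the field are derivatives of the coordinate change, applied to
  a smooth field.  This is how fields constructed in one chart become vector fields.
\<close>

lemma vector_field_on_tangent_of_coord:
  assumes c: "c \<in> atlas M" and V: "openin (coord_top B) V" "V \<subseteq> snd c ` fst c"
    and Y: "smooth_on B V Y" "\<And>y. y \<in> V \<Longrightarrow> Y y \<in> span B"
  shows "vector_field_on M (chart_inv c ` V) (\<lambda>p. tangent_of_coord M c p (Y (snd c p)))"
  unfolding vector_field_on_def
proof (intro conjI ballI)
  have inV: "p \<in> fst c" "snd c p \<in> V" if "p \<in> chart_inv c ` V" for p
    using that V(2) chart_inv_in[of _ c] chart_chart_inv[of _ c] by auto
  show "tangent_of_coord M c p (Y (snd c p)) \<in> tangent_space M p" if "p \<in> chart_inv c ` V" for p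
    using inV[OF that] c Y(2) by (intro tangent_of_coord_in) (auto simp: charts_at_def)
  fix d assume d: "d \<in> atlas M"
  let ?D = "snd d ` (chart_inv c ` V \<inter> fst d)"
  have op: "openin (coord_top B) ?D"
    by (rule openin_chart_image[OF d openin_chart_inv_image[OF c V]])
  have sm: "smooth_on B ?D (transition d c)"
    by (rule smooth_on_subset[OF smooth_transition[OF d c]]) (use inV in auto)
  have smY: "smooth_on B ?D (\<lambda>y. Y (transition d c y))"
    by (rule smooth_on_compose[OF op V(1) axes_Basis _ sm Y(1)])
      (use inV in \<open>auto simp: chart_inv_chart[OF d]\<close>)
  have "smooth_on B ?D (\<lambda>y. deriv_along B (transition c d) (transition d c y) (Y (transition d c y)))"
    by (rule smooth_on_deriv_field[OF op openin_overlap[OF c d] axes_Basis _ sm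
          smooth_transition[OF c d] smY])
      (use inV Y(2) in \<open>auto simp: chart_inv_chart[OF d]\<close>)
  then show "smooth_on B ?D (\<lambda>y. tangent_of_coord M c (chart_inv d y) (Y (snd c (chart_inv d y))) d)"
    by (subst (asm) smooth_on_cong[OF op])
      (use d in \<open>auto simp: chart_inv_chart[OF d] tangent_of_coord_def charts_at_def\<close>)
qed

lemma vector_field_on_subset:
  assumes "vector_field_on M V X" "W \<subseteq> V"
  shows "vector_field_on M W X"
  unfolding vector_field_on_def
proof (intro conjI ballI)
  show "smooth_on B (snd c ` (W \<inter> fst c)) (\<lambda>y. X (chart_inv c y) c)" if "c \<in> atlas M" for c
    by (rule smooth_on_subset[where A = "snd c ` (V \<inter> fst c)"])
      (use assms that in \<open>auto simp: vector_field_on_def\<close>)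
qed (use assms in \<open>auto simp: vector_field_on_def\<close>)

lemma vector_field_on_cong:
  assumes "openin (mtop M) V" "vector_field_on M V X" "\<And>p. p \<in> V \<Longrightarrow> Y p = X p"
  shows "vector_field_on M V Y"
  unfolding vector_field_on_def
proof (intro conjI ballI)
  show "Y p \<in> tangent_space M p" if "p \<in> V" for p
    using assms that by (simp add: vector_field_on_def)
  fix c assume c: "c \<in> atlas M"
  have "smooth_on B (snd c ` (V \<inter> fst c)) (\<lambda>y. X (chart_inv c y) c)"
    using assms(2) c by (simp add: vector_field_on_def)
  also have "?this \<longleftrightarrow> smooth_on B (snd c ` (V \<inter> fst c)) (\<lambda>y. Y (chart_inv c y) c)"
    by (rule smooth_on_cong[OF openin_chart_image[OF c assms(1)]])
      (auto simp: chart_inv_chart[OF c] assms(3))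
  finally show "smooth_on B (snd c ` (V \<inter> fst c)) (\<lambda>y. Y (chart_inv c y) c)" .
qed

lemma vector_field_on_Union:
  assumes "\<And>V. V \<in> \<V> \<Longrightarrow> openin (mtop M) V \<and> vector_field_on M V X"
  shows "vector_field_on M (\<Union>\<V>) X"
  unfolding vector_field_on_def
proof (intro conjI ballI)
  show "X p \<in> tangent_space M p" if "p \<in> \<Union>\<V>" for p
    using assms that by (auto simp: vector_field_on_def)
  fix c assume c: "c \<in> atlas M"
  show "smooth_on B (snd c ` (\<Union>\<V> \<inter> fst c)) (\<lambda>y. X (chart_inv c y) c)"
  proof (rule smooth_on_local)
    show "snd c ` (\<Union>\<V> \<inter> fst c) \<subseteq> span B"
      using chart_image_subset_span[OF c] by auto
    fix y assume "y \<in> snd c ` (\<Union>\<V> \<inter> fst c)"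
    then obtain V where V: "V \<in> \<V>" "y \<in> snd c ` (V \<inter> fst c)"
      by auto
    then have "openin (mtop M) V" "smooth_on B (snd c ` (V \<inter> fst c)) (\<lambda>y. X (chart_inv c y) c)"
      using assms[OF V(1)] c by (simp_all add: vector_field_on_def)
    then show "\<exists>A'. openin (coord_top B) A' \<and> y \<in> A' \<and> smooth_on B A' (\<lambda>y. X (chart_inv c y) c)"
      using openin_chart_image[OF c] V(2) by blast
  qed
qed

end


section \<open>Bump functions\<close>

text \<open>
  The functions \<open>t\<^sup>-\<^sup>n exp (- 1 / t)\<close>, extended by 0 to the left.  Derivatives of members of this
  family are combinations of members, so all of them are smooth by one induction.
\<close>

definition flat_fun :: "nat \<Rightarrow> real \<Rightarrow> real" where
  "flat_fun n t = (if t > 0 then inverse t ^ n * exp (- inverse t) else 0)"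

lemma flat_fun_tendsto_0: "(flat_fun n \<longlongrightarrow> 0) (at 0)"
proof (rule filterlim_split_at)
  have "\<forall>\<^sub>F t in at_left (0::real). 0 = flat_fun n t"
    by (auto simp: eventually_at_filter flat_fun_def)
  then show "(flat_fun n \<longlongrightarrow> 0) (at_left 0)"
    by (rule Lim_transform_eventually[OF tendsto_const])
  have "((\<lambda>t::real. inverse t ^ n / exp (inverse t)) \<longlongrightarrow> 0) (at_right 0)"
    by (rule filterlim_compose[OF tendsto_power_div_exp_0 filterlim_inverse_at_top_right])
  moreover have "\<forall>\<^sub>F t in at_right (0::real). inverse t ^ n / exp (inverse t) = flat_fun n t"
    by (auto simp: eventually_at_filter flat_fun_def exp_minus field_simps)
  ultimately show "(flat_fun n \<longlongrightarrow> 0) (at_right 0)"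
    by (rule Lim_transform_eventually)
qed

lemma flat_fun_derivative:
  "(flat_fun n has_real_derivative flat_fun (n + 2) t - real n * flat_fun (n + 1) t) (at t)"
proof (cases "t = 0")
  case True
  have "(\<lambda>h. (flat_fun n (0 + h) - flat_fun n 0) / h) = flat_fun (n + 1)"
    by (auto simp: flat_fun_def fun_eq_iff field_simps)
  then have "(flat_fun n has_real_derivative 0) (at 0)"
    unfolding DERIV_def using flat_fun_tendsto_0[of "n + 1"] by simp
  then show ?thesis
    using True by (simp add: flat_fun_def)
next
  case False
  show ?thesis
  proof (cases "t > 0")
    case True
    define i where "i = inverse t"
    have "((\<lambda>t. inverse t) has_real_derivative - (i * i)) (at t)"
      using DERIV_inverse[of t UNIV] True by (simp add: i_def power2_eq_square)
    from DERIV_mult[OF DERIV_power[OF this, of n] DERIV_fun_exp[OF DERIV_minus[OF this]]]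
    have "((\<lambda>t. inverse t ^ n * exp (- inverse t)) has_real_derivative
        real n * (- (i * i) * i ^ (n - Suc 0)) * exp (- i) + exp (- i) * - (- (i * i)) * i ^ n) (at t)"
      by (simp add: i_def)
    also have "real n * (- (i * i) * i ^ (n - Suc 0)) * exp (- i) + exp (- i) * - (- (i * i)) * i ^ n =
        flat_fun (n + 2) t - real n * flat_fun (n + 1) t"
      using True by (cases n) (simp_all add: flat_fun_def i_def[symmetric] algebra_simps)
    finally have "((\<lambda>t. inverse t ^ n * exp (- inverse t)) has_real_derivative
        flat_fun (n + 2) t - real n * flat_fun (n + 1) t) (at t)" .
    then show ?thesis
      by (rule DERIV_cong_ev[THEN iffD1, rotated -1])
        (use True eventually_gt_at_top in \<open>auto simp: flat_fun_def eventually_nhds intro!: exI[of _ "{0<..}"]\<close>)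
  next
    case neg: False
    have "(flat_fun n has_real_derivative 0) (at t)"
      by (rule DERIV_cong_ev[THEN iffD1, OF refl _ refl DERIV_const[of 0]])
        (use neg False in \<open>auto simp: flat_fun_def eventually_nhds intro!: exI[of _ "{..<0}"]\<close>)
    then show ?thesis
      using neg by (simp add: flat_fun_def)
  qed
qed

lemma openin_Basis_UNIV: "openin (coord_top (Basis :: 'a::euclidean_space set)) UNIV"
  by simp

lemma Ck_on_flat_fun: "Ck_on Basis k UNIV (flat_fun n)"
proof (induction k arbitrary: n)
  case 0
  show ?case
    using DERIV_isCont[OF flat_fun_derivative] by (simp add: continuous_at_imp_continuous_on)
next
  case (Suc k)
  show ?case
  proof (rule Ck_on_SucI[where D = "\<lambda>t h. (flat_fun (n + 2) t - real n * flat_fun (n + 1) t) * h"])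
    show "(flat_fun n has_derivative (\<lambda>h. (flat_fun (n + 2) t - real n * flat_fun (n + 1) t) * h))
        (at t within span Basis)" for t
      by (rule has_derivative_at_withinI)
        (use flat_fun_derivative[of n t] in \<open>simp add: has_field_derivative_def\<close>)
    show "Ck_on Basis k UNIV (\<lambda>t. (flat_fun (n + 2) t - real n * flat_fun (n + 1) t) * b)"
      if "b \<in> Basis" for b :: real
    proof -
      have "Ck_on Basis k UNIV (\<lambda>t. flat_fun (n + 2) t + (- real n) * flat_fun (n + 1) t)"
        by (intro Ck_on_add openin_Basis_UNIV Suc
            Ck_on_bounded_linear_compose[OF openin_Basis_UNIV bounded_linear_mult_right])
      then show ?thesis
        using that by simp
    qed
  qed (rule openin_Basis_UNIV)
qed

lemma smooth_on_flat_fun: "smooth_on Basis UNIV (flat_fun n)"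
  by (simp add: smooth_on_def Ck_on_flat_fun del: Basis_real_def)

context smooth_space
begin

lemma openin_points: "openin (mtop M) V \<Longrightarrow> p \<in> V \<Longrightarrow> p \<in> points M"
  using openin_subset by blast

lemma chart_around: "p \<in> points M \<Longrightarrow> \<exists>c. c \<in> atlas M \<and> p \<in> fst c"
  using charts_cover by (auto simp: charts_at_def)

text \<open>
  The function is a bump in one chart, extended by 0.  The Hausdorff property enters because the
  support, compact in the chart, has to be closed in the whole space for the extension to be smooth.
\<close>

lemma bump_function:
  assumes haus: "Hausdorff_space (mtop M)" and V: "openin (mtop M) V" "p \<in> V"
  obtains \<theta> :: "'m \<Rightarrow> real" and C where "closedin (mtop M) C" "C \<subseteq> V"
    "smooth_fun_on M (points M) \<theta>" "\<theta> p \<noteq> 0" "\<And>q. q \<notin> C \<Longrightarrow> \<theta> q = 0"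
proof -
  obtain c where c: "c \<in> atlas M" "p \<in> fst c"
    using chart_around[OF openin_points[OF V]] by blast
  define y0 where "y0 = snd c p"
  have op: "openin (coord_top B) (snd c ` (V \<inter> fst c))"
    by (rule openin_chart_image[OF c(1) V(1)])
  obtain T where T: "open T" "snd c ` (V \<inter> fst c) = span B \<inter> T"
    using op by (auto simp: openin_open)
  have "y0 \<in> T"
    using T(2) V(2) c(2) by (auto simp: y0_def)
  then obtain r where r: "r > 0" "cball y0 r \<subseteq> T"
    using T(1) open_contains_cball by blast
  define S where "S = cball y0 r \<inter> span B"
  have S: "S \<subseteq> snd c ` (V \<inter> fst c)" "compact S"
    using r(2) T(2) by (auto simp: S_def intro!: compact_Int_closed closed_subspace)
  define C where "C = chart_inv c ` S"
  have "compactin (top_of_set (snd c ` fst c)) S"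
    using S by (auto simp: compactin_subtopology)
  then have "compactin (mtop M) C"
    unfolding C_def using continuous_chart_inv[OF c(1)] image_compactin by blast
  then have C: "closedin (mtop M) C"
    using haus compactin_imp_closedin by blast
  have CV: "C \<subseteq> V"
    using S(1) chart_inv_chart[OF c(1)] by (auto simp: C_def)
  define bump where "bump y = flat_fun 0 (r\<^sup>2 - (y - y0) \<bullet> (y - y0))" for y
  have smooth_bump: "smooth_on B A bump" if "openin (coord_top B) A" for A
  proof -
    have "smooth_on B A (\<lambda>y. y + (- y0))"
      by (intro smooth_on_add smooth_on_id smooth_on_const that)
    then have "smooth_on B A (\<lambda>y. (y - y0) \<bullet> (y - y0))"
      using smooth_on_bilinear[OF bounded_bilinear_inner that, of "\<lambda>y. y - y0" "\<lambda>y. y - y0"] by simp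
    then have "smooth_on B A (\<lambda>y. r\<^sup>2 + - ((y - y0) \<bullet> (y - y0)))"
      by (intro smooth_on_add[OF that] smooth_on_const that
          smooth_on_bounded_linear_compose[OF that bounded_linear_minus[OF bounded_linear_ident]])
    then show ?thesis
      unfolding bump_def
      by (intro smooth_on_compose[OF that openin_Basis_UNIV subset_refl _ _ smooth_on_flat_fun])
        simp_all
  qed
  have bump0: "bump y = 0" if "y \<notin> cball y0 r" for y
  proof -
    have "r < norm (y - y0)"
      using that by (simp add: dist_norm norm_minus_commute)
    then have "r\<^sup>2 < (norm (y - y0))\<^sup>2"
      using r(1) by (intro power_strict_mono) auto
    then show ?thesis
      by (simp add: bump_def flat_fun_def power2_norm_eq_inner)
  qed
  define \<theta> where "\<theta> q = (if q \<in> fst c then bump (snd c q) else 0)" for q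
  have \<theta>0: "\<theta> q = 0" if "q \<notin> C" for q
  proof (cases "q \<in> fst c")
    case True
    have "snd c q \<notin> S"
      using that chart_inv_chart[OF c(1) True] by (metis C_def imageI)
    then have "snd c q \<notin> cball y0 r"
      using chart_image_subset_span[OF c(1) True] by (simp add: S_def)
    from bump0[OF this] show ?thesis
      by (simp add: \<theta>_def)
  qed (simp add: \<theta>_def)
  have "smooth_fun_on M (points M) \<theta>"
  proof (rule smooth_fun_onI)
    fix q assume q: "q \<in> points M"
    show "\<exists>d W. d \<in> atlas M \<and> openin (mtop M) W \<and> q \<in> W \<and> W \<subseteq> fst d \<and>
        smooth_on B (snd d ` W) (\<theta> \<circ> chart_inv d)"
    proof (cases "q \<in> fst c")
      case True
      have "smooth_on B (snd c ` fst c) bump \<longleftrightarrow> smooth_on B (snd c ` fst c) (\<theta> \<circ> chart_inv c)"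
        by (rule smooth_on_cong[OF openin_chart_image_dom[OF c(1)]])
          (auto simp: \<theta>_def chart_inv_chart[OF c(1)])
      then show ?thesis
        using c(1) True openin_chart[OF c(1)] smooth_bump[OF openin_chart_image_dom[OF c(1)]] by blast
    next
      case False
      obtain d where d: "d \<in> atlas M" "q \<in> fst d"
        using chart_around[OF q] by blast
      have W: "openin (mtop M) (fst d - C)"
        using openin_diff[OF openin_chart[OF d(1)] C] .
      have Cc: "C \<subseteq> fst c"
        using S(1) chart_inv_in[of _ c] by (auto simp: C_def)
      have op': "openin (coord_top B) (snd d ` (fst d - C))"
        using openin_chart_image[OF d(1) W] by (simp add: Int_absorb2)
      have "smooth_on B (snd d ` (fst d - C)) (\<theta> \<circ> chart_inv d)"
        by (subst smooth_on_cong[OF op', of _ "\<lambda>_. 0"])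
          (auto simp: chart_inv_chart[OF d(1)] \<theta>0 intro: smooth_on_const op')
      then show ?thesis
        using d W False Cc by (intro exI[of _ d] exI[of _ "fst d - C"]) auto
    qed
  qed simp
  moreover have "\<theta> p \<noteq> 0"
    using c r(1) by (simp add: \<theta>_def bump_def flat_fun_def y0_def)
  ultimately show thesis
    using that C CV \<theta>0 by blast
qed

lemma smooth_fun_on_mult:
  assumes V: "openin (mtop M) V"
    and f: "smooth_fun_on M V f" and g: "smooth_fun_on M V (g :: 'm \<Rightarrow> real)"
  shows "smooth_fun_on M V (\<lambda>p. f p * g p :: real)"
  unfolding smooth_fun_on_def
proof
  fix c assume c: "c \<in> atlas M"
  have "smooth_on B (snd c ` (V \<inter> fst c)) (\<lambda>y. (f \<circ> chart_inv c) y * (g \<circ> chart_inv c) y)"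
    by (rule smooth_on_mult[OF openin_chart_image[OF c V]])
      (use f g c in \<open>auto simp: smooth_fun_on_def o_def\<close>)
  then show "smooth_on B (snd c ` (V \<inter> fst c)) ((\<lambda>p. f p * g p) \<circ> chart_inv c)"
    by (simp add: o_def)
qed

lemma smooth_fun_on_compose:
  assumes V: "openin (mtop M) V" and f: "smooth_fun_on M V f"
    and A: "openin (coord_top Q) A" "Q \<subseteq> Basis" "\<And>p. p \<in> V \<Longrightarrow> f p \<in> A" and g: "smooth_on Q A g"
  shows "smooth_fun_on M V (\<lambda>p. g (f p))"
  unfolding smooth_fun_on_def
proof
  fix c assume c: "c \<in> atlas M"
  have "smooth_on B (snd c ` (V \<inter> fst c)) (\<lambda>y. g ((f \<circ> chart_inv c) y))"
    by (rule smooth_on_compose[OF openin_chart_image[OF c V] A(1,2) _ _ g])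
      (use f c A(3) chart_inv_chart[OF c] in \<open>auto simp: smooth_fun_on_def o_def\<close>)
  then show "smooth_on B (snd c ` (V \<inter> fst c)) ((\<lambda>p. g (f p)) \<circ> chart_inv c)"
    by (simp add: o_def)
qed

lemma smooth_fun_on_subset: "smooth_fun_on M V f \<Longrightarrow> W \<subseteq> V \<Longrightarrow> smooth_fun_on M W f"
  unfolding smooth_fun_on_def using smooth_on_subset by (metis (no_types, lifting) Int_mono image_mono subset_refl)

end


section \<open>Haefliger charts\<close>

lemma germ_range_germ_at:
  assumes "x \<in> span Q"
  shows "germ_range (germ_at Q g x) = g x"
proof -
  have "g \<in> snd (germ_at Q g x)"
    using assms by (auto simp: germ_at_def intro!: exI[of _ "span Q"])
  then have "germ_rep (germ_at Q g x) \<in> snd (germ_at Q g x)"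
    unfolding germ_rep_def using someI[of "\<lambda>k. k \<in> snd (germ_at Q g x)"] by blast
  then show ?thesis
    by (auto simp: germ_range_def germ_source_def germ_at_def)
qed

locale haefliger_structure = smooth_space M
  for M :: "('m, 'e::euclidean_space) manifold" +
  fixes Q :: "'q::euclidean_space set" and I :: "'i set" and U :: "'i \<Rightarrow> 'm set"
    and h :: "'i \<Rightarrow> 'i \<Rightarrow> 'm \<Rightarrow> 'q germ"
  assumes Hausdorff: "Hausdorff_space (mtop M)"
    and Q_Basis: "Q \<subseteq> Basis"
    and cocycle: "haefliger_cocycle M Q I U h"
begin

abbreviation f where "f \<equiv> haefliger_chart h"

lemma openin_U: "\<alpha> \<in> I \<Longrightarrow> openin (mtop M) (U \<alpha>)"
  using cocycle by (simp add: haefliger_cocycle_def)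

lemma U_cover: "p \<in> points M \<Longrightarrow> \<exists>\<alpha>\<in>I. p \<in> U \<alpha>"
  using cocycle by (auto simp: haefliger_cocycle_def)

text \<open>
  Applying the condition that products are composable to repeated indices already identifies sources
  and ranges: \<open>h \<beta> \<beta> x\<close> must be composable with itself.
\<close>

lemma germ_source_cocycle:
  assumes "\<alpha> \<in> I" "\<beta> \<in> I" "x \<in> U \<alpha> \<inter> U \<beta>"
  shows "germ_source (h \<alpha> \<beta> x) = f \<beta> x" "germ_range (h \<alpha> \<beta> x) = f \<alpha> x"
proof -
  have *: "germ_source (h \<alpha> \<beta> x) = germ_range (h \<beta> \<delta> x)"
    if "\<alpha> \<in> I" "\<beta> \<in> I" "\<delta> \<in> I" "x \<in> U \<alpha> \<inter> U \<beta> \<inter> U \<delta>" for \<alpha> \<beta> \<delta>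
    using cocycle that unfolding haefliger_cocycle_def by blast
  show "germ_source (h \<alpha> \<beta> x) = f \<beta> x" "germ_range (h \<alpha> \<beta> x) = f \<alpha> x"
    using *[of \<alpha> \<beta> \<beta>] *[of \<beta> \<beta> \<beta>] *[of \<alpha> \<alpha> \<beta>] assms by (simp_all add: haefliger_chart_def)
qed

text \<open>
  A map into the germ space that is continuous at \<^term>\<open>x\<close> takes values near \<^term>\<open>x\<close> in a single basic
  open set, that is, in the germs of one local diffeomorphism.
\<close>

lemma local_germ_representative:
  assumes \<alpha>: "\<alpha> \<in> I" and \<beta>: "\<beta> \<in> I" and x: "x \<in> U \<alpha> \<inter> U \<beta>"
  shows "\<exists>N g A. openin (mtop M) N \<and> x \<in> N \<and> N \<subseteq> U \<alpha> \<inter> U \<beta> \<and> local_diffeo Q A g \<and>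
    (\<forall>y\<in>N. h \<alpha> \<beta> y \<in> germ_at Q g ` A \<and> f \<beta> y \<in> A \<and> f \<alpha> y = g (f \<beta> y))"
proof -
  let ?W = "U \<alpha> \<inter> U \<beta>" and ?S = "{germ_at Q g ` U | g U. local_diffeo Q U g}"
  have op: "openin (mtop M) ?W"
    using openin_U[OF \<alpha>] openin_U[OF \<beta>] by blast
  then have top: "topspace (subtopology (mtop M) ?W) = ?W"
    using openin_subset[OF op] by (simp add: topspace_subtopology Int_absorb1)
  have cont: "continuous_map (subtopology (mtop M) ?W) (topology_generated_by ?S) (h \<alpha> \<beta>)"
    using cocycle \<alpha> \<beta> by (simp add: haefliger_cocycle_def smooth_map_on_def Gamma_def)
  then have "h \<alpha> \<beta> x \<in> topspace (topology_generated_by ?S)"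
    using x top continuous_map_image_subset_topspace by blast
  then have "h \<alpha> \<beta> x \<in> \<Union>?S"
    by (simp only: topology_generated_by_topspace)
  then obtain g A where g: "local_diffeo Q A g" "h \<alpha> \<beta> x \<in> germ_at Q g ` A"
    by blast
  have "germ_at Q g ` A \<in> ?S"
    using g(1) by blast
  then have "openin (topology_generated_by ?S) (germ_at Q g ` A)"
    by (rule topology_generated_by_Basis)
  from openin_continuous_map_preimage[OF cont this]
  have "openin (subtopology (mtop M) ?W) {y \<in> ?W. h \<alpha> \<beta> y \<in> germ_at Q g ` A}"
    by (simp only: top)
  then have N: "openin (mtop M) {y \<in> ?W. h \<alpha> \<beta> y \<in> germ_at Q g ` A}"
    using op openin_trans_full by blast
  have "f \<beta> y \<in> A \<and> f \<alpha> y = g (f \<beta> y)" if y: "y \<in> ?W" "h \<alpha> \<beta> y \<in> germ_at Q g ` A" for y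
  proof -
    obtain z where z: "z \<in> A" "h \<alpha> \<beta> y = germ_at Q g z"
      using y(2) by blast
    have "f \<beta> y = z"
      using germ_source_cocycle(1)[OF \<alpha> \<beta> y(1)] z(2) by (simp add: germ_source_def germ_at_def)
    moreover have "z \<in> span Q"
      using g(1) z(1) openin_coord_subset unfolding local_diffeo_def by blast
    then have "f \<alpha> y = g z"
      using germ_source_cocycle(2)[OF \<alpha> \<beta> y(1)] z(2) by (simp add: germ_range_germ_at)
    ultimately show ?thesis
      using z(1) by simp
  qed
  with N g x show ?thesis
    by (intro exI[of _ "{y \<in> ?W. h \<alpha> \<beta> y \<in> germ_at Q g ` A}"] exI[of _ g] exI[of _ A]) auto
qed

lemma smooth_haefliger_chart:
  assumes \<alpha>: "\<alpha> \<in> I"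
  shows "smooth_fun_on M (U \<alpha>) (f \<alpha>)"
proof (rule smooth_fun_onI[OF openin_U[OF \<alpha>]])
  fix x assume x: "x \<in> U \<alpha>"
  obtain N g A where N: "openin (mtop M) N" "x \<in> N" "N \<subseteq> U \<alpha>" "local_diffeo Q A g"
    "\<And>y. y \<in> N \<Longrightarrow> h \<alpha> \<alpha> y \<in> germ_at Q g ` A"
    using local_germ_representative[OF \<alpha> \<alpha>, of x] x by blast
  obtain c where c: "c \<in> atlas M" "x \<in> fst c"
    using chart_around[OF openin_points[OF N(1,2)]] by blast
  let ?d = "(germ_at Q g ` A, germ_source :: 'q germ \<Rightarrow> 'q)"
  have "?d \<in> atlas (Gamma Q)"
    using N(4) by (auto simp: Gamma_def)
  moreover have "smooth_map_on M (U \<alpha> \<inter> U \<alpha>) (Gamma Q) (h \<alpha> \<alpha>)"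
    using cocycle \<alpha> unfolding haefliger_cocycle_def by blast
  ultimately have "smooth_on B (snd c ` {p \<in> U \<alpha> \<inter> U \<alpha> \<inter> fst c. h \<alpha> \<alpha> p \<in> fst ?d})
      (snd ?d \<circ> h \<alpha> \<alpha> \<circ> chart_inv c)"
    unfolding smooth_map_on_def using c(1) by blast
  then have "smooth_on B (snd c ` (N \<inter> fst c)) (snd ?d \<circ> h \<alpha> \<alpha> \<circ> chart_inv c)"
    by (rule smooth_on_subset) (use N in auto)
  moreover have "snd ?d \<circ> h \<alpha> \<alpha> \<circ> chart_inv c = f \<alpha> \<circ> chart_inv c"
    by (auto simp: haefliger_chart_def)
  ultimately show "\<exists>c W. c \<in> atlas M \<and> openin (mtop M) W \<and> x \<in> W \<and> W \<subseteq> fst c \<and>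
      smooth_on B (snd c ` W) (f \<alpha> \<circ> chart_inv c)"
    using c N(1,2) openin_chart[OF c(1)]
    by (intro exI[of _ c] exI[of _ "N \<inter> fst c"]) auto
qed

lemma haefliger_chart_in_span: "\<alpha> \<in> I \<Longrightarrow> x \<in> U \<alpha> \<Longrightarrow> f \<alpha> x \<in> span Q"
  using local_germ_representative[of \<alpha> \<alpha> x] openin_coord_subset unfolding local_diffeo_def by blast

lemma haefliger_differential_in_span:
  assumes \<alpha>: "\<alpha> \<in> I" and p: "p \<in> U \<alpha>" and \<xi>: "\<xi> \<in> tangent_space M p"
  shows "fun_differential M (f \<alpha>) p \<xi> \<in> span Q"
proof -
  obtain c where c: "c \<in> charts_at M p"
    using charts_cover[OF openin_points[OF openin_U[OF \<alpha>] p]] by blast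
  then have c': "c \<in> atlas M" "p \<in> fst c"
    by (auto simp: charts_at_def)
  let ?A = "snd c ` (U \<alpha> \<inter> fst c)"
  have sm: "smooth_on B ?A (f \<alpha> \<circ> chart_inv c)"
    using smooth_haefliger_chart[OF \<alpha>] c' by (simp add: smooth_fun_on_def)
  have "deriv_along B (f \<alpha> \<circ> chart_inv c) (snd c p) (\<xi> c) \<in> span Q"
    by (rule deriv_along_in_span[OF openin_chart_image[OF c'(1) openin_U[OF \<alpha>]] Q_Basis])
      (use p c' smooth_on_differentiable[OF sm] tangent_space_span[OF \<xi> c] haefliger_chart_in_span[OF \<alpha>]
        in \<open>auto simp: chart_inv_chart[OF c'(1)]\<close>)
  then show ?thesis
    using fun_differential_eq[OF smooth_haefliger_chart[OF \<alpha>] p openin_U[OF \<alpha>] \<xi> c] by simp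
qed

lemma haefliger_differential_change:
  assumes \<alpha>: "\<alpha> \<in> I" and \<beta>: "\<beta> \<in> I" and N: "openin (mtop M) N" "N \<subseteq> U \<alpha> \<inter> U \<beta>"
    and A: "openin (coord_top Q) A" and g: "smooth_on Q A g"
    and rep: "\<And>y. y \<in> N \<Longrightarrow> f \<beta> y \<in> A \<and> f \<alpha> y = g (f \<beta> y)"
    and q: "q \<in> N" and \<xi>: "\<xi> \<in> tangent_space M q"
  shows "fun_differential M (f \<alpha>) q \<xi> = deriv_along Q g (f \<beta> q) (fun_differential M (f \<beta>) q \<xi>)"
proof -
  have q\<alpha>: "q \<in> U \<alpha>" and q\<beta>: "q \<in> U \<beta>"
    using N q by auto
  obtain c where c: "c \<in> charts_at M q"
    using charts_cover[OF openin_points[OF N(1) q]] by blast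
  then have c': "c \<in> atlas M" "q \<in> fst c"
    by (auto simp: charts_at_def)
  let ?D = "snd c ` (N \<inter> fst c)"
  have op: "openin (coord_top B) ?D"
    by (rule openin_chart_image[OF c'(1) N(1)])
  have y: "snd c q \<in> ?D"
    using q c'(2) by blast
  have sm\<beta>: "smooth_on B (snd c ` (U \<beta> \<inter> fst c)) (f \<beta> \<circ> chart_inv c)"
    using smooth_haefliger_chart[OF \<beta>] c'(1) by (simp add: smooth_fun_on_def)
  have "fun_differential M (f \<alpha>) q \<xi> = deriv_along B (f \<alpha> \<circ> chart_inv c) (snd c q) (\<xi> c)"
    by (rule fun_differential_eq[OF smooth_haefliger_chart[OF \<alpha>] q\<alpha> openin_U[OF \<alpha>] \<xi> c])
  also have "\<dots> = deriv_along B (\<lambda>y. g ((f \<beta> \<circ> chart_inv c) y)) (snd c q) (\<xi> c)"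
    by (rule deriv_along_cong[OF op y]) (use rep in \<open>auto simp: chart_inv_chart[OF c'(1)]\<close>)
  also have "\<dots> = deriv_along Q g ((f \<beta> \<circ> chart_inv c) (snd c q))
      (deriv_along B (f \<beta> \<circ> chart_inv c) (snd c q) (\<xi> c))"
  proof (rule deriv_along_chain[OF op _ y _ _ tangent_space_span[OF \<xi> c]])
    show "(f \<beta> \<circ> chart_inv c) y \<in> span Q" if "y \<in> ?D" for y
      using that rep openin_coord_subset[OF A] by (auto simp: chart_inv_chart[OF c'(1)])
    show "(f \<beta> \<circ> chart_inv c) differentiable (at (snd c q) within span B)"
      by (rule smooth_on_differentiable[OF sm\<beta>]) (use q\<beta> c' in auto)
    show "g differentiable (at ((f \<beta> \<circ> chart_inv c) (snd c q)) within span Q)"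
      by (rule smooth_on_differentiable[OF g]) (use rep q c' in \<open>auto simp: chart_inv_chart[OF c'(1)]\<close>)
  qed
  also have "deriv_along B (f \<beta> \<circ> chart_inv c) (snd c q) (\<xi> c) = fun_differential M (f \<beta>) q \<xi>"
    by (rule fun_differential_eq[OF smooth_haefliger_chart[OF \<beta>] q\<beta> openin_U[OF \<beta>] \<xi> c, symmetric])
  finally show ?thesis
    by (simp add: chart_inv_chart[OF c'])
qed

text \<open>
  Hence the kernel of the differential does not depend on which Haefliger chart is used.
\<close>

lemma haefliger_differential_zero:
  assumes \<alpha>: "\<alpha> \<in> I" and \<beta>: "\<beta> \<in> I" and q: "q \<in> U \<alpha> \<inter> U \<beta>" and \<xi>: "\<xi> \<in> tangent_space M q"
    and zero: "fun_differential M (f \<beta>) q \<xi> = 0"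
  shows "fun_differential M (f \<alpha>) q \<xi> = 0"
proof -
  obtain N g A where N: "openin (mtop M) N" "q \<in> N" "N \<subseteq> U \<alpha> \<inter> U \<beta>" "local_diffeo Q A g"
    and rep: "\<And>y. y \<in> N \<Longrightarrow> f \<beta> y \<in> A \<and> f \<alpha> y = g (f \<beta> y)"
    using local_germ_representative[OF \<alpha> \<beta> q] by blast
  have A: "openin (coord_top Q) A" "smooth_on Q A g"
    using N(4) by (simp_all add: local_diffeo_def)
  have "linear (deriv_along Q g (f \<beta> q))"
    by (rule deriv_along_linear[OF smooth_on_differentiable[OF A(2)]]) (use rep N(2) in blast)
  then show ?thesis
    using haefliger_differential_change[OF \<alpha> \<beta> N(1,3) A rep N(2) \<xi>] zero by (simp add: linear_0)
qed

end


section \<open>The Haefliger sheaf and its distribution\<close>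

context haefliger_structure
begin

abbreviation D where "D \<equiv> haefliger_sheaf M Q I U h"

text \<open>
  A generator is only defined over \<^term>\<open>U \<alpha>\<close>, but cutting it off by a function with support in
  \<^term>\<open>U \<alpha>\<close> gives a section of the ideal over all of \<^term>\<open>W\<close>: over another \<^term>\<open>U \<beta>\<close> it is a combination of the
  generators there, with the partial derivatives of the local diffeomorphism \<open>g\<close> in
  \<open>f \<alpha> = g \<circ> f \<beta>\<close> as coefficients.
\<close>

lemma bump_pullback_in_ideal:
  assumes W: "openin (mtop M) W" and \<alpha>: "\<alpha> \<in> I" and i: "i \<in> Q"
    and C: "closedin (mtop M) C" "C \<subseteq> W \<inter> U \<alpha>"
    and \<theta>: "smooth_fun_on M (points M) \<theta>" "\<And>q. q \<notin> C \<Longrightarrow> \<theta> q = 0"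
  shows "(\<lambda>q \<xi>. \<theta> q * pullback_dx M (f \<alpha>) i q \<xi>) \<in> haefliger_ideal M Q I U h W"
proof -
  note U\<alpha> = openin_U[OF \<alpha>] and f\<alpha> = smooth_haefliger_chart[OF \<alpha>]
  have form: "one_form_on M W (\<lambda>q \<xi>. \<theta> q * pullback_dx M (f \<alpha>) i q \<xi>)"
    unfolding one_form_on_def
  proof (intro conjI ballI allI)
    fix p \<xi> \<eta> assume "p \<in> W" and \<xi>: "\<xi> \<in> tangent_space M p" and \<eta>: "\<eta> \<in> tangent_space M p"
    show "\<theta> p * pullback_dx M (f \<alpha>) i p (\<lambda>c. \<xi> c + \<eta> c) =
        \<theta> p * pullback_dx M (f \<alpha>) i p \<xi> + \<theta> p * pullback_dx M (f \<alpha>) i p \<eta>"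
    proof (cases "p \<in> U \<alpha>")
      case True
      show ?thesis
        using fun_differential_linear(1)[OF f\<alpha> True U\<alpha> \<xi> \<eta>]
        by (simp add: pullback_dx_def inner_add_left distrib_left)
    next
      case False
      then have "p \<notin> C" using C(2) by blast
      then show ?thesis by (simp add: \<theta>(2))
    qed
  next
    fix p \<xi> and a :: real assume "p \<in> W" and \<xi>: "\<xi> \<in> tangent_space M p"
    show "\<theta> p * pullback_dx M (f \<alpha>) i p (\<lambda>c. a *\<^sub>R \<xi> c) = a * (\<theta> p * pullback_dx M (f \<alpha>) i p \<xi>)"
    proof (cases "p \<in> U \<alpha>")
      case True
      show ?thesis
        using fun_differential_linear(2)[OF f\<alpha> True U\<alpha> \<xi>, of a] by (simp add: pullback_dx_def)
    next
      case False
      then have "p \<notin> C" using C(2) by blast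
      then show ?thesis by (simp add: \<theta>(2))
    qed
  next
    fix d b assume d: "d \<in> atlas M" and b: "b \<in> B"
    let ?F = "\<lambda>y. \<theta> (chart_inv d y) *
      pullback_dx M (f \<alpha>) i (chart_inv d y) (tangent_of_coord M d (chart_inv d y) b)"
    show "smooth_on B (snd d ` (W \<inter> fst d)) ?F"
    proof (rule smooth_on_local)
      show "snd d ` (W \<inter> fst d) \<subseteq> span B"
        using chart_image_subset_span[OF d] by auto
      fix y assume "y \<in> snd d ` (W \<inter> fst d)"
      then obtain q where q: "q \<in> W" "q \<in> fst d" "y = snd d q" by auto
      show "\<exists>A'. openin (coord_top B) A' \<and> y \<in> A' \<and> smooth_on B A' ?F"
      proof (cases "q \<in> U \<alpha>")
        case True
        let ?A = "snd d ` (U \<alpha> \<inter> fst d)"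
        have op: "openin (coord_top B) ?A"
          by (rule openin_chart_image[OF d U\<alpha>])
        have "smooth_on B ?A (f \<alpha> \<circ> chart_inv d)"
          using f\<alpha> d by (simp add: smooth_fun_on_def)
        note deriv = smooth_on_bounded_linear_compose[OF op bounded_linear_inner_left
            smooth_on_deriv[OF this b]]
        have "smooth_on B (snd d ` (points M \<inter> fst d)) (\<theta> \<circ> chart_inv d)"
          using \<theta>(1) d unfolding smooth_fun_on_def by blast
        then have "smooth_on B ?A (\<theta> \<circ> chart_inv d)"
          by (rule smooth_on_subset) (use chart_subset[OF d] in auto)
        then have "smooth_on B ?A (\<lambda>y. (\<theta> \<circ> chart_inv d) y * (deriv_along B (f \<alpha> \<circ> chart_inv d) y b \<bullet> i))"
          by (rule smooth_on_mult[OF op _ deriv])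
        also have "?this \<longleftrightarrow> smooth_on B ?A ?F"
        proof (rule smooth_on_cong[OF op])
          fix z assume "z \<in> ?A"
          then obtain q' where q': "q' \<in> U \<alpha>" "q' \<in> fst d" "z = snd d q'" by auto
          have dq: "d \<in> charts_at M q'"
            using d q' by (simp add: charts_at_def)
          have "fun_differential M (f \<alpha>) q' (tangent_of_coord M d q' b) =
              deriv_along B (f \<alpha> \<circ> chart_inv d) (snd d q') b"
            using fun_differential_eq[OF f\<alpha> q'(1) U\<alpha> tangent_of_coord_in[OF dq] dq, of b]
              tangent_of_coord_self[OF dq, of b] span_base[OF b] by simp
          then show "(\<theta> \<circ> chart_inv d) z * (deriv_along B (f \<alpha> \<circ> chart_inv d) z b \<bullet> i) = ?F z"
            using q' chart_inv_chart[OF d q'(2)] by (simp add: pullback_dx_def)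
        qed
        finally show ?thesis
          using op True q by blast
      next
        case False
        let ?A = "snd d ` ((W - C) \<inter> fst d)"
        have op: "openin (coord_top B) ?A"
          by (rule openin_chart_image[OF d openin_diff[OF W C(1)]])
        have "smooth_on B ?A ?F"
          by (subst smooth_on_cong[OF op, of _ "\<lambda>_. 0"])
            (auto simp: chart_inv_chart[OF d] \<theta>(2) intro: smooth_on_const op)
        moreover have "y \<in> ?A"
          using q False C(2) by auto
        ultimately show ?thesis
          using op by blast
      qed
    qed
  qed
  moreover have "\<exists>V a. openin (mtop M) V \<and> x \<in> V \<and> V \<subseteq> W \<inter> U \<beta> \<and> (\<forall>j\<in>Q. smooth_fun_on M V (a j)) \<and>
      (\<forall>p\<in>V. \<forall>\<xi>\<in>tangent_space M p. \<theta> p * pullback_dx M (f \<alpha>) i p \<xi> =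
        (\<Sum>j\<in>Q. a j p * pullback_dx M (f \<beta>) j p \<xi>))"
    if \<beta>: "\<beta> \<in> I" and x: "x \<in> W \<inter> U \<beta>" for \<beta> x
  proof (cases "x \<in> U \<alpha>")
    case True
    obtain N g A where N: "openin (mtop M) N" "x \<in> N" "N \<subseteq> U \<alpha> \<inter> U \<beta>" "local_diffeo Q A g"
      and rep: "\<And>y. y \<in> N \<Longrightarrow> f \<beta> y \<in> A \<and> f \<alpha> y = g (f \<beta> y)"
      using local_germ_representative[OF \<alpha> \<beta>, of x] True x by blast
    have A: "openin (coord_top Q) A" "smooth_on Q A g"
      using N(4) by (simp_all add: local_diffeo_def)
    define V where "V = N \<inter> W"
    have V: "openin (mtop M) V" "V \<subseteq> points M" "V \<subseteq> U \<beta>"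
      using N W openin_subset by (auto simp: V_def)
    define a where "a j q = \<theta> q * (deriv_along Q g (f \<beta> q) j \<bullet> i)" for j q
    have "smooth_fun_on M V (a j)" if j: "j \<in> Q" for j
    proof -
      have "smooth_on Q A (\<lambda>y. deriv_along Q g y j \<bullet> i)"
        by (rule smooth_on_bounded_linear_compose[OF A(1) bounded_linear_inner_left
              smooth_on_deriv[OF A(2) j]])
      then have "smooth_fun_on M V (\<lambda>q. deriv_along Q g (f \<beta> q) j \<bullet> i)"
        by (rule smooth_fun_on_compose[OF V(1) smooth_fun_on_subset[OF smooth_haefliger_chart[OF \<beta>] V(3)]
              A(1) Q_Basis, rotated])
          (use rep in \<open>auto simp: V_def\<close>)
      then show ?thesis
        unfolding a_def by (rule smooth_fun_on_mult[OF V(1) smooth_fun_on_subset[OF \<theta>(1) V(2)]])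
    qed
    moreover have "\<theta> p * pullback_dx M (f \<alpha>) i p \<xi> = (\<Sum>j\<in>Q. a j p * pullback_dx M (f \<beta>) j p \<xi>)"
      if p: "p \<in> V" and \<xi>: "\<xi> \<in> tangent_space M p" for p \<xi>
    proof -
      have pN: "p \<in> N" "p \<in> U \<beta>"
        using p V by (auto simp: V_def)
      have "fun_differential M (f \<alpha>) p \<xi> = deriv_along Q g (f \<beta> p) (fun_differential M (f \<beta>) p \<xi>)"
        by (rule haefliger_differential_change[OF \<alpha> \<beta> N(1,3) A rep pN(1) \<xi>])
      also have "\<dots> = (\<Sum>j\<in>Q. (fun_differential M (f \<beta>) p \<xi> \<bullet> j) *\<^sub>R deriv_along Q g (f \<beta> p) j)"
        by (rule deriv_along_expansion[OF Q_Basis smooth_on_differentiable[OF A(2)]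
              haefliger_differential_in_span[OF \<beta> pN(2) \<xi>]]) (use rep pN in blast)
      finally show ?thesis
        by (simp add: pullback_dx_def a_def inner_sum_left sum_distrib_left mult_ac)
    qed
    ultimately show ?thesis
      using V N(2) x by (intro exI[of _ V] exI[of _ a]) (auto simp: V_def)
  next
    case False
    have V: "openin (mtop M) (W \<inter> U \<beta> - C)"
      by (rule openin_diff[OF openin_Int[OF W openin_U[OF \<beta>]] C(1)])
    have "smooth_fun_on M (W \<inter> U \<beta> - C) (\<lambda>q. 0 :: real)"
      unfolding smooth_fun_on_def o_def using openin_chart_image[OF _ V] by (auto intro: smooth_on_const)
    then show ?thesis
      using V False x C(2) \<theta>(2)
      by (intro exI[of _ "W \<inter> U \<beta> - C"] exI[of _ "\<lambda>_ _. 0"]) auto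
  qed
  ultimately show ?thesis
    unfolding haefliger_ideal_def by blast
qed

text \<open>
  The sheaf is defined through all sections of the ideal over \<^term>\<open>W\<close>, which is not a local condition
  as it stands.  The cut-off generators show that it amounts to being annihilated by the differentials
  of the Haefliger charts, which is local; restriction and gluing follow from this.
\<close>

lemma haefliger_sheaf_iff:
  assumes W: "openin (mtop M) W"
  shows "X \<in> D W \<longleftrightarrow> vector_field_on M W X \<and>
    (\<forall>\<alpha>\<in>I. \<forall>p\<in>W \<inter> U \<alpha>. fun_differential M (f \<alpha>) p (X p) = 0)"
proof (intro iffI conjI ballI)
  assume X: "X \<in> D W"
  then show XW: "vector_field_on M W X"
    by (simp add: haefliger_sheaf_def)
  fix \<alpha> p assume \<alpha>: "\<alpha> \<in> I" and p: "p \<in> W \<inter> U \<alpha>"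
  have Xp: "X p \<in> tangent_space M p"
    using XW p by (simp add: vector_field_on_def)
  have op: "openin (mtop M) (W \<inter> U \<alpha>)"
    by (rule openin_Int[OF W openin_U[OF \<alpha>]])
  obtain \<theta> :: "'m \<Rightarrow> real" and C where C: "closedin (mtop M) C" "C \<subseteq> W \<inter> U \<alpha>"
    and \<theta>: "smooth_fun_on M (points M) \<theta>" "\<theta> p \<noteq> 0" "\<And>q. q \<notin> C \<Longrightarrow> \<theta> q = 0"
    using bump_function[OF Hausdorff op p] by metis
  have "fun_differential M (f \<alpha>) p (X p) \<bullet> i = 0" if i: "i \<in> Q" for i
  proof -
    have "(\<lambda>q \<xi>. \<theta> q * pullback_dx M (f \<alpha>) i q \<xi>) \<in> haefliger_ideal M Q I U h W"
      by (rule bump_pullback_in_ideal[OF W \<alpha> i C \<theta>(1)]) (rule \<theta>(3))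
    moreover have "\<forall>\<omega>\<in>haefliger_ideal M Q I U h W. \<forall>p\<in>W. \<omega> p (X p) = 0"
      using X by (simp add: haefliger_sheaf_def)
    ultimately have "\<theta> p * pullback_dx M (f \<alpha>) i p (X p) = 0"
      using p by fast
    then show ?thesis
      using \<theta>(2) by (simp add: pullback_dx_def)
  qed
  then show "fun_differential M (f \<alpha>) p (X p) = 0"
    using span_coord_expansion[OF Q_Basis haefliger_differential_in_span[OF \<alpha> _ Xp]] p by simp
next
  assume *: "vector_field_on M W X \<and> (\<forall>\<alpha>\<in>I. \<forall>p\<in>W \<inter> U \<alpha>. fun_differential M (f \<alpha>) p (X p) = 0)"
  have "\<omega> p (X p) = 0" if \<omega>: "\<omega> \<in> haefliger_ideal M Q I U h W" and p: "p \<in> W" for \<omega> p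
  proof -
    obtain \<alpha> where \<alpha>: "\<alpha> \<in> I" "p \<in> U \<alpha>"
      using U_cover[OF openin_points[OF W p]] by blast
    then obtain V a where "p \<in> V" "\<forall>q\<in>V. \<forall>\<xi>\<in>tangent_space M q.
        \<omega> q \<xi> = (\<Sum>i\<in>Q. a i q * pullback_dx M (f \<alpha>) i q \<xi>)"
      using \<omega> p unfolding haefliger_ideal_def by blast
    moreover have "X p \<in> tangent_space M p"
      using * p by (simp add: vector_field_on_def)
    moreover have "fun_differential M (f \<alpha>) p (X p) = 0"
      using * \<alpha> p by blast
    ultimately show ?thesis
      by (simp add: pullback_dx_def)
  qed
  with * show "X \<in> D W"
    by (simp add: haefliger_sheaf_def)
qed

lemma haefliger_subsheaf: "vector_field_subsheaf M D"
  unfolding vector_field_subsheaf_def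
proof (intro conjI allI impI)
  show "D W \<subseteq> {X. vector_field_on M W X}" if "openin (mtop M) W" for W
    using haefliger_sheaf_iff[OF that] by blast
  show "Y \<in> D V" if "openin (mtop M) W \<and> openin (mtop M) V \<and> V \<subseteq> W \<and> X \<in> D W \<and> (\<forall>p\<in>V. Y p = X p)"
    for W V X Y
  proof -
    have W: "openin (mtop M) W" and V: "openin (mtop M) V" and VW: "V \<subseteq> W" and X: "X \<in> D W"
      and eq: "\<And>p. p \<in> V \<Longrightarrow> Y p = X p"
      using that by auto
    have "vector_field_on M V X"
      using X haefliger_sheaf_iff[OF W] vector_field_on_subset[OF _ VW] by blast
    then have "vector_field_on M V Y"
      by (rule vector_field_on_cong[OF V]) (rule eq)
    then show ?thesis
      using X haefliger_sheaf_iff[OF W] haefliger_sheaf_iff[OF V] eq VW by auto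
  qed
  show "X \<in> D (\<Union>\<V>)" if "\<forall>V\<in>\<V>. openin (mtop M) V \<and> X \<in> D V" for \<V> X
  proof -
    have *: "openin (mtop M) V \<and> vector_field_on M V X \<and>
        (\<forall>\<alpha>\<in>I. \<forall>p\<in>V \<inter> U \<alpha>. fun_differential M (f \<alpha>) p (X p) = 0)" if "V \<in> \<V>" for V
      using \<open>\<forall>V\<in>\<V>. openin (mtop M) V \<and> X \<in> D V\<close> that haefliger_sheaf_iff[of V X] by blast
    then have "openin (mtop M) (\<Union>\<V>)"
      by (intro openin_Union) blast
    moreover have "vector_field_on M (\<Union>\<V>) X"
      by (rule vector_field_on_Union) (use * in blast)
    ultimately show ?thesis
      unfolding haefliger_sheaf_iff[OF \<open>openin (mtop M) (\<Union>\<V>)\<close>] using * by blast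
  qed
qed

lemma haefliger_distribution_in_chart:
  assumes \<alpha>: "\<alpha> \<in> I" and p: "p \<in> U \<alpha>" and c: "c \<in> charts_at M p"
  shows "haefliger_distribution M Q I U h p = tangent_of_coord M c p `
    kernel_values B (snd c ` (U \<alpha> \<inter> fst c)) (f \<alpha> \<circ> chart_inv c) (snd c p)"
proof -
  have c': "c \<in> atlas M" "p \<in> fst c"
    using c by (auto simp: charts_at_def)
  note U\<alpha> = openin_U[OF \<alpha>] and f\<alpha> = smooth_haefliger_chart[OF \<alpha>]
  show ?thesis
  proof (intro equalityI subsetI)
    fix \<xi> assume "\<xi> \<in> haefliger_distribution M Q I U h p"
    then obtain X V where X: "\<xi> = X p" "openin (mtop M) V" "p \<in> V" "X \<in> D V"
      unfolding haefliger_distribution_def section_values_def by blast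
    have XV: "vector_field_on M V X" "\<And>q. q \<in> V \<inter> U \<alpha> \<Longrightarrow> fun_differential M (f \<alpha>) q (X q) = 0"
      using X(4) haefliger_sheaf_iff[OF X(2)] \<alpha> by blast+
    define Y where "Y y = X (chart_inv c y) c" for y
    have "Y (snd c p) \<in> kernel_values B (snd c ` (U \<alpha> \<inter> fst c)) (f \<alpha> \<circ> chart_inv c) (snd c p)"
    proof (rule kernel_valuesI[where V = "snd c ` (V \<inter> U \<alpha> \<inter> fst c)"])
      show "openin (coord_top B) (snd c ` (V \<inter> U \<alpha> \<inter> fst c))"
        by (rule openin_chart_image[OF c'(1) openin_Int[OF X(2) U\<alpha>]])
      have "smooth_on B (snd c ` (V \<inter> fst c)) Y"
        using XV(1) c'(1) by (simp add: vector_field_on_def Y_def[abs_def])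
      then show "smooth_on B (snd c ` (V \<inter> U \<alpha> \<inter> fst c)) Y"
        by (rule smooth_on_subset) auto
      fix z assume "z \<in> snd c ` (V \<inter> U \<alpha> \<inter> fst c)"
      then obtain q where q: "q \<in> V" "q \<in> U \<alpha>" "q \<in> fst c" "z = snd c q" by auto
      have cq: "c \<in> charts_at M q"
        using q c' by (simp add: charts_at_def)
      have Xq: "X q \<in> tangent_space M q"
        using XV(1) q by (simp add: vector_field_on_def)
      have Yz: "Y z = X q c"
        using q chart_inv_chart[OF c'(1)] by (simp add: Y_def)
      show "Y z \<in> span B"
        using tangent_space_span[OF Xq cq] Yz by simp
      show "deriv_along B (f \<alpha> \<circ> chart_inv c) z (Y z) = 0"
        using fun_differential_eq[OF f\<alpha> q(2) U\<alpha> Xq cq] XV(2)[of q] q Yz by simp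
    qed (use X p c' in auto)
    moreover have "X p \<in> tangent_space M p"
      using XV(1) X(3) by (simp add: vector_field_on_def)
    then have "\<xi> = tangent_of_coord M c p (Y (snd c p))"
      using tangent_space_eq[OF _ c] chart_inv_chart[OF c'] X(1) by (simp add: Y_def)
    ultimately show "\<xi> \<in> tangent_of_coord M c p `
        kernel_values B (snd c ` (U \<alpha> \<inter> fst c)) (f \<alpha> \<circ> chart_inv c) (snd c p)"
      by blast
  next
    fix \<xi> assume "\<xi> \<in> tangent_of_coord M c p `
        kernel_values B (snd c ` (U \<alpha> \<inter> fst c)) (f \<alpha> \<circ> chart_inv c) (snd c p)"
    then obtain v where v: "v \<in> kernel_values B (snd c ` (U \<alpha> \<inter> fst c)) (f \<alpha> \<circ> chart_inv c) (snd c p)"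
      "\<xi> = tangent_of_coord M c p v" by blast
    show "\<xi> \<in> haefliger_distribution M Q I U h p"
    proof (rule kernel_valuesE[OF v(1)])
      fix Y V assume V: "openin (coord_top B) V" "snd c p \<in> V" "V \<subseteq> snd c ` (U \<alpha> \<inter> fst c)"
        and Y: "smooth_on B V Y" "\<And>z. z \<in> V \<Longrightarrow> Y z \<in> span B"
          "\<And>z. z \<in> V \<Longrightarrow> deriv_along B (f \<alpha> \<circ> chart_inv c) z (Y z) = 0" "v = Y (snd c p)"
      define X where "X q = tangent_of_coord M c q (Y (snd c q))" for q
      define W where "W = chart_inv c ` V"
      have Vc: "V \<subseteq> snd c ` fst c"
        using V(3) by blast
      have W: "openin (mtop M) W"
        unfolding W_def by (rule openin_chart_inv_image[OF c'(1) V(1) Vc])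
      have pW: "p \<in> W"
        unfolding W_def using V(2) chart_inv_chart[OF c'] by (metis imageI)
      have Wq: "q \<in> U \<alpha>" "q \<in> fst c" "snd c q \<in> V" if "q \<in> W" for q
        using that V(3) chart_inv_chart[OF c'(1)] by (auto simp: W_def)
      have XW: "vector_field_on M W X"
        unfolding W_def X_def by (rule vector_field_on_tangent_of_coord[OF c'(1) V(1) Vc Y(1,2)])
      have "fun_differential M (f \<beta>) q (X q) = 0" if \<beta>: "\<beta> \<in> I" and q: "q \<in> W \<inter> U \<beta>" for \<beta> q
      proof -
        have cq: "c \<in> charts_at M q"
          using Wq[of q] q c'(1) by (simp add: charts_at_def)
        have Xq: "X q \<in> tangent_space M q"
          using XW q by (simp add: vector_field_on_def)
        have "X q c = Y (snd c q)"
          unfolding X_def by (rule tangent_of_coord_self[OF cq Y(2)]) (use Wq q in auto)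
        then have "fun_differential M (f \<alpha>) q (X q) = 0"
          using fun_differential_eq[OF f\<alpha> _ U\<alpha> Xq cq] Wq[of q] q Y(3)[of "snd c q"] by auto
        then show ?thesis
          by (rule haefliger_differential_zero[OF \<beta> \<alpha> _ Xq, rotated]) (use Wq q in auto)
      qed
      then have "X \<in> D W"
        using haefliger_sheaf_iff[OF W] XW by blast
      moreover have "\<xi> = X p"
        by (simp add: X_def v(2) Y(4))
      ultimately show ?thesis
        unfolding haefliger_distribution_def section_values_def using W pW by blast
    qed
  qed
qed

lemma haefliger_distribution_linear:
  assumes p: "p \<in> points M"
  shows "linear_subspace_at M p (haefliger_distribution M Q I U h p)"
proof -
  obtain \<alpha> where \<alpha>: "\<alpha> \<in> I" "p \<in> U \<alpha>"
    using U_cover[OF p] by blast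
  obtain c where c: "c \<in> charts_at M p"
    using charts_cover[OF p] by blast
  then have c': "c \<in> atlas M" "p \<in> fst c"
    by (auto simp: charts_at_def)
  let ?L = "kernel_values B (snd c ` (U \<alpha> \<inter> fst c)) (f \<alpha> \<circ> chart_inv c) (snd c p)"
  have sub: "subspace ?L"
    by (rule subspace_kernel_values[OF openin_chart_image[OF c'(1) openin_U[OF \<alpha>(1)]]])
      (use smooth_haefliger_chart[OF \<alpha>(1)] \<alpha>(2) c' in \<open>auto simp: smooth_fun_on_def\<close>)
  have span: "v \<in> span B" if "v \<in> ?L" for v
    by (rule kernel_valuesE[OF that]) blast
  show ?thesis
    unfolding haefliger_distribution_in_chart[OF \<alpha> c] linear_subspace_at_def
  proof (intro conjI ballI allI)
    show "tangent_of_coord M c p ` ?L \<subseteq> tangent_space M p"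
      using tangent_of_coord_in[OF c] span by blast
    have "(\<lambda>d. 0 *\<^sub>R tangent_of_coord M c p 0 d) = tangent_of_coord M c p 0"
      using tangent_of_coord_scale[OF c, of 0 0] by simp
    then show "(\<lambda>d. 0) \<in> tangent_of_coord M c p ` ?L"
      using subspace_0[OF sub] by (auto intro: image_eqI)
    fix \<xi> \<eta> assume "\<xi> \<in> tangent_of_coord M c p ` ?L" "\<eta> \<in> tangent_of_coord M c p ` ?L"
    then show "(\<lambda>d. \<xi> d + \<eta> d) \<in> tangent_of_coord M c p ` ?L"
      using tangent_of_coord_add[OF c] subspace_add[OF sub] by auto
  next
    fix r :: real and \<xi> assume "\<xi> \<in> tangent_of_coord M c p ` ?L"
    then show "(\<lambda>d. r *\<^sub>R \<xi> d) \<in> tangent_of_coord M c p ` ?L"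
      using tangent_of_coord_scale[OF c] subspace_scale[OF sub] by auto
  qed
qed

lemma smooth_haefliger_distribution: "smooth_distribution M (haefliger_distribution M Q I U h)"
  unfolding smooth_distribution_def
proof (intro conjI exI[of _ D] ballI haefliger_subsheaf)
  fix p assume p: "p \<in> points M"
  show "linear_subspace_at M p (haefliger_distribution M Q I U h p)"
    by (rule haefliger_distribution_linear[OF p])
  then show "haefliger_distribution M Q I U h p = span_at M p (section_values M D p)"
    unfolding span_at_def haefliger_distribution_def by blast
qed

end


section \<open>Leaves as immersed submanifolds\<close>

lemma paracompact_space_top_of_set:
  "paracompact_space (top_of_set (S :: 'a::euclidean_space set))"
  unfolding paracompact_space_def
proof (intro allI impI)
  fix \<U> :: "'a set set"
  assume \<U>: "(\<forall>U\<in>\<U>. openin (top_of_set S) U) \<and> \<Union>\<U> = topspace (top_of_set S)"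
  have "closedin (top_of_set S) S"
    using closedin_topspace[of "top_of_set S"] by simp
  then obtain \<V> where \<V>: "S \<subseteq> \<Union>\<V>"
    "\<And>V. V \<in> \<V> \<Longrightarrow> openin (top_of_set S) V \<and> (\<exists>T. T \<in> \<U> \<and> V \<subseteq> T)"
    "\<And>x. x \<in> S \<Longrightarrow> \<exists>V. openin (top_of_set S) V \<and> x \<in> V \<and> finite {X. X \<in> \<V> \<and> X \<inter> V \<noteq> {}}"
    by (rule paracompact_closedin[where \<C> = \<U> and U = S]) (use \<U> in auto)
  have "\<Union>\<V> = S"
    using \<V>(1,2) openin_imp_subset by blast
  moreover have "\<forall>V\<in>\<V>. openin (top_of_set S) V \<and> (\<exists>U\<in>\<U>. V \<subseteq> U)"
    using \<V>(2) by blast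
  ultimately show "\<exists>\<V>. (\<forall>V\<in>\<V>. openin (top_of_set S) V \<and> (\<exists>U\<in>\<U>. V \<subseteq> U)) \<and>
      \<Union>\<V> = topspace (top_of_set S) \<and> locally_finite_in (top_of_set S) \<V>"
    using \<V>(3) by (intro exI[of _ \<V>]) (simp add: locally_finite_in_def)
qed

text \<open>
  Leaves carry a topology transported from a coordinate space, so paracompactness has to be
  transported as well.
\<close>

lemma paracompact_space_homeomorphic:
  assumes hom: "homeomorphic_maps X Y f g" and Y: "paracompact_space Y"
  shows "paracompact_space X"
  unfolding paracompact_space_def
proof (intro allI impI)
  have f: "continuous_map X Y f" and g: "continuous_map Y X g"
    and gf: "\<And>x. x \<in> topspace X \<Longrightarrow> g (f x) = x"
    using hom by (auto simp: homeomorphic_maps_def)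
  have fX: "f x \<in> topspace Y" if "x \<in> topspace X" for x
    using continuous_map_image_subset_topspace[OF f] that by blast
  fix \<U> assume \<U>: "(\<forall>U\<in>\<U>. openin X U) \<and> \<Union>\<U> = topspace X"
  define \<U>' where "\<U>' = (\<lambda>U. {y \<in> topspace Y. g y \<in> U}) ` \<U>"
  have gY: "g y \<in> topspace X" if "y \<in> topspace Y" for y
    using continuous_map_image_subset_topspace[OF g] that by blast
  have "\<forall>U\<in>\<U>'. openin Y U"
    using \<U> openin_continuous_map_preimage[OF g] by (auto simp: \<U>'_def)
  moreover have "\<Union>\<U>' = topspace Y"
  proof (intro equalityI subsetI)
    fix y assume y: "y \<in> topspace Y"
    then obtain U where "U \<in> \<U>" "g y \<in> U"
      using gY[OF y] \<U> by blast
    then show "y \<in> \<Union>\<U>'"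
      using y by (auto simp: \<U>'_def)
  qed (auto simp: \<U>'_def)
  ultimately have "(\<forall>U\<in>\<U>'. openin Y U) \<and> \<Union>\<U>' = topspace Y"
    by (rule conjI)
  from mp[OF spec[OF Y[unfolded paracompact_space_def]] this] obtain \<W> where
    "(\<forall>W\<in>\<W>. openin Y W \<and> (\<exists>U\<in>\<U>'. W \<subseteq> U)) \<and> \<Union>\<W> = topspace Y \<and>
     locally_finite_in Y \<W>"
    by (elim exE)
  then have \<W>: "\<And>W. W \<in> \<W> \<Longrightarrow> openin Y W" "\<And>W. W \<in> \<W> \<Longrightarrow> \<exists>U\<in>\<U>'. W \<subseteq> U"
    "\<Union>\<W> = topspace Y" "locally_finite_in Y \<W>"
    by simp_all
  define P where "P W = {x \<in> topspace X. f x \<in> W}" for W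
  have P_open: "openin X (P W)" if "openin Y W" for W
    unfolding P_def by (rule openin_continuous_map_preimage[OF f that])
  show "\<exists>\<V>. (\<forall>V\<in>\<V>. openin X V \<and> (\<exists>U\<in>\<U>. V \<subseteq> U)) \<and> \<Union>\<V> = topspace X \<and> locally_finite_in X \<V>"
  proof (intro exI[of _ "P ` \<W>"] conjI ballI)
    fix V assume "V \<in> P ` \<W>"
    then obtain W where W: "W \<in> \<W>" "V = P W" by blast
    then show "openin X V"
      using \<W>(1) P_open by blast
    obtain U where "U \<in> \<U>" "W \<subseteq> {y \<in> topspace Y. g y \<in> U}"
      using \<W>(2)[OF W(1)] by (auto simp: \<U>'_def)
    then have "V \<subseteq> U"
      using gf by (auto simp: W(2) P_def)
    then show "\<exists>U\<in>\<U>. V \<subseteq> U"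
      using \<open>U \<in> \<U>\<close> by blast
  next
    show cover: "\<Union> (P ` \<W>) = topspace X"
      using \<W>(3) fX by (auto simp: P_def)
    show "locally_finite_in X (P ` \<W>)"
      unfolding locally_finite_in_def
    proof (intro conjI ballI)
      show "\<Union> (P ` \<W>) \<subseteq> topspace X"
        using cover by simp
      fix x assume x: "x \<in> topspace X"
      have "\<exists>V. openin Y V \<and> f x \<in> V \<and> finite {W \<in> \<W>. W \<inter> V \<noteq> {}}"
        using \<W>(4) fX[OF x] by (simp add: locally_finite_in_def)
      then obtain V where V: "openin Y V" "f x \<in> V" "finite {W \<in> \<W>. W \<inter> V \<noteq> {}}"
        by (elim exE conjE)
      have "{U \<in> P ` \<W>. U \<inter> P V \<noteq> {}} \<subseteq> P ` {W \<in> \<W>. W \<inter> V \<noteq> {}}"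
        by (auto simp: P_def)
      then have "finite {U \<in> P ` \<W>. U \<inter> P V \<noteq> {}}"
        using finite_subset V(3) by blast
      then show "\<exists>V. openin X V \<and> x \<in> V \<and> finite {U \<in> P ` \<W>. U \<inter> V \<noteq> {}}"
        using P_open[OF V(1)] x V(2) by (intro exI[of _ "P V"]) (simp add: P_def)
    qed
  qed
qed

text \<open>
  The leaf topology is the one transported from the parameter domain, not the one induced from the
  ambient space, so an injective parametrization suffices and is itself the inverse of the only
  chart.
\<close>

definition parametrized_manifold ::
  "'e::euclidean_space set \<Rightarrow> 'e set \<Rightarrow> ('e \<Rightarrow> 'm) \<Rightarrow> ('m, 'e) manifold" where
  "parametrized_manifold K E g =
     \<lparr> mtop = pullback_topology (g ` E) (inv_into E g) (top_of_set E),
       atlas = {(g ` E, inv_into E g)},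
       axes = K \<rparr>"

locale parametrization =
  fixes K E :: "'e::euclidean_space set" and g :: "'e \<Rightarrow> 'm"
  assumes K_Basis: "K \<subseteq> Basis" and openin_E: "openin (coord_top K) E" and inj_g: "inj_on g E"
begin

abbreviation S where "S \<equiv> parametrized_manifold K E g"
abbreviation inv_g where "inv_g \<equiv> inv_into E g"
abbreviation s where "s \<equiv> (g ` E, inv_g)"

lemma S_simps: "atlas S = {s}" "axes S = K"
  by (simp_all add: parametrized_manifold_def)

lemma inv_g_g: "u \<in> E \<Longrightarrow> inv_g (g u) = u"
  by (rule inv_into_f_f[OF inj_g])

lemma homeomorphic_maps_S: "homeomorphic_maps (mtop S) (top_of_set E) inv_g g"
  unfolding homeomorphic_maps_def
proof (intro conjI ballI)
  have "continuous_map (pullback_topology (g ` E) inv_g (top_of_set E)) (top_of_set E) (id \<circ> inv_g)"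
    by (rule continuous_map_pullback) (rule continuous_map_id)
  then show "continuous_map (mtop S) (top_of_set E) inv_g"
    by (simp add: parametrized_manifold_def)
  have "continuous_map (top_of_set E) (top_of_set E) (inv_g \<circ> g)"
    by (rule continuous_map_eq[OF continuous_map_id]) (simp add: inv_g_g)
  then show "continuous_map (top_of_set E) (mtop S) g"
    unfolding parametrized_manifold_def by (simp, intro continuous_map_pullback') auto
qed (auto simp: parametrized_manifold_def topspace_pullback_topology inv_g_g)

lemma points_S: "points S = g ` E"
  by (auto simp: parametrized_manifold_def topspace_pullback_topology inv_g_g)

lemma chart_inv_S: "u \<in> E \<Longrightarrow> chart_inv s u = g u"
  unfolding chart_inv_def fst_conv snd_conv
  by (rule inv_into_f_eq) (auto simp: inv_g_g inj_on_def)

lemma chart_image_S: "snd s ` fst s = E"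
  by (auto simp: inv_g_g image_image)

lemma smooth_structure_S: "smooth_structure S"
  unfolding smooth_structure_def S_simps
proof (intro conjI ballI)
  show "\<Union> (fst ` {s}) = points S"
    by (simp add: points_S)
  fix c assume c: "c \<in> {s}"
  show "openin (mtop S) (fst c)"
    using c openin_topspace[of "mtop S"] by (simp add: points_S)
  show "openin (coord_top K) (snd c ` fst c)"
    using c chart_image_S openin_E by simp
  have "subtopology (mtop S) (g ` E) = mtop S"
    by (rule subtopology_superset) (simp add: points_S)
  then show "homeomorphic_map (subtopology (mtop S) (fst c)) (top_of_set (snd c ` fst c)) (snd c)"
    using c homeomorphic_maps_S chart_image_S homeomorphic_map_maps by fastforce
  fix d assume d: "d \<in> {s}"
  have "smooth_on K E (snd s \<circ> chart_inv s) \<longleftrightarrow> smooth_on K E (\<lambda>u. u)"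
    by (rule smooth_on_cong[OF openin_E]) (simp add: chart_inv_S inv_g_g)
  then show "smooth_on K (snd c ` (fst c \<inter> fst d)) (snd d \<circ> chart_inv c)"
    using c d chart_image_S smooth_on_id[OF openin_E] by simp
qed (rule K_Basis)

lemma smooth_manifold_S:
  assumes "connected E"
  shows "smooth_manifold S"
  unfolding smooth_manifold_def
proof (intro conjI smooth_structure_S)
  have hom: "mtop S homeomorphic_space top_of_set E"
    using homeomorphic_maps_S homeomorphic_space_def by blast
  show "connected_space (mtop S)"
    using homeomorphic_connected_space[OF hom] assms by (simp add: connected_space_subtopology)
  show "Hausdorff_space (mtop S)"
    using homeomorphic_Hausdorff_space[OF hom] by (simp add: Hausdorff_space_subtopology)
  show "paracompact_space (mtop S)"
    by (rule paracompact_space_homeomorphic[OF homeomorphic_maps_S paracompact_space_top_of_set])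
qed

end

text \<open>
  The setting in which a leaf found in the coordinates of one chart becomes a submanifold.
\<close>

locale local_parametrization = smooth_space M + parametrization K E g
  for M :: "('m, 'e::euclidean_space) manifold" and K E :: "'e set" and g :: "'e \<Rightarrow> 'm" +
  fixes c :: "('m, 'e) chart" and \<Psi> :: "'e \<Rightarrow> 'e"
  assumes c: "c \<in> atlas M" and \<Psi>_in: "\<And>u. u \<in> E \<Longrightarrow> \<Psi> u \<in> snd c ` fst c"
    and smooth_\<Psi>: "smooth_on K E \<Psi>" and g_eq: "\<And>u. u \<in> E \<Longrightarrow> g u = chart_inv c (\<Psi> u)"
begin

sublocale S: smooth_space S
  by unfold_locales (rule smooth_structure_S)

lemma g_in: "u \<in> E \<Longrightarrow> g u \<in> fst c"
  using chart_inv_in[OF \<Psi>_in] by (simp add: g_eq)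

lemma chart_g: "u \<in> E \<Longrightarrow> snd c (g u) = \<Psi> u"
  using chart_chart_inv[OF \<Psi>_in] by (simp add: g_eq)

lemma chart_inv_S_eq: "u \<in> E \<Longrightarrow> chart_inv s u = chart_inv c (\<Psi> u)"
  by (rule trans[OF chart_inv_S g_eq])

lemma continuous_g: "continuous_map (top_of_set E) (mtop M) g"
proof -
  have "continuous_map (top_of_set E) (top_of_set (snd c ` fst c)) \<Psi>"
    using smooth_on_continuous[OF smooth_\<Psi>] \<Psi>_in by auto
  from continuous_map_compose[OF this continuous_chart_inv[OF c]] show ?thesis
    by (rule continuous_map_eq) (simp add: g_eq)
qed

lemma openin_E_chart: "d \<in> atlas M \<Longrightarrow> openin (coord_top K) {u \<in> E. g u \<in> fst d}"
  using openin_continuous_map_preimage[OF continuous_g openin_chart] openin_trans[OF _ openin_E] by simp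

lemma smooth_inclusion: "smooth_map_on S (points S) M (\<lambda>x. x)"
  unfolding smooth_map_on_def S_simps
proof (intro conjI ballI)
  have "continuous_map (mtop S) (mtop M) (g \<circ> inv_g)"
    using homeomorphic_maps_S continuous_g continuous_map_compose unfolding homeomorphic_maps_def by blast
  then have "continuous_map (mtop S) (mtop M) (\<lambda>x. x)"
    by (rule continuous_map_eq) (auto simp: points_S inv_g_g)
  then show "continuous_map (subtopology (mtop S) (points S)) (mtop M) (\<lambda>x. x)"
    by simp
  fix c' d assume c': "c' \<in> {s}" and d: "d \<in> atlas M"
  let ?E = "{u \<in> E. g u \<in> fst d}"
  have "inv_g ` {p \<in> g ` E \<inter> g ` E. p \<in> fst d} = ?E"
    using inv_g_g by (force)
  then have dom: "snd c' ` {p \<in> points S \<inter> fst c'. p \<in> fst d} = ?E"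
    using c' by (simp add: points_S)
  have "smooth_on K ?E (\<lambda>u. transition c d (\<Psi> u))"
  proof (rule smooth_on_compose[OF openin_E_chart[OF d] openin_overlap[OF c d] axes_Basis _ _
        smooth_transition[OF c d]])
    show "\<Psi> u \<in> snd c ` (fst c \<inter> fst d)" if "u \<in> ?E" for u
      using that g_in[of u] chart_g[of u] by (intro image_eqI[of _ _ "g u"]) auto
    show "smooth_on K ?E \<Psi>"
      by (rule smooth_on_subset[OF smooth_\<Psi>]) auto
  qed
  also have "?this \<longleftrightarrow> smooth_on K ?E (snd d \<circ> (\<lambda>x. x) \<circ> chart_inv c')"
    by (rule smooth_on_cong[OF openin_E_chart[OF d]]) (use c' chart_inv_S_eq in auto)
  finally show "smooth_on K (snd c' ` {p \<in> points S \<inter> fst c'. p \<in> fst d}) (snd d \<circ> (\<lambda>x. x) \<circ> chart_inv c')"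
    using dom by simp
qed

lemma s_in_charts: "u \<in> E \<Longrightarrow> s \<in> charts_at S (g u)"
  by (auto simp: charts_at_def S_simps)

lemma c_in_charts: "u \<in> E \<Longrightarrow> c \<in> charts_at M (g u)"
  using g_in c by (simp add: charts_at_def)

text \<open>
  In coordinates the inclusion is \<^term>\<open>\<Psi>\<close>.
\<close>

lemma map_differential_inclusion:
  assumes u: "u \<in> E" and \<xi>: "\<xi> \<in> tangent_space S (g u)"
  shows "map_differential S M (\<lambda>x. x) (g u) \<xi> =
    tangent_of_coord M c (g u) (deriv_along K \<Psi> u (\<xi> s))"
proof
  fix d
  have "charts_at S (g u) = {s}"
    using u by (auto simp: charts_at_def S_simps)
  then have s: "chart_at S (g u) = s"
    unfolding chart_at_def by simp
  have \<xi>s: "\<xi> s \<in> span K"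
    using S.tangent_space_span[OF \<xi> s_in_charts[OF u]] by (simp add: S_simps)
  show "map_differential S M (\<lambda>x. x) (g u) \<xi> d = tangent_of_coord M c (g u) (deriv_along K \<Psi> u (\<xi> s)) d"
  proof (cases "d \<in> charts_at M (g u)")
    case True
    then have d: "d \<in> atlas M" "g u \<in> fst d"
      by (auto simp: charts_at_def)
    let ?E = "{u \<in> E. g u \<in> fst d}"
    have uE: "u \<in> ?E"
      using u d by simp
    have "deriv_along K (snd d \<circ> (\<lambda>x. x) \<circ> chart_inv s) u (\<xi> s) =
        deriv_along K (\<lambda>u. transition c d (\<Psi> u)) u (\<xi> s)"
      by (rule deriv_along_cong[OF openin_E_chart[OF d(1)] uE]) (auto simp: chart_inv_S_eq)
    also have "\<dots> = deriv_along B (transition c d) (\<Psi> u) (deriv_along K \<Psi> u (\<xi> s))"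
    proof (rule deriv_along_chain[OF openin_E_chart[OF d(1)] _ uE _ _ \<xi>s])
      show "\<Psi> y \<in> span B" if "y \<in> ?E" for y
        using that \<Psi>_in[of y] chart_image_subset_span[OF c] by auto
      show "\<Psi> differentiable (at u within span K)"
        by (rule smooth_on_differentiable[OF smooth_\<Psi> u])
      show "transition c d differentiable (at (\<Psi> u) within span B)"
        using transition_differentiable[OF c_in_charts[OF u] True] chart_g[OF u] by simp
    qed
    finally show ?thesis
      using True chart_g[OF u] inv_g_g[OF u]
      by (simp add: map_differential_def s Let_def tangent_of_coord_def S_simps)
  next
    case False
    then show ?thesis
      by (simp add: map_differential_def tangent_of_coord_def Let_def)
  qed
qed

lemma map_differential_inclusion_image:
  assumes u: "u \<in> E"
  shows "map_differential S M (\<lambda>x. x) (g u) ` tangent_space S (g u) =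
    tangent_of_coord M c (g u) ` deriv_along K \<Psi> u ` span K"
proof (intro equalityI subsetI)
  fix \<eta> assume "\<eta> \<in> map_differential S M (\<lambda>x. x) (g u) ` tangent_space S (g u)"
  then obtain \<xi> where \<xi>: "\<xi> \<in> tangent_space S (g u)" "\<eta> = map_differential S M (\<lambda>x. x) (g u) \<xi>"
    by blast
  then have "\<eta> = tangent_of_coord M c (g u) (deriv_along K \<Psi> u (\<xi> s))"
    using map_differential_inclusion[OF u] by blast
  moreover have "\<xi> s \<in> span K"
    using S.tangent_space_span[OF \<xi>(1) s_in_charts[OF u]] by (simp add: S_simps)
  ultimately show "\<eta> \<in> tangent_of_coord M c (g u) ` deriv_along K \<Psi> u ` span K"
    by blast
next
  fix \<eta> assume "\<eta> \<in> tangent_of_coord M c (g u) ` deriv_along K \<Psi> u ` span K"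
  then obtain v where v: "v \<in> span K" "\<eta> = tangent_of_coord M c (g u) (deriv_along K \<Psi> u v)"
    by blast
  have vS: "v \<in> span (axes S)"
    using v(1) by (simp add: S_simps)
  have \<xi>: "tangent_of_coord S s (g u) v \<in> tangent_space S (g u)"
    by (rule S.tangent_of_coord_in[OF s_in_charts[OF u] vS])
  have "map_differential S M (\<lambda>x. x) (g u) (tangent_of_coord S s (g u) v) = \<eta>"
    unfolding map_differential_inclusion[OF u \<xi>] S.tangent_of_coord_self[OF s_in_charts[OF u] vS]
    by (simp add: v(2))
  then show "\<eta> \<in> map_differential S M (\<lambda>x. x) (g u) ` tangent_space S (g u)"
    using \<xi> by blast
qed

lemma immersed_inclusion:
  assumes "connected E" "\<And>u. u \<in> E \<Longrightarrow> inj_on (deriv_along K \<Psi> u) (span K)"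
  shows "immersed_submanifold S (\<lambda>x. x) M"
  unfolding immersed_submanifold_def
proof (intro conjI ballI smooth_manifold_S assms(1) smooth_inclusion)
  fix x assume "x \<in> points S"
  then obtain u where u: "u \<in> E" "x = g u"
    by (auto simp: points_S)
  show "inj_on (map_differential S M (\<lambda>x. x) x) (tangent_space S x)"
  proof (rule inj_onI)
    fix \<xi> \<eta> assume \<xi>: "\<xi> \<in> tangent_space S x" and \<eta>: "\<eta> \<in> tangent_space S x"
      and eq: "map_differential S M (\<lambda>x. x) x \<xi> = map_differential S M (\<lambda>x. x) x \<eta>"
    have sp: "\<xi> s \<in> span K" "\<eta> s \<in> span K"
      using S.tangent_space_span[OF _ s_in_charts[OF u(1)]] \<xi> \<eta> u(2) by (simp_all add: S_simps)
    have "deriv_along K \<Psi> u v \<in> span B" if "v \<in> span K" for v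
      by (rule deriv_along_in_span[OF openin_E axes_Basis _ u(1)
            smooth_on_differentiable[OF smooth_\<Psi> u(1)] that])
        (use \<Psi>_in chart_image_subset_span[OF c] in force)
    moreover have "tangent_of_coord M c (g u) (deriv_along K \<Psi> u (\<xi> s)) =
        tangent_of_coord M c (g u) (deriv_along K \<Psi> u (\<eta> s))"
      using eq map_differential_inclusion[OF u(1)] \<xi> \<eta> u(2) by metis
    ultimately have "deriv_along K \<Psi> u (\<xi> s) = deriv_along K \<Psi> u (\<eta> s)"
      using tangent_of_coord_self[OF c_in_charts[OF u(1)]] sp by metis
    then have "\<xi> s = \<eta> s"
      using assms(2)[OF u(1)] sp by (auto dest: inj_onD)
    then show "\<xi> = \<eta>"
      using S.tangent_space_eq[OF _ s_in_charts[OF u(1)]] \<xi> \<eta> u(2) by metis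
  qed
qed simp

end

lemma (in haefliger_structure) haefliger_distribution_integrable:
  "integrable_distribution M (haefliger_distribution M Q I U h)"
  unfolding integrable_distribution_def
proof (intro conjI ballI smooth_haefliger_distribution)
  fix p assume p: "p \<in> points M"
  obtain \<alpha> where \<alpha>: "\<alpha> \<in> I" "p \<in> U \<alpha>"
    using U_cover[OF p] by blast
  obtain c where c: "c \<in> atlas M" "p \<in> fst c"
    using chart_around[OF p] by blast
  let ?A = "snd c ` (U \<alpha> \<inter> fst c)" and ?F = "f \<alpha> \<circ> chart_inv c"
  have A: "openin (coord_top B) ?A"
    by (rule openin_chart_image[OF c(1) openin_U[OF \<alpha>(1)]])
  have F: "smooth_on B ?A ?F"
    using smooth_haefliger_chart[OF \<alpha>(1)] c(1) by (simp add: smooth_fun_on_def)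
  have "snd c p \<in> ?A"
    using \<alpha> c by blast
  from local_leaf_span[OF axes_Basis A F this] obtain K :: "'e set" and r \<Psi> where
    "K \<subseteq> Basis \<and> r > 0 \<and> \<Psi> 0 = snd c p \<and>
     smooth_on K (ball 0 r \<inter> span K) \<Psi> \<and> inj_on \<Psi> (ball 0 r \<inter> span K) \<and>
     (\<forall>u \<in> ball 0 r \<inter> span K. \<Psi> u \<in> ?A \<and> inj_on (deriv_along K \<Psi> u) (span K) \<and>
        deriv_along K \<Psi> u ` span K = kernel_values B ?A ?F (\<Psi> u))"
    by (elim exE)
  then have K: "K \<subseteq> Basis" and r: "r > 0" and \<Psi>0: "\<Psi> 0 = snd c p"
    and \<Psi>: "smooth_on K (ball 0 r \<inter> span K) \<Psi>" "inj_on \<Psi> (ball 0 r \<inter> span K)"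
    and leaf: "\<forall>u \<in> ball 0 r \<inter> span K. \<Psi> u \<in> ?A \<and> inj_on (deriv_along K \<Psi> u) (span K) \<and>
        deriv_along K \<Psi> u ` span K = kernel_values B ?A ?F (\<Psi> u)"
    by blast+
  define E where "E = ball 0 r \<inter> span K"
  note \<Psi> = \<Psi>[folded E_def] and leaf = leaf[folded E_def]
  have openin_E: "openin (coord_top K) E"
    using openin_open_Int[of "ball 0 r" "span K"] by (simp add: E_def Int_commute)
  have \<Psi>_dom: "\<Psi> u \<in> snd c ` fst c" if "u \<in> E" for u
    using leaf that by blast
  have inj: "inj_on (chart_inv c \<circ> \<Psi>) E"
  proof (rule inj_onI)
    fix u u' assume u: "u \<in> E" "u' \<in> E" and eq: "(chart_inv c \<circ> \<Psi>) u = (chart_inv c \<circ> \<Psi>) u'"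
    have "\<Psi> u = snd c (chart_inv c (\<Psi> u))"
      by (rule chart_chart_inv[OF \<Psi>_dom[OF u(1)], symmetric])
    also have "\<dots> = snd c (chart_inv c (\<Psi> u'))"
      using eq by (simp only: o_apply)
    also have "\<dots> = \<Psi> u'"
      by (rule chart_chart_inv[OF \<Psi>_dom[OF u(2)]])
    finally have "\<Psi> u = \<Psi> u'" .
    then show "u = u'"
      using \<Psi>(2) u by (auto dest: inj_onD)
  qed
  define g where "g = chart_inv c \<circ> \<Psi>"
  interpret L: local_parametrization M K E g c \<Psi>
    by unfold_locales (use K openin_E inj c(1) \<Psi>_dom \<Psi>(1) in \<open>auto simp: g_def\<close>)
  have conn: "connected E"
    unfolding E_def by (intro convex_connected convex_Int convex_ball subspace_imp_convex subspace_span)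
  have imm: "immersed_submanifold L.S (\<lambda>x. x) M"
    by (rule L.immersed_inclusion[OF conn]) (use leaf in blast)
  have "map_differential L.S M (\<lambda>x. x) x ` tangent_space L.S x = haefliger_distribution M Q I U h x"
    if x: "x \<in> points L.S" for x
  proof -
    obtain u where u: "u \<in> E" "x = g u"
      using x by (auto simp: L.points_S)
    have "snd c x \<in> ?A"
      using leaf u(1) L.chart_g[OF u(1)] u(2) by auto
    then have "x \<in> U \<alpha>"
      using L.g_in[OF u(1)] u(2) inj_chart[OF c(1)] by (auto dest: inj_onD)
    from haefliger_distribution_in_chart[OF \<alpha>(1) this] show ?thesis
      using L.map_differential_inclusion_image[OF u(1)] L.c_in_charts[OF u(1)] L.chart_g[OF u(1)] leaf u
      by metis
  qed
  with imm have "integral_submanifold M (haefliger_distribution M Q I U h) L.S (\<lambda>x. x)"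
    by (simp add: integral_submanifold_def)
  moreover have "p \<in> (\<lambda>x. x) ` points L.S"
  proof -
    have "0 \<in> E"
      using r by (simp add: E_def span_zero)
    then have "g 0 \<in> points L.S"
      by (auto simp: L.points_S)
    then show ?thesis
      using chart_inv_chart[OF c] by (simp add: \<Psi>0 g_def)
  qed
  ultimately show "\<exists>(S :: ('m, 'e) manifold) \<iota>.
      integral_submanifold M (haefliger_distribution M Q I U h) S \<iota> \<and> p \<in> \<iota> ` points S"
    by blast
qed

theorem propositionA2:
  fixes M :: "('m, 'e::euclidean_space) manifold"
    and Q :: "'q::euclidean_space set"
    and I :: "'i set"
    and U :: "'i \<Rightarrow> 'm set"
    and h :: "'i \<Rightarrow> 'i \<Rightarrow> 'm \<Rightarrow> 'q germ"
  assumes "smooth_manifold M"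
    and "Q \<subseteq> Basis"
    and "haefliger_cocycle M Q I U h"
  shows "integrable_distribution M (haefliger_distribution M Q I U h)"
proof -
  interpret haefliger_structure M Q I U h
    by unfold_locales (use assms in \<open>auto simp: smooth_manifold_def\<close>)
  show ?thesis
    by (rule haefliger_distribution_integrable)
qed

end
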